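(* Suppose the following hold. (i) There is a constant $c_\pi>0$ such that $0\le \pi(x),\sigma^2(x)\le c_\pi$ for all $x\in\mathcal{X}$. (ii) $c_\varphi:=\sup_{j\ge1}\|\varphi_j\|_{\sup}<\infty$ and $\sup_{k\ge1}\frac{\sum_{\nu=k+1}^\infty\mu_\nu}{k\mu_k}<\infty$. (iii) There exist nonnegative constants $a,b$ such that $\max_{1\le j\le s}\xi_j=O_P\left(\sqrt{\frac{\log^b N}{nh^a}}\right)$. (iv) $\log^b N=o(nh^a)$ with the $a,b$ of (iii). Let $f_0\in\mathcal{H}$ be the true regression function, i.e. the model holds with $f=f_0$. Then, with probability approaching one as $N\to\infty$, $$E\Big\{\Big\|\bar f-\frac1N\sum_{i=1}^N\epsilon_iK_{X_i}-f_0+\mathcal{P}_\lambda f_0\Big\|^2\,\Big|\,\mathbf{X}\Big\}\le 4\left(\frac{c_\pi c_\varphi^2}{Nh}+\lambda\|f_0\|_{\mathcal{H}}^2\right)\max_{1\le j\le s}\xi_j^2,$$ $$E\{\|\bar f-f_0\|^2\mid\mathbf{X}\}\le\frac{4c_\pi c_\varphi^2}{Nh}+8\lambda\|f_0\|_{\mathcal{H}}^2 .$$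
   Context: Model: $(Y_i,X_i)$, $i=1,\dots,N$, are i.i.d. from $Y_i=f(X_i)+\epsilon_i$, with $E\{\epsilon_i|X_i\}=0$, $E\{\epsilon_i^2|X_i\}=\sigma^2(X_i)>0$, $X_i\in\mathcal{X}\subseteq\mathbb{R}^d$ with distribution (density) $\pi$, $Y_i\in\mathbb{R}$, and $f\in\mathcal{H}$ unknown. RKHS: $\mathcal{H}\subset L^2_\pi(\mathcal{X})$ is a reproducing kernel Hilbert space with inner product $\langle\cdot,\cdot\rangle_{\mathcal{H}}$ and kernel $R(x,x')=\sum_{i\ge1}\mu_i\varphi_i(x)\varphi_i(x')$, $\mu_1\ge\mu_2\ge\cdots\ge0$, where $\{\varphi_i\}$ is a basis of $L^2_\pi(\mathcal{X})$ with $\langle\varphi_i,\varphi_j\rangle_{L^2_\pi}=\delta_{ij}$ and $\langle\varphi_i,\varphi_j\rangle_{\mathcal{H}}=\delta_{ij}/\mu_i$. For $\lambda>0$ define $\langle f,g\rangle=V(f,g)+\lambda\langle f,g\rangle_{\mathcal{H}}$, $V(f,g)=E\{f(X)g(X)\}$, with norm $\|\cdot\|$; $(\mathcal{H},\langle\cdot,\cdot\rangle)$ is an RKHS with kernel $K(x,y)=\sum_{\nu\ge1}\frac{\varphi_\nu(x)\varphi_\nu(y)}{1+\lambda/\mu_\nu}$, and $K_x=K(x,\cdot)$. $\mathcal{P}_\lambda:\mathcal{H}\to\mathcal{H}$ is the self-adjoint operator with $\langle\mathcal{P}_\lambda f,g\rangle=\lambda\langle f,g\rangle_{\mathcal{H}}$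 for all $f,g\in\mathcal{H}$. $h^{-1}:=\sum_{\nu\ge1}\frac{1}{1+\lambda/\mu_\nu}$. $\|f\|_{\sup}=\sup_{x\in\mathcal{X}}|f(x)|$. Divide and conquer: the $N$ samples are randomly divided into $s$ subsamples with index sets $I_1,\dots,I_s$, $|I_j|=n$, $N=ns$. $\widehat f_j=\arg\min_{f\in\mathcal{H}}\frac1{2n}\sum_{i\in I_j}(Y_i-f(X_i))^2+\frac\lambda2\|f\|_{\mathcal{H}}^2$ and $\bar f=\frac1s\sum_{j=1}^s\widehat f_j$. $\mathbf{X}_j=\{X_i:i\in I_j\}$, $\mathbf{X}=\{\mathbf{X}_1,\dots,\mathbf{X}_s\}$. Empirical process: $Pf=E_X\{f(X)\}$, $P_jf=n^{-1}\sum_{i\in I_j}f(X_i)$, $\xi_j=\sup_{f,g\in\mathcal{H},\,\|f\|=\|g\|=1}|P_jfg-Pfg|$. The quantities $s,n,\lambda,h$ depend on $N$; asymptotics are as $N\to\infty$. *)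

theory Defs
  imports "HOL-Probability.Probability" "HOL-Library.Landau_Symbols"
begin

text \<open>
  Functions on the domain \<open>D\<close> (the set of covariate values) are represented by functions on the
  whole type that vanish off \<open>D\<close>. Sequences indexed by $1, 2, \ldots$ are functions on
  \<^typ>\<open>nat\<close> whose value at \<open>0\<close> is never used.
\<close>

section \<open>The function space\<close>

definition law :: "('a::euclidean_space \<Rightarrow> real) \<Rightarrow> 'a measure" where
  "law dens = density lborel (\<lambda>x. ennreal (dens x))"

definition L2 :: "('a::euclidean_space \<Rightarrow> real) \<Rightarrow> ('a \<Rightarrow> real) set" where
  "L2 dens = {f \<in> borel_measurable borel. integrable (law dens) (\<lambda>x. (f x)\<^sup>2)}"

definition V :: "('a::euclidean_space \<Rightarrow> real) \<Rightarrow> ('a \<Rightarrow> real) \<Rightarrow> ('a \<Rightarrow> real) \<Rightarrow> real" where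
  "V dens f g = (LINT x|law dens. f x * g x)"

definition sup_norm :: "'a set \<Rightarrow> ('a \<Rightarrow> real) \<Rightarrow> ennreal" where
  "sup_norm D f = (SUP x\<in>D. ennreal \<bar>f x\<bar>)"

locale rkhs =
  fixes D :: "'a set" and H :: "('a \<Rightarrow> real) set"
    and ip :: "('a \<Rightarrow> real) \<Rightarrow> ('a \<Rightarrow> real) \<Rightarrow> real"
    and R :: "'a \<Rightarrow> 'a \<Rightarrow> real"
  assumes vanish: "f \<in> H \<Longrightarrow> x \<notin> D \<Longrightarrow> f x = 0"
    and zero_closed: "(\<lambda>x. 0) \<in> H"
    and add_closed: "f \<in> H \<Longrightarrow> g \<in> H \<Longrightarrow> (\<lambda>x. f x + g x) \<in> H"
    and scale_closed: "f \<in> H \<Longrightarrow> (\<lambda>x. c * f x) \<in> H"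
    and ip_commute: "f \<in> H \<Longrightarrow> g \<in> H \<Longrightarrow> ip f g = ip g f"
    and ip_add: "f \<in> H \<Longrightarrow> f' \<in> H \<Longrightarrow> g \<in> H \<Longrightarrow> ip (\<lambda>x. f x + f' x) g = ip f g + ip f' g"
    and ip_scale: "f \<in> H \<Longrightarrow> g \<in> H \<Longrightarrow> ip (\<lambda>x. c * f x) g = c * ip f g"
    and ip_pos: "f \<in> H \<Longrightarrow> f \<noteq> (\<lambda>x. 0) \<Longrightarrow> 0 < ip f f"
    and complete: "(\<And>m. F m \<in> H) \<Longrightarrow>
          (\<And>e. 0 < e \<Longrightarrow> \<exists>M. \<forall>m\<ge>M. \<forall>k\<ge>M.
             sqrt (ip (\<lambda>x. F m x - F k x) (\<lambda>x. F m x - F k x)) < e) \<Longrightarrow>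
          \<exists>f\<in>H. (\<lambda>m. sqrt (ip (\<lambda>x. F m x - f x) (\<lambda>x. F m x - f x))) \<longlonglongrightarrow> 0"
    and kernel_in: "x \<in> D \<Longrightarrow> R x \<in> H"
    and reproducing: "x \<in> D \<Longrightarrow> f \<in> H \<Longrightarrow> ip f (R x) = f x"

definition R_kernel :: "(nat \<Rightarrow> real) \<Rightarrow> (nat \<Rightarrow> 'a \<Rightarrow> real) \<Rightarrow> 'a \<Rightarrow> 'a \<Rightarrow> real" where
  "R_kernel \<mu> \<phi> x y = (\<Sum>i. \<mu> (Suc i) * \<phi> (Suc i) x * \<phi> (Suc i) y)"

text \<open>
  An eigenvalue may be zero. The corresponding \<open>\<phi> i\<close> then has infinite \<open>H\<close>-norm, that is,
  it does not lie in \<open>H\<close>, so the relation $\langle\varphi_i,\varphi_j\rangle_H =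
  \delta_{ij}/\mu_i$ is required for positive eigenvalues.
\<close>

locale mercer_rkhs = rkhs D H ip "R_kernel \<mu> \<phi>"
  for D :: "'a::euclidean_space set" and dens :: "'a \<Rightarrow> real"
    and H :: "('a \<Rightarrow> real) set" and ip :: "('a \<Rightarrow> real) \<Rightarrow> ('a \<Rightarrow> real) \<Rightarrow> real"
    and \<mu> :: "nat \<Rightarrow> real" and \<phi> :: "nat \<Rightarrow> 'a \<Rightarrow> real" +
  assumes H_L2: "H \<subseteq> L2 dens"
    and \<mu>_nonneg: "1 \<le> i \<Longrightarrow> 0 \<le> \<mu> i"
    and \<mu>_decreasing: "1 \<le> i \<Longrightarrow> i \<le> j \<Longrightarrow> \<mu> j \<le> \<mu> i"
    and R_summable: "x \<in> D \<Longrightarrow> y \<in> D \<Longrightarrow>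
          summable (\<lambda>i. \<mu> (Suc i) * \<phi> (Suc i) x * \<phi> (Suc i) y)"
    and \<phi>_vanish: "1 \<le> i \<Longrightarrow> x \<notin> D \<Longrightarrow> \<phi> i x = 0"
    and \<phi>_L2: "1 \<le> i \<Longrightarrow> \<phi> i \<in> L2 dens"
    and \<phi>_orthonormal: "1 \<le> i \<Longrightarrow> 1 \<le> j \<Longrightarrow> V dens (\<phi> i) (\<phi> j) = (if i = j then 1 else 0)"
    and \<phi>_basis: "g \<in> L2 dens \<Longrightarrow>
          (\<lambda>m. LINT x|law dens. (g x - (\<Sum>i=1..m. V dens g (\<phi> i) * \<phi> i x))\<^sup>2) \<longlonglongrightarrow> 0"
    and \<phi>_H: "1 \<le> i \<Longrightarrow> 0 < \<mu> i \<Longrightarrow> \<phi> i \<in> H"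
    and \<phi>_H_orthogonal: "1 \<le> i \<Longrightarrow> 1 \<le> j \<Longrightarrow> 0 < \<mu> i \<Longrightarrow> 0 < \<mu> j \<Longrightarrow>
          ip (\<phi> i) (\<phi> j) = (if i = j then 1 / \<mu> i else 0)"

definition ip_lam where
  "ip_lam dens ip lam f g = V dens f g + lam * ip f g"

definition norm_lam where
  "norm_lam dens ip lam f = sqrt (ip_lam dens ip lam f f)"

text \<open>
  $1/(1+\lambda/\mu)$, which is $0$ for $\mu = 0$ because $\lambda/0$ stands for $\infty$ here
  (HOL division by zero would give $1$ instead).
\<close>

definition shrink :: "real \<Rightarrow> real \<Rightarrow> real" where
  "shrink lam m = (if m = 0 then 0 else 1 / (1 + lam / m))"

definition K_kernel :: "(nat \<Rightarrow> real) \<Rightarrow> (nat \<Rightarrow> 'a \<Rightarrow> real) \<Rightarrow> real \<Rightarrow> 'a \<Rightarrow> 'a \<Rightarrow> real" where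
  "K_kernel \<mu> \<phi> lam x y =
     (\<Sum>\<nu>. \<phi> (Suc \<nu>) x * \<phi> (Suc \<nu>) y * shrink lam (\<mu> (Suc \<nu>)))"

definition bandwidth :: "(nat \<Rightarrow> real) \<Rightarrow> real \<Rightarrow> real" where
  "bandwidth \<mu> lam = inverse (\<Sum>\<nu>. shrink lam (\<mu> (Suc \<nu>)))"

definition P_op where
  "P_op dens H ip lam f =
     (THE p. p \<in> H \<and> (\<forall>g\<in>H. ip_lam dens ip lam p g = lam * ip f g))"


section \<open>The sampling model\<close>

definition noise :: "('a \<Rightarrow> real) \<Rightarrow> (nat \<Rightarrow> 'w \<Rightarrow> 'a) \<Rightarrow> (nat \<Rightarrow> 'w \<Rightarrow> real) \<Rightarrow> nat \<Rightarrow> 'w \<Rightarrow> real" where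
  "noise f X Y i w = Y i w - f (X i w)"

locale regression_model = prob_space M
  for M :: "'w measure" and D :: "'a::euclidean_space set" and dens :: "'a \<Rightarrow> real"
    and sigma2 :: "'a \<Rightarrow> real" and f :: "'a \<Rightarrow> real"
    and X :: "nat \<Rightarrow> 'w \<Rightarrow> 'a" and Y :: "nat \<Rightarrow> 'w \<Rightarrow> real" +
  assumes D_borel: "D \<in> sets borel"
    and dens_support: "x \<notin> D \<Longrightarrow> dens x = 0"
    and indep: "indep_vars (\<lambda>_. borel) (\<lambda>i w. (X i w, Y i w)) {1..}"
    and ident: "1 \<le> i \<Longrightarrow>
          distr M borel (\<lambda>w. (X i w, Y i w)) = distr M borel (\<lambda>w. (X 1 w, Y 1 w))"
    and X_dens: "1 \<le> i \<Longrightarrow> distributed M lborel (X i) (\<lambda>x. ennreal (dens x))"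
    and noise_integrable: "1 \<le> i \<Longrightarrow> integrable M (noise f X Y i)"
    and noise_mean: "1 \<le> i \<Longrightarrow>
          AE w in M. real_cond_exp M (vimage_algebra (space M) (X i) borel) (noise f X Y i) w = 0"
    and noise_var: "1 \<le> i \<Longrightarrow>
          AE w in M. nn_cond_exp M (vimage_algebra (space M) (X i) borel)
                       (\<lambda>w. ennreal ((noise f X Y i w)\<^sup>2)) w = ennreal (sigma2 (X i w))"
    and sigma2_pos: "x \<in> D \<Longrightarrow> 0 < sigma2 x"


section \<open>Divide and conquer\<close>

definition divisions :: "nat \<Rightarrow> nat \<Rightarrow> nat \<Rightarrow> (nat \<Rightarrow> nat set) set" where
  "divisions N s n = {I \<in> {1..s} \<rightarrow>\<^sub>E Pow {1..N}.
     disjoint_family_on I {1..s} \<and> (\<Union>j\<in>{1..s}. I j) = {1..N} \<and> (\<forall>j\<in>{1..s}. card (I j) = n)}"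

text \<open>
  The random division of the sample: its law on the equipartitions is arbitrary (uniform, for
  instance), but it does not depend on the data.
\<close>

definition random_division ::
  "'w measure \<Rightarrow> (nat \<Rightarrow> 'w \<Rightarrow> 'a::euclidean_space) \<Rightarrow> (nat \<Rightarrow> 'w \<Rightarrow> real) \<Rightarrow>
     nat \<Rightarrow> nat \<Rightarrow> nat \<Rightarrow> ('w \<Rightarrow> nat \<Rightarrow> nat set) \<Rightarrow> bool" where
  "random_division M X Y N s n I \<longleftrightarrow>
     I \<in> measurable M (count_space (divisions N s n)) \<and>
     prob_space.indep_set M
       (sets (vimage_algebra (space M) I (count_space (divisions N s n))))
       (sets (vimage_algebra (space M) (\<lambda>w. \<lambda>i\<in>{1..N}. (X i w, Y i w)) (\<Pi>\<^sub>M i\<in>{1..N}. borel)))"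

text \<open>
  The sigma-algebra of \<open>\<^bold>X\<close>, i.e. of the family of covariates sorted into subsamples.
\<close>

definition cov_algebra ::
  "'w measure \<Rightarrow> (nat \<Rightarrow> 'w \<Rightarrow> 'a::euclidean_space) \<Rightarrow>
     nat \<Rightarrow> nat \<Rightarrow> nat \<Rightarrow> ('w \<Rightarrow> nat \<Rightarrow> nat set) \<Rightarrow> 'w measure" where
  "cov_algebra M X N s n I =
     vimage_algebra (space M) (\<lambda>w. (I w, \<lambda>i\<in>{1..N}. X i w))
       (count_space (divisions N s n) \<Otimes>\<^sub>M (\<Pi>\<^sub>M i\<in>{1..N}. borel))"

definition sub_estimator where
  "sub_estimator H ip lam n X Y I j w =
     arg_min (\<lambda>f. 1 / (2 * real n) * (\<Sum>i\<in>I w j. (Y i w - f (X i w))\<^sup>2) + lam / 2 * ip f f)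
       (\<lambda>f. f \<in> H)"

definition avg_estimator where
  "avg_estimator H ip lam s n X Y I w =
     (\<lambda>x. 1 / real s * (\<Sum>j=1..s. sub_estimator H ip lam n X Y I j w x))"

definition P_emp where
  "P_emp n X I j w f = 1 / real n * (\<Sum>i\<in>I w j. f (X i w))"

definition xi where
  "xi dens H ip lam n X I j w =
     Sup {\<bar>P_emp n X I j w (\<lambda>x. f x * g x) - (LINT x|law dens. f x * g x)\<bar> | f g.
           f \<in> H \<and> g \<in> H \<and> norm_lam dens ip lam f = 1 \<and> norm_lam dens ip lam g = 1}"

definition max_xi where
  "max_xi dens H ip lam s n X I w = Max ((\<lambda>j. xi dens H ip lam n X I j w) ` {1..s})"

definition remainder where
  "remainder dens H ip \<mu> \<phi> lam N s n X Y I f w =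
     (\<lambda>x. avg_estimator H ip lam s n X Y I w x
          - 1 / real N * (\<Sum>i=1..N. noise f X Y i w * K_kernel \<mu> \<phi> lam (X i w) x)
          - f x + P_op dens H ip lam f x)"

definition big_OP :: "'w measure \<Rightarrow> nat filter \<Rightarrow> (nat \<Rightarrow> 'w \<Rightarrow> real) \<Rightarrow> (nat \<Rightarrow> real) \<Rightarrow> bool" where
  "big_OP M F Z r \<longleftrightarrow> (\<forall>e>0. \<exists>C>0. eventually (\<lambda>N.
     measure M {w \<in> space M. \<bar>Z N w\<bar> > C * r N} \<le> e) F)"

text \<open>
  Since \<open>N = n s\<close>, only those \<open>N\<close> in some infinite set \<open>Ns\<close> need admit a division of the
  required kind (a prime \<open>N\<close>, say, has only trivial ones); this is \<open>N \<rightarrow> \<infinity>\<close> along \<open>Ns\<close>.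
\<close>

definition along :: "nat set \<Rightarrow> nat filter" where
  "along Ns = inf at_top (principal Ns)"

end

theory Submission
  imports Defs
begin

text \<open>
  Put $\langle f, g\rangle_j = P_j(fg) + \lambda\langle f,g\rangle_H$ and let $\psi_i$ represent the
  evaluation at $X_i$ with respect to the form of the block $j$ containing $i$. Then
  $\widehat f_j = \frac1n\sum_{i\in I_j} Y_i\psi_i$, hence
  $\bar f - f_0 = \frac1N\sum_i \epsilon_i\psi_i + (\ldots)$ with a second part that depends on the
  covariates only. The forms $\langle\cdot,\cdot\rangle_j$ and $\langle\cdot,\cdot\rangle$ differ by at
  most $\xi_j \|f\| \|g\|$, so for $\xi_j \le 1/2$ an element $\delta$ that represents under
  $\langle\cdot,\cdot\rangle_j$ the functional of $\zeta$ under $\langle\cdot,\cdot\rangle$ satisfies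
  $\|\delta\| \le 2\|\zeta\|$ and $\|\delta-\zeta\| \le 2\xi_j\|\zeta\|$. This bounds each $\psi_i$
  against $K_{X_i}$, and the bias in each block against $-\mathcal P_\lambda f_0$. Given
  $\mathbf X$, the noise terms are uncorrelated, which yields $1/N$ instead of $1/n$. The event
  $\max_j\xi_j\le 1/2$ has probability tending to one by (iii) and (iv).
\<close>

section \<open>Function spaces with an inner product\<close>

text \<open>The obstacle is less the estimates than measurability and integrability. Conditional
  expectations are formed on the whole sample space, so the integrands must be measurable and their
  expansion into noise terms legitimate even where the maximal deviation is large. Hence each
  \<open>psi\<close> comes from an explicit recursion with a norm bound valid for all covariates,
  \<open>H\<close>-valued maps are called measurable through their coefficients, and each supremum
  is reduced to a countable one. The event that the deviation is at most 1/2 enters only after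
  conditioning, pointwise, through functions of the covariates. The ratio condition makes the
  eigenvalues summable; point evaluations are then bounded on \<open>H\<close> uniformly in the
  point, and all uniform bounds rest on this. The threshold 1/2 gives the factor 2 in the norm
  bounds and so the 4 in both inequalities; the 8 is slack. The conditioning includes the random
  division. It takes finitely many values and is independent of the data, so moments reduce to
  events of the covariates alone, and there all observations but one can be frozen.\<close>

locale inner_form =
  fixes H :: "('a \<Rightarrow> real) set" and q :: "('a \<Rightarrow> real) \<Rightarrow> ('a \<Rightarrow> real) \<Rightarrow> real"
  assumes zero_mem: "(\<lambda>x. 0) \<in> H"
    and add_mem: "f \<in> H \<Longrightarrow> g \<in> H \<Longrightarrow> (\<lambda>x. f x + g x) \<in> H"
    and scale_mem: "f \<in> H \<Longrightarrow> (\<lambda>x. c * f x) \<in> H"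
    and commute: "f \<in> H \<Longrightarrow> g \<in> H \<Longrightarrow> q f g = q g f"
    and add_left: "f \<in> H \<Longrightarrow> f' \<in> H \<Longrightarrow> g \<in> H \<Longrightarrow> q (\<lambda>x. f x + f' x) g = q f g + q f' g"
    and scale_left: "f \<in> H \<Longrightarrow> g \<in> H \<Longrightarrow> q (\<lambda>x. c * f x) g = c * q f g"
    and nonneg: "f \<in> H \<Longrightarrow> 0 \<le> q f f"
begin

definition nrm :: "('a \<Rightarrow> real) \<Rightarrow> real" where "nrm f = sqrt (q f f)"

lemma diff_mem: "f \<in> H \<Longrightarrow> g \<in> H \<Longrightarrow> (\<lambda>x. f x - g x) \<in> H"
  using add_mem[of f "\<lambda>x. (-1) * g x"] scale_mem[of g "-1"] by simp

lemma lincomb_mem: "(\<And>i. i \<in> A \<Longrightarrow> u i \<in> H) \<Longrightarrow> (\<lambda>x. \<Sum>i\<in>A. c i * u i x) \<in> H"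
proof (induction A rule: infinite_finite_induct)
  case (insert k A)
  then show ?case
    using add_mem[of "\<lambda>x. c k * u k x" "\<lambda>x. \<Sum>i\<in>A. c i * u i x"] scale_mem[of "u k" "c k"] by simp
qed (simp_all add: zero_mem)

lemma diff_left: "f \<in> H \<Longrightarrow> f' \<in> H \<Longrightarrow> g \<in> H \<Longrightarrow> q (\<lambda>x. f x - f' x) g = q f g - q f' g"
  using add_left[of f "\<lambda>x. (-1) * f' x" g] scale_mem[of f' "-1"] scale_left[of f' g "-1"] by simp

lemma zero_left: "g \<in> H \<Longrightarrow> q (\<lambda>x. 0) g = 0"
  using scale_left[of "\<lambda>x. 0" g 0] zero_mem by simp

lemma add_right: "f \<in> H \<Longrightarrow> g \<in> H \<Longrightarrow> g' \<in> H \<Longrightarrow> q f (\<lambda>x. g x + g' x) = q f g + q f g'"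
  using commute[of f "\<lambda>x. g x + g' x"] add_mem[of g g'] add_left[of g g' f] commute[of f g] commute[of f g'] by simp

lemma scale_right: "f \<in> H \<Longrightarrow> g \<in> H \<Longrightarrow> q f (\<lambda>x. c * g x) = c * q f g"
  using commute[of f "\<lambda>x. c * g x"] scale_mem[of g c] scale_left[of g f c] commute[of f g] by simp

lemma diff_right: "f \<in> H \<Longrightarrow> g \<in> H \<Longrightarrow> g' \<in> H \<Longrightarrow> q f (\<lambda>x. g x - g' x) = q f g - q f g'"
  using commute[of f "\<lambda>x. g x - g' x"] diff_mem[of g g'] diff_left[of g g' f] commute[of f g] commute[of f g'] by simp

lemma lincomb_left:
  "(\<And>i. i \<in> A \<Longrightarrow> u i \<in> H) \<Longrightarrow> g \<in> H \<Longrightarrow> q (\<lambda>x. \<Sum>i\<in>A. c i * u i x) g = (\<Sum>i\<in>A. c i * q (u i) g)"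
proof (induction A rule: infinite_finite_induct)
  case (insert k A)
  then show ?case
    using add_left[of "\<lambda>x. c k * u k x" "\<lambda>x. \<Sum>i\<in>A. c i * u i x" g] scale_mem[of "u k" "c k"]
      scale_left[of "u k" g "c k"] lincomb_mem[of A u c] by simp
qed (simp_all add: zero_left)

lemma lincomb_right:
  assumes "\<And>i. i \<in> A \<Longrightarrow> u i \<in> H" "g \<in> H"
  shows "q g (\<lambda>x. \<Sum>i\<in>A. c i * u i x) = (\<Sum>i\<in>A. c i * q g (u i))"
  using lincomb_left[of A u g c] commute[of g "\<lambda>x. \<Sum>i\<in>A. c i * u i x"] lincomb_mem[of A u c]
    commute[OF assms(2) assms(1)] assms by simp

lemma nrm_nonneg: "f \<in> H \<Longrightarrow> 0 \<le> nrm f"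
  by (simp add: nrm_def nonneg)

lemma nrm_sq: "f \<in> H \<Longrightarrow> (nrm f)\<^sup>2 = q f f"
  by (simp add: nrm_def nonneg)

lemma sq_diff:
  "f \<in> H \<Longrightarrow> g \<in> H \<Longrightarrow> q (\<lambda>x. f x - g x) (\<lambda>x. f x - g x) = q f f - 2 * q f g + q g g"
  by (simp add: diff_left diff_right diff_mem commute)

lemma sq_add:
  "f \<in> H \<Longrightarrow> g \<in> H \<Longrightarrow> q (\<lambda>x. f x + g x) (\<lambda>x. f x + g x) = q f f + 2 * q f g + q g g"
  by (simp add: add_left add_right add_mem commute)

text \<open>The form is only semidefinite (\<open>V\<close> vanishes on functions that are zero
  almost everywhere), so \<open>q g g = 0\<close> does not give \<open>g = 0\<close> and needs its
  own argument.\<close>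

lemma cauchy_schwarz_sq:
  assumes "f \<in> H" "g \<in> H"
  shows "(q f g)\<^sup>2 \<le> q f f * q g g"
proof -
  have *: "0 \<le> q f f - 2 * c * q f g + c\<^sup>2 * q g g" for c
    using nonneg[OF diff_mem[OF assms(1) scale_mem[OF assms(2), of c]]] assms
    by (simp add: sq_diff scale_mem scale_left scale_right power2_eq_square algebra_simps)
  show ?thesis
  proof (cases "q g g = 0")
    case True
    have "q f g = 0"
    proof (rule ccontr)
      assume "q f g \<noteq> 0"
      \<comment> \<open>With \<open>q g g = 0\<close> the quadratic is affine in \<open>c\<close>,
        and this \<open>c\<close> gives it the value -1.\<close>
      then show False
        using *[of "(q f f + 1) / (2 * q f g)"] True by simp
    qed
    then show ?thesis using True by simp
  next
    case False
    then have "0 < q g g" using nonneg[OF assms(2)] by simp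
    \<comment> \<open>The \<open>c\<close> chosen here minimises the quadratic.\<close>
    then show ?thesis
      using *[of "q f g / q g g"] by (simp add: power2_eq_square field_simps)
  qed
qed

lemma cauchy_schwarz: "f \<in> H \<Longrightarrow> g \<in> H \<Longrightarrow> \<bar>q f g\<bar> \<le> nrm f * nrm g"
  unfolding nrm_def real_sqrt_mult[symmetric]
  by (metis cauchy_schwarz_sq real_sqrt_abs real_sqrt_le_iff)

lemma nrm_scale: "f \<in> H \<Longrightarrow> nrm (\<lambda>x. c * f x) = \<bar>c\<bar> * nrm f"
  by (simp add: nrm_def scale_left scale_right scale_mem real_sqrt_mult flip: mult.assoc power2_eq_square)

lemma nrm_zero: "nrm (\<lambda>x. 0) = 0"
  by (simp add: nrm_def zero_left zero_mem)

lemma nrm_triangle: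
  assumes "f \<in> H" "g \<in> H"
  shows "nrm (\<lambda>x. f x + g x) \<le> nrm f + nrm g"
proof (rule power2_le_imp_le)
  show "(nrm (\<lambda>x. f x + g x))\<^sup>2 \<le> (nrm f + nrm g)\<^sup>2"
    using cauchy_schwarz[OF assms] assms by (simp add: nrm_sq add_mem power2_sum sq_add)
qed (simp add: nrm_nonneg assms)

lemma nrm_triangle_diff:
  assumes "f \<in> H" "g \<in> H" shows "nrm f \<le> nrm (\<lambda>x. f x - g x) + nrm g"
  using nrm_triangle[OF diff_mem[OF assms] assms(2)] by simp

lemma nrm_lincomb:
  "(\<And>i. i \<in> A \<Longrightarrow> u i \<in> H) \<Longrightarrow> nrm (\<lambda>x. \<Sum>i\<in>A. c i * u i x) \<le> (\<Sum>i\<in>A. \<bar>c i\<bar> * nrm (u i))"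
proof (induction A rule: infinite_finite_induct)
  case (insert k A)
  then show ?case
    using nrm_triangle[of "\<lambda>x. c k * u k x" "\<lambda>x. \<Sum>i\<in>A. c i * u i x"]
      scale_mem[of "u k" "c k"] lincomb_mem[of A u c] nrm_scale[of "u k" "c k"] by force
qed (simp_all add: nrm_zero)

lemma cauchy_schwarz_tendsto:
  assumes "\<And>k. F k \<in> H" "f \<in> H" "g \<in> H" "(\<lambda>k. nrm (\<lambda>x. F k x - f x)) \<longlonglongrightarrow> 0"
  shows "(\<lambda>k. q (F k) g) \<longlonglongrightarrow> q f g"
proof (rule LIM_zero_cancel, rule Lim_null_comparison)
  show "\<forall>\<^sub>F k in sequentially. norm (q (F k) g - q f g) \<le> nrm (\<lambda>x. F k x - f x) * nrm g"
    using cauchy_schwarz[OF diff_mem[OF assms(1,2)] assms(3)] assms by (simp add: diff_left)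
  show "(\<lambda>k. nrm (\<lambda>x. F k x - f x) * nrm g) \<longlonglongrightarrow> 0"
    using tendsto_mult_right[OF assms(4), of "nrm g"] by simp
qed

end

sublocale rkhs \<subseteq> hip: inner_form H ip
proof
  show "f \<in> H \<Longrightarrow> 0 \<le> ip f f" for f
    using ip_pos[of f] ip_scale[of "\<lambda>x. 0" "\<lambda>x. 0" 0] zero_closed by (cases "f = (\<lambda>x. 0)") auto
qed (auto simp: zero_closed add_closed scale_closed ip_add ip_scale intro: ip_commute)

section \<open>Mercer expansions\<close>

context mercer_rkhs
begin

text \<open>
  Indices start at \<open>0\<close> here. The \<open>e i\<close> are orthonormal in \<open>H\<close>, except that those of
  eigenvalue \<open>0\<close> vanish, so that expansions need no restriction to positive eigenvalues.
\<close>

definition m :: "nat \<Rightarrow> real" where "m i = \<mu> (Suc i)"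

definition e :: "nat \<Rightarrow> 'a \<Rightarrow> real" where "e i x = sqrt (m i) * \<phi> (Suc i) x"

definition cf :: "('a \<Rightarrow> real) \<Rightarrow> nat \<Rightarrow> real" where "cf f i = ip f (e i)"

definition pc :: "(nat \<Rightarrow> real) \<Rightarrow> nat \<Rightarrow> 'a \<Rightarrow> real" where "pc c k x = (\<Sum>i<k. c i * e i x)"

abbreviation "Rk \<equiv> R_kernel \<mu> \<phi>"

lemma m_nonneg: "0 \<le> m i"
  by (simp add: m_def \<mu>_nonneg)

lemma e_null: "m i = 0 \<Longrightarrow> e i = (\<lambda>x. 0)"
  by (simp add: e_def fun_eq_iff)

lemma e_mem: "e i \<in> H"
proof (cases "m i = 0")
  case True then show ?thesis by (simp add: e_null zero_closed)
next
  case False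
  then have "\<phi> (Suc i) \<in> H" using m_nonneg[of i] by (intro \<phi>_H) (auto simp: m_def)
  then show ?thesis using scale_closed[of "\<phi> (Suc i)" "sqrt (m i)"] by (simp add: e_def[abs_def])
qed

lemma e_orthonormal: "ip (e i) (e j) = (if i = j \<and> m i \<noteq> 0 then 1 else 0)"
proof (cases "m i = 0 \<or> m j = 0")
  case True
  then show ?thesis
    using hip.zero_left[OF e_mem] ip_commute[OF zero_closed e_mem] hip.zero_left[OF zero_closed]
    by (auto simp: e_null)
next
  case False
  then have *: "0 < \<mu> (Suc i)" "0 < \<mu> (Suc j)" using m_nonneg[of i] m_nonneg[of j] by (auto simp: m_def)
  then have "\<phi> (Suc i) \<in> H" "\<phi> (Suc j) \<in> H" by (auto intro: \<phi>_H)
  then have "ip (e i) (e j) = sqrt (m i) * (sqrt (m j) * ip (\<phi> (Suc i)) (\<phi> (Suc j)))"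
    by (simp add: e_def[abs_def] hip.scale_left hip.scale_right scale_closed)
  then show ?thesis using * by (simp add: \<phi>_H_orthogonal m_def flip: mult.assoc)
qed

lemma pc_eq: "pc c k = (\<lambda>x. \<Sum>i\<in>{..<k}. c i * e i x)"
  by (simp add: pc_def fun_eq_iff)

lemma pc_mem: "pc c k \<in> H"
  unfolding pc_eq by (rule hip.lincomb_mem) (rule e_mem)

lemma ip_pc: "g \<in> H \<Longrightarrow> ip (pc c k) g = (\<Sum>i<k. c i * cf g i)"
  unfolding pc_eq cf_def by (subst hip.lincomb_left) (auto simp: e_mem ip_commute)

lemma cf_e: "cf (e i) j = (if i = j \<and> m i \<noteq> 0 then 1 else 0)"
  by (simp add: cf_def e_orthonormal)

lemma cf_null: "f \<in> H \<Longrightarrow> m i = 0 \<Longrightarrow> cf f i = 0"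
  using hip.zero_left[of f] ip_commute[of f "\<lambda>x. 0"] by (simp add: cf_def e_null zero_closed)

lemma cf_pc: "cf (pc c k) i = (if i < k \<and> m i \<noteq> 0 then c i else 0)"
proof -
  have "cf (pc c k) i = (\<Sum>j<k. c j * cf (e i) j)"
    unfolding cf_def[of "pc c k"] by (rule ip_pc[OF e_mem])
  also have "\<dots> = (\<Sum>j<k. if j = i then (if m i \<noteq> 0 then c i else 0) else 0)"
    by (intro sum.cong) (auto simp: cf_e)
  also have "\<dots> = (if i < k \<and> m i \<noteq> 0 then c i else 0)"
    by (subst sum.delta) auto
  finally show ?thesis .
qed

lemma ip_pc_pc: "ip (pc c k) (pc d l) = (\<Sum>i<min k l. if m i \<noteq> 0 then c i * d i else 0)"
proof -
  have "ip (pc c k) (pc d l) = (\<Sum>i<k. if i < l then (if m i \<noteq> 0 then c i * d i else 0) else 0)"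
    by (subst ip_pc[OF pc_mem]) (auto simp: cf_pc intro!: sum.cong)
  also have "\<dots> = (\<Sum>i\<in>{i. i < k \<and> i < l}. if m i \<noteq> 0 then c i * d i else 0)"
    by (subst sum.inter_filter[symmetric]) (auto intro: sum.cong)
  also have "{i. i < k \<and> i < l} = {..<min k l}" by auto
  finally show ?thesis .
qed

text \<open>Riesz-Fischer: orthonormality turns the Cauchy property of the sums of squares into that
  of the partial sums, and \<open>H\<close> is complete. A coefficient at eigenvalue zero leaves no
  trace because \<open>e i\<close> vanishes there.\<close>

lemma series_converges:
  assumes "summable (\<lambda>i. (c i)\<^sup>2)"
  obtains f where "f \<in> H" "\<And>i. cf f i = (if m i = 0 then 0 else c i)"
    "(\<lambda>k. hip.nrm (\<lambda>x. pc c k x - f x)) \<longlonglongrightarrow> 0"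
proof -
  define S where "S k = (\<Sum>i<k. if m i \<noteq> 0 then (c i)\<^sup>2 else 0)" for k
  have "summable (\<lambda>i. if m i \<noteq> 0 then (c i)\<^sup>2 else 0)"
    by (rule summable_comparison_test[OF _ assms]) (auto intro!: exI[of _ 0])
  then have "Cauchy S"
    unfolding S_def summable_iff_convergent by (rule convergent_Cauchy)
  \<comment> \<open>The inner product of two partial sums is \<open>S\<close> at the smaller length,
    and \<open>S\<close> is monotone, so the squared distance collapses to a difference of
    \<open>S\<close>.\<close>
  have sq: "ip (\<lambda>x. pc c k x - pc c l x) (\<lambda>x. pc c k x - pc c l x) = \<bar>S k - S l\<bar>" for k l
  proof -
    have "S a \<le> S b" if "a \<le> b" for a b
      unfolding S_def by (intro sum_mono2) (use that in auto)
    then have "S (min k l) = min (S k) (S l)" by (metis min.absorb1 min.absorb2 nle_le)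
    moreover have "ip (pc c a) (pc c b) = S (min a b)" for a b
      by (simp add: ip_pc_pc S_def power2_eq_square cong: if_cong)
    ultimately show ?thesis
      by (simp add: hip.sq_diff pc_mem)
  qed
  have "\<exists>f\<in>H. (\<lambda>k. sqrt (ip (\<lambda>x. pc c k x - f x) (\<lambda>x. pc c k x - f x))) \<longlonglongrightarrow> 0"
  proof (rule complete)
    show "pc c k \<in> H" for k by (rule pc_mem)
    show "\<exists>M. \<forall>k\<ge>M. \<forall>l\<ge>M. sqrt (ip (\<lambda>x. pc c k x - pc c l x) (\<lambda>x. pc c k x - pc c l x)) < e"
      if "0 < e" for e
    proof -
      obtain M where "\<forall>k\<ge>M. \<forall>l\<ge>M. dist (S k) (S l) < e\<^sup>2"
        using \<open>Cauchy S\<close> \<open>0 < e\<close> unfolding Cauchy_def by (meson zero_less_power)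
      then have "\<forall>k\<ge>M. \<forall>l\<ge>M. sqrt \<bar>S k - S l\<bar> < sqrt (e\<^sup>2)"
        by (auto simp: dist_real_def simp del: real_sqrt_abs)
      then show ?thesis using \<open>0 < e\<close> unfolding sq by auto
    qed
  qed
  then obtain f where f: "f \<in> H" "(\<lambda>k. hip.nrm (\<lambda>x. pc c k x - f x)) \<longlonglongrightarrow> 0"
    by (auto simp: hip.nrm_def)
  have "cf f i = (if m i = 0 then 0 else c i)" for i
  proof -
    have "(\<lambda>k. cf (pc c k) i) \<longlonglongrightarrow> cf f i"
      unfolding cf_def by (rule hip.cauchy_schwarz_tendsto[OF pc_mem f(1) e_mem f(2)])
    moreover have "(\<lambda>k. cf (pc c k) i) \<longlonglongrightarrow> (if m i = 0 then 0 else c i)"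
      by (rule tendsto_eventually, rule eventually_mono[OF eventually_gt_at_top[of i]])
        (auto simp: cf_pc)
    ultimately show ?thesis by (rule LIMSEQ_unique)
  qed
  with f that show ?thesis by blast
qed

lemma bessel:
  assumes "f \<in> H"
  shows "ip (\<lambda>x. f x - pc (cf f) k x) (\<lambda>x. f x - pc (cf f) k x) = ip f f - (\<Sum>i<k. (cf f i)\<^sup>2)"
    "(\<Sum>i<k. (cf f i)\<^sup>2) \<le> ip f f" "summable (\<lambda>i. (cf f i)\<^sup>2)"
proof -
  have *: "ip (\<lambda>x. f x - pc (cf f) k x) (\<lambda>x. f x - pc (cf f) k x) = ip f f - (\<Sum>i<k. (cf f i)\<^sup>2)" for k
  proof -
    have "ip (pc (cf f) k) (pc (cf f) k) = (\<Sum>i<k. (cf f i)\<^sup>2)"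
      by (subst ip_pc[OF pc_mem]) (auto simp: cf_pc cf_null[OF assms] power2_eq_square intro!: sum.cong)
    moreover have "ip f (pc (cf f) k) = (\<Sum>i<k. (cf f i)\<^sup>2)"
      using ip_pc[OF assms, of "cf f" k] by (simp add: ip_commute assms pc_mem power2_eq_square)
    ultimately show ?thesis
      using hip.sq_diff[OF assms pc_mem, of "cf f" k] by simp
  qed
  show "ip (\<lambda>x. f x - pc (cf f) k x) (\<lambda>x. f x - pc (cf f) k x) = ip f f - (\<Sum>i<k. (cf f i)\<^sup>2)"
    by (rule *)
  have 2: "(\<Sum>i<k. (cf f i)\<^sup>2) \<le> ip f f" for k
    using hip.nonneg[OF hip.diff_mem[OF assms pc_mem], of "cf f" k] *[of k] by simp
  then show "(\<Sum>i<k. (cf f i)\<^sup>2) \<le> ip f f" .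
  show "summable (\<lambda>i. (cf f i)\<^sup>2)"
    by (rule summableI_nonneg_bounded[OF _ 2]) simp
qed

lemma Rk_off: "x \<notin> D \<Longrightarrow> Rk x = (\<lambda>y. 0)"
  by (simp add: R_kernel_def \<phi>_vanish fun_eq_iff)

lemma Rk_mem: "Rk x \<in> H"
  by (cases "x \<in> D") (auto simp: kernel_in Rk_off zero_closed)

lemma eval: "f \<in> H \<Longrightarrow> ip f (Rk x) = f x"
  using hip.zero_left[of f] ip_commute[of f "\<lambda>x. 0"]
  by (cases "x \<in> D") (simp_all add: reproducing Rk_off vanish zero_closed)

lemma cf_Rk: "cf (Rk x) i = e i x"
  unfolding cf_def by (subst ip_commute) (auto simp: Rk_mem e_mem eval)

lemma Rk_diag_sums: "(\<lambda>i. (e i x)\<^sup>2) sums Rk x x"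
proof -
  have "summable (\<lambda>i. \<mu> (Suc i) * \<phi> (Suc i) x * \<phi> (Suc i) x)"
    by (cases "x \<in> D") (auto simp: R_summable \<phi>_vanish)
  moreover have "(\<lambda>i. \<mu> (Suc i) * \<phi> (Suc i) x * \<phi> (Suc i) x) = (\<lambda>i. (e i x)\<^sup>2)"
    using m_nonneg by (auto simp: e_def m_def power_mult_distrib power2_eq_square)
  ultimately show ?thesis
    unfolding R_kernel_def by (simp add: summable_sums)
qed

lemma ip_Rk_Rk: "ip (Rk x) (Rk y) = Rk x y"
  by (simp add: eval Rk_mem)

text \<open>The diagonal of the Mercer series says that the squared coefficients of
  \<open>Rk x\<close> add up to its squared norm, so the defect in Bessel's inequality tends to
  zero.\<close>

lemma Rk_approx: "(\<lambda>k. hip.nrm (\<lambda>y. pc (\<lambda>i. e i x) k y - Rk x y)) \<longlonglongrightarrow> 0"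
proof -
  have "(\<lambda>k. ip (Rk x) (Rk x) - (\<Sum>i<k. (e i x)\<^sup>2)) \<longlonglongrightarrow> 0"
    using tendsto_diff[OF tendsto_const, of _ "Rk x x" sequentially "Rk x x"] Rk_diag_sums[of x]
    unfolding sums_def ip_Rk_Rk by fastforce
  then have "(\<lambda>k. sqrt (ip (Rk x) (Rk x) - (\<Sum>i<k. (e i x)\<^sup>2))) \<longlonglongrightarrow> 0"
    using tendsto_real_sqrt by fastforce
  moreover have "hip.nrm (\<lambda>y. pc (\<lambda>i. e i x) k y - Rk x y) = sqrt (ip (Rk x) (Rk x) - (\<Sum>i<k. (e i x)\<^sup>2))" for k
  proof -
    have "hip.nrm (\<lambda>y. pc (\<lambda>i. e i x) k y - Rk x y) = hip.nrm (\<lambda>y. Rk x y - pc (\<lambda>i. e i x) k y)"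
      using hip.nrm_scale[OF hip.diff_mem[OF Rk_mem pc_mem], of "-1" x "\<lambda>i. e i x" k] by simp
    then show ?thesis
      using bessel(1)[OF Rk_mem, of x k] by (simp add: hip.nrm_def cf_Rk[abs_def] cf_Rk)
  qed
  ultimately show ?thesis by simp
qed

text \<open>Completeness of the \<open>e i\<close> in \<open>H\<close> is derived from the kernel.
  The expansion of \<open>f\<close> converges to some \<open>f'\<close> with the same coefficients;
  kernel sections are limits of combinations of the \<open>e i\<close>, hence cannot separate
  \<open>f\<close> from \<open>f'\<close>, and these inner products are the point values.\<close>

lemma pc_approx:
  assumes "f \<in> H"
  shows "(\<lambda>k. hip.nrm (\<lambda>x. pc (cf f) k x - f x)) \<longlonglongrightarrow> 0"
proof -
  obtain f' where f': "f' \<in> H" "\<And>i. cf f' i = (if m i = 0 then 0 else cf f i)"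
    "(\<lambda>k. hip.nrm (\<lambda>x. pc (cf f) k x - f' x)) \<longlonglongrightarrow> 0"
    using series_converges[OF bessel(3)[OF assms]] by blast
  have eq: "cf f' i = cf f i" for i using f'(2) cf_null[OF assms] by auto
  have "f' x = f x" for x
  proof -
    have "(\<lambda>k. ip (pc (\<lambda>i. e i x) k) f) \<longlonglongrightarrow> ip (Rk x) f"
      "(\<lambda>k. ip (pc (\<lambda>i. e i x) k) f') \<longlonglongrightarrow> ip (Rk x) f'"
      by (rule hip.cauchy_schwarz_tendsto[OF pc_mem Rk_mem _ Rk_approx]; fact)+
    then have "ip (Rk x) f = ip (Rk x) f'"
      by (simp add: ip_pc assms f'(1) eq LIMSEQ_unique)
    then show ?thesis by (metis assms f'(1) eval ip_commute Rk_mem)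
  qed
  then have "f' = f" by auto
  with f'(3) show ?thesis by simp
qed

lemma parseval:
  assumes "f \<in> H" "g \<in> H"
  shows "(\<lambda>i. cf f i * cf g i) sums ip f g"
  using hip.cauchy_schwarz_tendsto[OF pc_mem assms pc_approx[OF assms(1)]]
  unfolding ip_pc[OF assms(2)] sums_def .

lemma eval_sums: "f \<in> H \<Longrightarrow> (\<lambda>i. cf f i * e i x) sums f x"
  using parseval[OF _ Rk_mem, of f x] by (simp add: cf_Rk eval)

end

section \<open>The population form, its kernel and the bias operator in coefficients\<close>

locale bounded_mercer = mercer_rkhs D dens H ip \<mu> \<phi>
  for D :: "'a::euclidean_space set" and dens H ip \<mu> \<phi> +
  fixes C lam :: real
  assumes law_prob: "prob_space (law dens)"
    and \<phi>_bound: "1 \<le> i \<Longrightarrow> \<bar>\<phi> i x\<bar> \<le> C"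
    and m_summable: "summable m"
    and lam_pos: "0 < lam"
begin

text \<open>Bounds the \<open>H\<close>-norm of every evaluation functional: \<open>Rk x x\<close>
  is the sum of the \<open>(e i x)^2\<close>, each at most \<open>C^2 * m i\<close>.\<close>

definition kap :: real where "kap = sqrt (C\<^sup>2 * suminf m)"

lemma kap_nonneg: "0 \<le> kap"
  by (simp add: kap_def suminf_nonneg m_summable m_nonneg)

lemma Rk_bound: "Rk x x \<le> kap\<^sup>2"
proof -
  have "(e i x)\<^sup>2 \<le> C\<^sup>2 * m i" for i
    using abs_le_square_iff[of "\<phi> (Suc i) x" C] \<phi>_bound[of "Suc i" x] m_nonneg[of i]
    by (auto simp: e_def power_mult_distrib mult.commute[of _ "m i"] intro: mult_left_mono)
  then have "Rk x x \<le> (\<Sum>i. C\<^sup>2 * m i)"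
    using Rk_diag_sums[of x] by (intro sums_le[OF _ Rk_diag_sums summable_sums]) (auto intro: summable_mult m_summable)
  then show ?thesis
    by (simp add: kap_def suminf_mult m_summable suminf_nonneg m_nonneg)
qed

lemma Rk_nrm: "hip.nrm (Rk x) \<le> kap"
  unfolding hip.nrm_def ip_Rk_Rk using Rk_bound[of x] kap_nonneg real_le_lsqrt by auto

lemma sup_bound: "f \<in> H \<Longrightarrow> \<bar>f x\<bar> \<le> kap * hip.nrm f"
  using hip.cauchy_schwarz[OF _ Rk_mem, of f x] mult_left_mono[OF Rk_nrm[of x] hip.nrm_nonneg[of f]]
  by (simp add: eval mult.commute)

lemma H_measurable: "f \<in> H \<Longrightarrow> f \<in> borel_measurable borel"
  using H_L2 by (auto simp: L2_def)

lemma sets_law [measurable_cong, simp]: "sets (law dens) = sets borel"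
  by (simp add: law_def)

lemma e_measurable [measurable]: "e i \<in> borel_measurable borel"
  by (rule H_measurable[OF e_mem])

lemma V_integrable:
  assumes "f \<in> H" "g \<in> H" shows "integrable (law dens) (\<lambda>x. f x * g x)"
proof -
  interpret law: prob_space "law dens" by (rule law_prob)
  have [measurable]: "f \<in> borel_measurable borel" "g \<in> borel_measurable borel"
    by (auto intro: H_measurable assms)
  show ?thesis
  proof (rule law.integrable_const_bound)
    show "AE x in law dens. norm (f x * g x) \<le> (kap * hip.nrm f) * (kap * hip.nrm g)"
      using sup_bound[OF assms(1)] sup_bound[OF assms(2)]
      by (auto simp: abs_mult intro!: mult_mono mult_nonneg_nonneg kap_nonneg hip.nrm_nonneg assms)
  qed simp
qed

sublocale vip: inner_form H "V dens"
proof
  fix f f' g :: "'a \<Rightarrow> real" and c :: real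
  show "f \<in> H \<Longrightarrow> g \<in> H \<Longrightarrow> V dens f g = V dens g f"
    by (simp add: V_def mult.commute)
  show "f \<in> H \<Longrightarrow> f' \<in> H \<Longrightarrow> g \<in> H \<Longrightarrow> V dens (\<lambda>x. f x + f' x) g = V dens f g + V dens f' g"
    by (simp add: V_def V_integrable distrib_right)
  show "f \<in> H \<Longrightarrow> g \<in> H \<Longrightarrow> V dens (\<lambda>x. c * f x) g = c * V dens f g"
    by (simp add: V_def V_integrable mult.assoc)
  show "f \<in> H \<Longrightarrow> 0 \<le> V dens f f"
    by (simp add: V_def)
qed (auto simp: zero_closed add_closed scale_closed)

abbreviation "ilam \<equiv> ip_lam dens ip lam"

sublocale lip: inner_form H ilam
proof
  show "f \<in> H \<Longrightarrow> g \<in> H \<Longrightarrow> ilam f g = ilam g f" for f g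
    using ip_commute[of f g] vip.commute[of f g] by (simp add: ip_lam_def)
qed (use lam_pos in \<open>auto simp: zero_closed add_closed scale_closed ip_lam_def ip_add ip_scale vip.add_left
      vip.scale_left vip.nonneg hip.nonneg distrib_left distrib_right mult.left_commute\<close>)

lemma norm_lam_eq: "norm_lam dens ip lam = lip.nrm"
  by (simp add: norm_lam_def lip.nrm_def fun_eq_iff)

lemma V_le:
  assumes "f \<in> H" shows "V dens f f \<le> kap\<^sup>2 * ip f f"
proof -
  interpret law: prob_space "law dens" by (rule law_prob)
  have "\<bar>f x\<bar>\<^sup>2 \<le> (kap * hip.nrm f)\<^sup>2" for x
    using sup_bound[OF assms, of x] by (intro power_mono) auto
  then have "f x * f x \<le> kap\<^sup>2 * ip f f" for x
    using hip.nrm_sq[OF assms] by (simp add: power_mult_distrib flip: power2_eq_square)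
  then have "V dens f f \<le> (LINT x|law dens. kap\<^sup>2 * ip f f)"
    unfolding V_def by (intro integral_mono[OF V_integrable[OF assms assms]]) auto
  then show ?thesis by (simp add: law.prob_space)
qed

lemma vip_nrm_le: "f \<in> H \<Longrightarrow> vip.nrm f \<le> kap * hip.nrm f"
  unfolding vip.nrm_def hip.nrm_def using real_sqrt_le_mono[OF V_le, of f] kap_nonneg
  by (simp add: real_sqrt_mult)

lemma pc_approx_V:
  assumes "f \<in> H"
  shows "(\<lambda>k. vip.nrm (\<lambda>x. pc (cf f) k x - f x)) \<longlonglongrightarrow> 0"
proof (rule Lim_null_comparison)
  show "\<forall>\<^sub>F k in sequentially. norm (vip.nrm (\<lambda>x. pc (cf f) k x - f x))
      \<le> kap * hip.nrm (\<lambda>x. pc (cf f) k x - f x)"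
    by (simp add: vip_nrm_le vip.nrm_nonneg hip.diff_mem pc_mem assms)
  show "(\<lambda>k. kap * hip.nrm (\<lambda>x. pc (cf f) k x - f x)) \<longlonglongrightarrow> 0"
    using tendsto_mult_left[OF pc_approx[OF assms], of kap] by simp
qed

lemma V_e: "V dens (e i) (e j) = (if i = j then m i else 0)"
proof -
  have "(\<lambda>x. e i x * e j x) = (\<lambda>x. sqrt (m i) * sqrt (m j) * (\<phi> (Suc i) x * \<phi> (Suc j) x))"
    by (simp add: e_def fun_eq_iff)
  then have "V dens (e i) (e j) = sqrt (m i) * sqrt (m j) * V dens (\<phi> (Suc i)) (\<phi> (Suc j))"
    unfolding V_def by (metis integral_mult_right_zero)
  then show ?thesis by (auto simp: \<phi>_orthonormal m_nonneg)
qed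

lemma V_pc: "g \<in> H \<Longrightarrow> V dens (pc c k) g = (\<Sum>i<k. c i * V dens (e i) g)"
  unfolding pc_eq by (subst vip.lincomb_left) (auto simp: e_mem)

text \<open>For finite combinations this is \<open>V_e\<close>; the rest follows since convergence
  in \<open>H\<close> implies convergence in the seminorm of \<open>V\<close>. Thus the
  \<open>e i\<close> diagonalise \<open>V\<close> and \<open>ip\<close> simultaneously, and
  \<open>Kk\<close> and \<open>Pl\<close> can be described coefficientwise.\<close>

lemma V_f_e:
  assumes "f \<in> H" shows "V dens f (e i) = m i * cf f i"
proof -
  have "(\<lambda>k. V dens (pc (cf f) k) (e i)) \<longlonglongrightarrow> V dens f (e i)"
    by (rule vip.cauchy_schwarz_tendsto[OF pc_mem assms e_mem pc_approx_V[OF assms]])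
  moreover have "(\<lambda>k. V dens (pc (cf f) k) (e i)) \<longlonglongrightarrow> m i * cf f i"
  proof (rule tendsto_eventually, rule eventually_mono[OF eventually_gt_at_top[of i]])
    fix k assume "i < k"
    have "V dens (pc (cf f) k) (e i) = (\<Sum>j<k. if j = i then m i * cf f i else 0)"
      unfolding V_pc[OF e_mem] by (intro sum.cong) (auto simp: V_e)
    then show "V dens (pc (cf f) k) (e i) = m i * cf f i"
      using \<open>i < k\<close> by simp
  qed
  ultimately show ?thesis by (rule LIMSEQ_unique)
qed

lemma V_sums:
  assumes "f \<in> H" "g \<in> H"
  shows "(\<lambda>i. m i * cf f i * cf g i) sums V dens f g"
proof -
  have "V dens (e i) g = m i * cf g i" for i
    using V_f_e[OF assms(2)] vip.commute[OF e_mem assms(2)] by simp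
  then have "V dens (pc (cf f) k) g = (\<Sum>i<k. m i * cf f i * cf g i)" for k
    by (simp add: V_pc assms mult_ac)
  then show ?thesis
    using vip.cauchy_schwarz_tendsto[OF pc_mem assms pc_approx_V[OF assms(1)]] by (simp add: sums_def)
qed

lemma ipl_sums:
  assumes "f \<in> H" "g \<in> H"
  shows "(\<lambda>i. (m i + lam) * cf f i * cf g i) sums ilam f g"
  using sums_add[OF V_sums[OF assms] sums_mult[OF parseval[OF assms], of lam]]
  by (simp add: ip_lam_def algebra_simps)

lemma ipl_le: "f \<in> H \<Longrightarrow> ilam f f \<le> (kap\<^sup>2 + lam) * ip f f"
  using V_le[of f] by (simp add: ip_lam_def distrib_right)

lemma ip_le_ipl: "f \<in> H \<Longrightarrow> lam * ip f f \<le> ilam f f"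
  using vip.nonneg[of f] by (simp add: ip_lam_def)

lemma ipl_zero: "f \<in> H \<Longrightarrow> ilam f f \<le> 0 \<Longrightarrow> f = (\<lambda>x. 0)"
  using ip_pos[of f] ip_le_ipl[of f] lam_pos zero_less_mult_iff[of lam "ip f f"] by fastforce

lemma lip_nrm_le: "f \<in> H \<Longrightarrow> lip.nrm f \<le> sqrt (kap\<^sup>2 + lam) * hip.nrm f"
  unfolding lip.nrm_def hip.nrm_def using real_sqrt_le_mono[OF ipl_le, of f]
  by (simp add: real_sqrt_mult)

lemma hip_nrm_le: "f \<in> H \<Longrightarrow> sqrt lam * hip.nrm f \<le> lip.nrm f"
  unfolding lip.nrm_def hip.nrm_def using real_sqrt_le_mono[OF ip_le_ipl, of f]
  by (simp add: real_sqrt_mult)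

lemma ipl_extensional:
  assumes "f \<in> H" "g \<in> H" "\<And>u. u \<in> H \<Longrightarrow> ilam f u = ilam g u"
  shows "f = g"
proof -
  have "ilam (\<lambda>x. f x - g x) (\<lambda>x. f x - g x) = 0"
    using assms by (simp add: lip.diff_left lip.diff_mem)
  then have "(\<lambda>x. f x - g x) = (\<lambda>x. 0)"
    using assms by (intro ipl_zero) (auto simp: lip.diff_mem)
  then show ?thesis by (auto simp: fun_eq_iff)
qed

text \<open>In this form eigenvalue zero is no exception: the quotient is zero there, as the
  convention behind \<open>shrink\<close> demands.\<close>

lemma shrink_eq: "shrink lam (\<mu> (Suc i)) = m i / (m i + lam)"
proof (cases "m i = 0")
  case False
  then have "0 < m i" using m_nonneg[of i] by simp
  then have "1 + lam / m i = (m i + lam) / m i" by (simp add: add_divide_distrib)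
  then show ?thesis using False by (simp add: shrink_def m_def)
qed (simp add: shrink_def m_def)

lemma denominator_pos: "0 < m i + lam"
  using lam_pos m_nonneg[of i] by simp

abbreviation "Kk \<equiv> K_kernel \<mu> \<phi> lam"

lemma Kk_term: "\<phi> (Suc i) x * \<phi> (Suc i) y * shrink lam (\<mu> (Suc i)) = e i x / (m i + lam) * e i y"
  using m_nonneg[of i] by (simp add: shrink_eq e_def)

text \<open>The coefficients are at most those of \<open>Rk x\<close> divided by \<open>lam\<close>,
  so they are square summable and define an element of \<open>H\<close>. Expansions in
  \<open>H\<close> also converge pointwise, which identifies this element with the kernel
  series.\<close>

lemma Kk_mem: "Kk x \<in> H" and cf_Kk: "cf (Kk x) i = e i x / (m i + lam)"
proof -
  have "(e i x / (m i + lam))\<^sup>2 \<le> (e i x)\<^sup>2 / lam\<^sup>2" for i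
    unfolding power_divide using lam_pos m_nonneg[of i]
    by (intro divide_left_mono power_mono) (auto intro!: mult_pos_pos zero_less_power add_nonneg_pos)
  then have "summable (\<lambda>i. (e i x / (m i + lam))\<^sup>2)"
    using Rk_diag_sums[of x]
    by (intro summable_comparison_test'[OF summable_divide[OF sums_summable[OF Rk_diag_sums]]]) auto
  then obtain f where f: "f \<in> H" "\<And>i. cf f i = (if m i = 0 then 0 else e i x / (m i + lam))"
    by (rule series_converges) (rule that)
  have cf: "cf f i = e i x / (m i + lam)" for i
    using f(2)[of i] by (auto simp: e_null)
  have "Kk x = f"
  proof
    fix y
    show "Kk x y = f y"
      using sums_unique[OF eval_sums[OF f(1), of y]] by (simp add: K_kernel_def Kk_term cf)
  qed
  with f(1) cf show "Kk x \<in> H" "cf (Kk x) i = e i x / (m i + lam)" by auto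
qed

text \<open>The denominators in the coefficients of \<open>Kk x\<close> cancel the weights
  \<open>m i + lam\<close> of the form and leave the pointwise expansion of
  \<open>g\<close>.\<close>

lemma Kk_eval:
  assumes "g \<in> H" shows "ilam (Kk x) g = g x"
proof -
  have "(\<lambda>i. cf g i * e i x) sums ilam (Kk x) g"
    using ipl_sums[OF Kk_mem assms, of x] denominator_pos
    by (simp add: cf_Kk less_imp_neq[THEN not_sym] mult.commute)
  then show ?thesis using eval_sums[OF assms] sums_unique2 by blast
qed

text \<open>The reproducing property turns the left side into the diagonal value
  \<open>Kk x x\<close>, a series with terms at most \<open>C^2\<close> times the summands of the
  inverse bandwidth. This is the origin of the variance constant.\<close>

lemma Kk_nrm_sq: "(lip.nrm (Kk x))\<^sup>2 \<le> C\<^sup>2 / bandwidth \<mu> lam"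
proof -
  have le: "m i / (m i + lam) \<le> m i / lam" for i
    using m_nonneg[of i] lam_pos by (intro divide_left_mono) auto
  have sm: "summable (\<lambda>i. m i / (m i + lam))"
    using le m_nonneg lam_pos
    by (intro summable_comparison_test'[OF summable_divide[OF m_summable]])
      (auto simp: less_imp_le)
  have "e i x / (m i + lam) * e i x \<le> C\<^sup>2 * (m i / (m i + lam))" for i
  proof -
    have "\<phi> (Suc i) x * \<phi> (Suc i) x \<le> C\<^sup>2"
      using abs_le_square_iff[of "\<phi> (Suc i) x" C] \<phi>_bound[of "Suc i" x] by (auto simp: power2_eq_square)
    then show ?thesis
      unfolding Kk_term[symmetric] shrink_eq using m_nonneg[of i] lam_pos
      by (intro mult_right_mono) auto
  qed
  then have "Kk x x \<le> (\<Sum>i. C\<^sup>2 * (m i / (m i + lam)))"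
    using eval_sums[OF Kk_mem, of x x] sm
    by (intro sums_le[OF _ _ summable_sums]) (auto simp: cf_Kk simp del: times_divide_eq_right intro: summable_mult)
  also have "\<dots> = C\<^sup>2 / bandwidth \<mu> lam"
    using sm by (simp add: bandwidth_def shrink_eq suminf_mult divide_inverse)
  finally show ?thesis
    using Kk_eval[OF Kk_mem, of x x] by (simp add: lip.nrm_sq Kk_mem)
qed

abbreviation "Pl \<equiv> P_op dens H ip lam"

text \<open>In coefficients the operator multiplies by \<open>lam / (m i + lam)\<close>, which is at
  most 1, so it maps into \<open>H\<close>. The definite description is justified because the
  population form separates points of \<open>H\<close>.\<close>

lemma
  assumes "f \<in> H"
  shows Pl_mem: "Pl f \<in> H" and Pl_ipl: "g \<in> H \<Longrightarrow> ilam (Pl f) g = lam * ip f g"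
proof -
  have "(lam / (m i + lam) * cf f i)\<^sup>2 \<le> (cf f i)\<^sup>2" for i
  proof -
    have "\<bar>lam / (m i + lam)\<bar> \<le> 1" using lam_pos m_nonneg[of i] by auto
    then have "(lam / (m i + lam))\<^sup>2 \<le> 1" by (simp add: abs_square_le_1)
    then show ?thesis
      unfolding power_mult_distrib by (rule mult_left_le_one_le[rotated 2]) auto
  qed
  then have "summable (\<lambda>i. (lam / (m i + lam) * cf f i)\<^sup>2)"
    by (intro summable_comparison_test'[OF bessel(3)[OF assms]]) auto
  then obtain p where p: "p \<in> H" "\<And>i. cf p i = (if m i = 0 then 0 else lam / (m i + lam) * cf f i)"
    by (rule series_converges) (rule that)
  have cf: "cf p i = lam / (m i + lam) * cf f i" for i
    using p(2)[of i] cf_null[OF assms, of i] by auto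
  have p_ipl: "ilam p g = lam * ip f g" if "g \<in> H" for g
  proof -
    have "(\<lambda>i. lam * (cf f i * cf g i)) sums ilam p g"
      using ipl_sums[OF p(1) that] denominator_pos
      by (simp add: cf less_imp_neq[THEN not_sym] mult_ac)
    then show ?thesis using sums_mult[OF parseval[OF assms that], of lam] sums_unique2 by blast
  qed
  have "Pl f = p"
    unfolding P_op_def
  proof (rule the_equality)
    show "p \<in> H \<and> (\<forall>g\<in>H. ilam p g = lam * ip f g)" using p(1) p_ipl by blast
    show "q = p" if "q \<in> H \<and> (\<forall>g\<in>H. ilam q g = lam * ip f g)" for q
      by (rule ipl_extensional) (use that p(1) p_ipl in auto)
  qed
  then show "Pl f \<in> H" "g \<in> H \<Longrightarrow> ilam (Pl f) g = lam * ip f g"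
    using p(1) p_ipl by auto
qed

text \<open>Testing the defining relation with \<open>Pl f\<close> itself and applying
  Cauchy-Schwarz in \<open>H\<close> bounds the square of \<open>ilam (Pl f) (Pl f)\<close> by
  \<open>lam * ip f f\<close> times that same quantity; one factor cancels.\<close>

lemma Pl_nrm_sq:
  assumes "f \<in> H" shows "(lip.nrm (Pl f))\<^sup>2 \<le> lam * ip f f"
proof -
  have "(ilam (Pl f) (Pl f))\<^sup>2 \<le> lam * ip f f * (lam * ip (Pl f) (Pl f))"
    using mult_left_mono[OF hip.cauchy_schwarz_sq[OF assms Pl_mem[OF assms]], of "lam\<^sup>2"]
    by (simp add: Pl_ipl[OF assms Pl_mem[OF assms]] power_mult_distrib power2_eq_square mult_ac)
  also have "\<dots> \<le> lam * ip f f * ilam (Pl f) (Pl f)"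
    using lam_pos hip.nonneg[OF assms] by (intro mult_left_mono ip_le_ipl Pl_mem assms) auto
  finally have "ilam (Pl f) (Pl f) \<le> lam * ip f f"
    using lip.nonneg[OF Pl_mem[OF assms]] lam_pos hip.nonneg[OF assms]
    by (cases "ilam (Pl f) (Pl f) = 0") (auto simp: power2_eq_square)
  then show ?thesis by (simp add: lip.nrm_sq Pl_mem assms)
qed

section \<open>Regularised least squares by rank-one updates\<close>

text \<open>
  Each further point is absorbed by the Sherman--Morrison formula; unlike an abstract Riesz
  representer, the result is visibly measurable in the data.
\<close>

primrec solve :: "nat \<Rightarrow> (nat \<Rightarrow> real) \<Rightarrow> (nat \<Rightarrow> 'a) \<Rightarrow> ('a \<Rightarrow> real) \<Rightarrow> 'a \<Rightarrow> real" where
  "solve 0 t z u = (\<lambda>x. 1 / lam * u x)"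
| "solve (Suc k) t z u = (\<lambda>x. solve k t z u x
     - t k * solve k t z u (z k) / (1 + t k * solve k t z (Rk (z k)) (z k)) * solve k t z (Rk (z k)) x)"

lemma solve_mem: "u \<in> H \<Longrightarrow> solve k t z u \<in> H"
  by (induction k arbitrary: u) (auto intro!: hip.diff_mem hip.scale_mem Rk_mem simp del: times_divide_eq_left)

text \<open>Induction on the number of points. A new point adds a multiple of the evaluation at
  \<open>z k\<close> to the form, and that evaluation is represented under the old form by
  \<open>?r\<close>; hence subtracting a suitable multiple of \<open>?r\<close> repairs the
  equation.\<close>

lemma solve_eq:
  assumes t: "\<And>l. 0 \<le> t l" and "u \<in> H" "g \<in> H"
  shows "lam * ip (solve k t z u) g + (\<Sum>l<k. t l * (solve k t z u (z l) * g (z l))) = ip u g"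
  using assms(2,3)
proof (induction k arbitrary: u g)
  case 0
  then show ?case using lam_pos by (simp add: ip_scale del: times_divide_eq_left)
next
  case (Suc k)
  let ?w = "solve k t z u" and ?r = "solve k t z (Rk (z k))"
  define c where "c = t k * ?w (z k) / (1 + t k * ?r (z k))"
  have mem: "?w \<in> H" "?r \<in> H" by (auto intro: solve_mem Suc.prems Rk_mem)
  \<comment> \<open>The value of \<open>?r\<close> at \<open>z k\<close> is its own quadratic form,
    hence nonnegative, so the denominator of the update is positive.\<close>
  have "0 \<le> lam * ip ?r ?r + (\<Sum>l<k. t l * (?r (z l) * ?r (z l)))"
    using lam_pos t hip.nonneg[OF mem(2)] by (intro add_nonneg_nonneg sum_nonneg) auto
  also have "\<dots> = ?r (z k)"
    using Suc.IH[OF Rk_mem mem(2), of "z k"] ip_commute[OF Rk_mem mem(2)] eval[OF mem(2)] by simp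
  finally have "1 + t k * ?r (z k) > 0"
    using t[of k] by (intro add_pos_nonneg) auto
  \<comment> \<open>The fixed-point form of the update: \<open>c\<close> is the weight times the
    value of the new solution at the new point.\<close>
  then have c: "c = t k * (?w (z k) - c * ?r (z k))"
    by (simp add: c_def field_simps)
  have "solve (Suc k) t z u = (\<lambda>x. ?w x - c * ?r x)"
    by (simp add: c_def)
  then have "lam * ip (solve (Suc k) t z u) g + (\<Sum>l<Suc k. t l * (solve (Suc k) t z u (z l) * g (z l)))
     = lam * ip (\<lambda>x. ?w x - c * ?r x) g + (\<Sum>l<Suc k. t l * ((?w (z l) - c * ?r (z l)) * g (z l)))"
    by simp
  also have "\<dots> = (lam * ip ?w g + (\<Sum>l<k. t l * (?w (z l) * g (z l))))
      - c * (lam * ip ?r g + (\<Sum>l<k. t l * (?r (z l) * g (z l)))) + t k * (?w (z k) - c * ?r (z k)) * g (z k)"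
    using mem Suc.prems
    by (simp add: hip.diff_left hip.scale_left hip.scale_mem sum_subtractf sum_distrib_left algebra_simps)
  also have "\<dots> = ip u g - c * g (z k) + c * g (z k)"
    using Suc.IH[OF Suc.prems] Suc.IH[OF Rk_mem Suc.prems(2)] c
      ip_commute[OF Rk_mem Suc.prems(2)] eval[OF Suc.prems(2)] by simp
  finally show ?case by simp
qed

text \<open>Testing the equation with the solution itself makes the sum over the points nonnegative,
  and it is dropped. The bound is thus uniform in points and weights, which later gives
  integrability for all data at once.\<close>

lemma solve_nrm:
  assumes t: "\<And>l. 0 \<le> t l" and "u \<in> H"
  shows "lam * hip.nrm (solve k t z u) \<le> hip.nrm u"
proof -
  let ?w = "solve k t z u"
  have mem: "?w \<in> H" by (rule solve_mem[OF assms(2)])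
  have "0 \<le> (\<Sum>l<k. t l * (?w (z l) * ?w (z l)))"
    using t by (intro sum_nonneg) auto
  then have "lam * ip ?w ?w \<le> ip u ?w"
    using solve_eq[where t = t and k = k and z = z, OF t assms(2) mem] by simp
  also have "\<dots> \<le> hip.nrm u * hip.nrm ?w"
    using hip.cauchy_schwarz[OF assms(2) mem] by simp
  finally have "lam * hip.nrm ?w * hip.nrm ?w \<le> hip.nrm u * hip.nrm ?w"
    using hip.nrm_sq[OF mem] by (simp add: power2_eq_square mult.assoc)
  then show ?thesis
    using hip.nrm_nonneg[OF mem] hip.nrm_nonneg[OF assms(2)] by (cases "hip.nrm ?w = 0") auto
qed

section \<open>Measurable families\<close>

text \<open>Measurability is stated through coefficients, without a sigma-algebra on
  \<open>H\<close>. This suffices because point values and the population form are series in the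
  coefficients.\<close>

definition Hmeas :: "'p measure \<Rightarrow> ('p \<Rightarrow> 'a \<Rightarrow> real) \<Rightarrow> bool" where
  "Hmeas Q u \<longleftrightarrow> (\<forall>p. u p \<in> H) \<and> (\<forall>i. (\<lambda>p. cf (u p) i) \<in> borel_measurable Q)"

lemma HmeasD: "Hmeas Q u \<Longrightarrow> u p \<in> H" "Hmeas Q u \<Longrightarrow> (\<lambda>p. cf (u p) i) \<in> borel_measurable Q"
  by (auto simp: Hmeas_def)

lemma cf_add: "f \<in> H \<Longrightarrow> g \<in> H \<Longrightarrow> cf (\<lambda>x. f x + g x) i = cf f i + cf g i"
  by (simp add: cf_def ip_add e_mem)

lemma cf_diff: "f \<in> H \<Longrightarrow> g \<in> H \<Longrightarrow> cf (\<lambda>x. f x - g x) i = cf f i - cf g i"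
  by (simp add: cf_def hip.diff_left e_mem)

lemma cf_scale: "f \<in> H \<Longrightarrow> cf (\<lambda>x. c * f x) i = c * cf f i"
  by (simp add: cf_def ip_scale e_mem)

lemma Hmeas_const: "f \<in> H \<Longrightarrow> Hmeas Q (\<lambda>p. f)"
  by (simp add: Hmeas_def)

lemma Hmeas_add: "Hmeas Q u \<Longrightarrow> Hmeas Q v \<Longrightarrow> Hmeas Q (\<lambda>p x. u p x + v p x)"
  by (auto simp: Hmeas_def cf_add intro: hip.add_mem borel_measurable_add)

lemma Hmeas_diff: "Hmeas Q u \<Longrightarrow> Hmeas Q v \<Longrightarrow> Hmeas Q (\<lambda>p x. u p x - v p x)"
  by (auto simp: Hmeas_def cf_diff intro: hip.diff_mem borel_measurable_diff)

lemma Hmeas_scale: "Hmeas Q u \<Longrightarrow> c \<in> borel_measurable Q \<Longrightarrow> Hmeas Q (\<lambda>p x. c p * u p x)"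
  by (auto simp: Hmeas_def cf_scale intro: hip.scale_mem borel_measurable_times)

lemma Hmeas_sum:
  "(\<And>k. k \<in> B \<Longrightarrow> Hmeas Q (u k)) \<Longrightarrow> (\<And>k. k \<in> B \<Longrightarrow> c k \<in> borel_measurable Q) \<Longrightarrow>
    Hmeas Q (\<lambda>p x. \<Sum>k\<in>B. c k p * u k p x)"
proof (induction B rule: infinite_finite_induct)
  case (insert k B)
  then show ?case
    using Hmeas_add[OF Hmeas_scale[of Q "u k" "c k"], of "\<lambda>p x. \<Sum>k\<in>B. c k p * u k p x"] by simp
qed (simp_all add: Hmeas_const zero_closed)

lemma Hmeas_Rk: "z \<in> borel_measurable Q \<Longrightarrow> Hmeas Q (\<lambda>p. Rk (z p))"
  by (simp add: Hmeas_def Rk_mem cf_Rk)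

lemma Hmeas_Kk: "z \<in> borel_measurable Q \<Longrightarrow> Hmeas Q (\<lambda>p. Kk (z p))"
  by (simp add: Hmeas_def Kk_mem cf_Kk)

lemma Hmeas_eval:
  assumes "Hmeas Q u" and [measurable]: "z \<in> borel_measurable Q"
  shows "(\<lambda>p. u p (z p)) \<in> borel_measurable Q"
proof -
  have [measurable]: "(\<lambda>p. cf (u p) i) \<in> borel_measurable Q" for i by (rule HmeasD(2)[OF assms(1)])
  have "u p (z p) = (\<Sum>i. cf (u p) i * e i (z p))" for p
    by (rule sums_unique[OF eval_sums[OF HmeasD(1)[OF assms(1)]]])
  then show ?thesis by simp
qed

lemma Hmeas_ipl:
  assumes "Hmeas Q u" "Hmeas Q v"
  shows "(\<lambda>p. ilam (u p) (v p)) \<in> borel_measurable Q"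
proof -
  have [measurable]: "(\<lambda>p. cf (u p) i) \<in> borel_measurable Q" "(\<lambda>p. cf (v p) i) \<in> borel_measurable Q" for i
    by (rule HmeasD(2)[OF assms(1)], rule HmeasD(2)[OF assms(2)])
  have "ilam (u p) (v p) = (\<Sum>i. (m i + lam) * cf (u p) i * cf (v p) i)" for p
    by (rule sums_unique[OF ipl_sums[OF HmeasD(1)[OF assms(1)] HmeasD(1)[OF assms(2)]]])
  then show ?thesis by simp
qed

lemma Hmeas_solve:
  assumes "Hmeas Q u"
    and [measurable]: "\<And>l. l < k \<Longrightarrow> (\<lambda>p. t p l) \<in> borel_measurable Q"
      "\<And>l. l < k \<Longrightarrow> (\<lambda>p. z p l) \<in> borel_measurable Q"
  shows "Hmeas Q (\<lambda>p. solve k (t p) (z p) (u p))"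
  using assms
proof (induction k arbitrary: u)
  case 0
  then show ?case using Hmeas_scale[of Q u "\<lambda>p. 1 / lam"] by simp
next
  case (Suc k)
  have [measurable]: "(\<lambda>p. t p k) \<in> borel_measurable Q" and z [measurable]: "(\<lambda>p. z p k) \<in> borel_measurable Q"
    by (auto intro: Suc.prems)
  have u: "Hmeas Q (\<lambda>p. solve k (t p) (z p) (u p))"
    and r: "Hmeas Q (\<lambda>p. solve k (t p) (z p) (Rk (z p k)))"
    by (auto intro!: Suc.IH Suc.prems Hmeas_Rk)
  have [measurable]: "(\<lambda>p. solve k (t p) (z p) (u p) (z p k)) \<in> borel_measurable Q"
    "(\<lambda>p. solve k (t p) (z p) (Rk (z p k)) (z p k)) \<in> borel_measurable Q"
    by (rule Hmeas_eval[OF u z], rule Hmeas_eval[OF r z])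
  show ?case
    unfolding solve.simps by (rule Hmeas_diff[OF u Hmeas_scale[OF r]]) simp
qed

end

text \<open>A point carries a division and the covariates. With \<open>fst\<close> in place of
  \<open>I\<close> and \<open>\<lambda>i p. snd p i\<close> in place of \<open>X\<close>, the
  definitions made on the probability space can be evaluated at such points.\<close>

abbreviation cov_space :: "nat \<Rightarrow> nat \<Rightarrow> nat \<Rightarrow> ((nat \<Rightarrow> nat set) \<times> (nat \<Rightarrow> 'a::euclidean_space)) measure" where
  "cov_space N s n \<equiv> count_space (divisions N s n) \<Otimes>\<^sub>M (\<Pi>\<^sub>M i\<in>{1..N}. borel)"

lemma cov_snd_measurable: "i \<in> {1..N} \<Longrightarrow> (\<lambda>p. snd p i) \<in> borel_measurable (cov_space N s n)"
  by (rule measurable_compose[OF measurable_snd]) (rule measurable_component_singleton)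

lemma cov_fst_measurable: "(\<lambda>p. u (fst p)) \<in> borel_measurable (cov_space N s n)"
  by (rule measurable_compose[OF measurable_fst]) simp

context bounded_mercer
begin

section \<open>Perturbation of the population form by the empirical one\<close>

definition dev :: "nat \<Rightarrow> (nat \<Rightarrow> 'w \<Rightarrow> 'a) \<Rightarrow> ('w \<Rightarrow> nat \<Rightarrow> nat set) \<Rightarrow> nat \<Rightarrow> 'w \<Rightarrow> ('a \<Rightarrow> real) \<Rightarrow> ('a \<Rightarrow> real) \<Rightarrow> real"
  where "dev n X I j w f g = P_emp n X I j w (\<lambda>x. f x * g x) - V dens f g"

lemma P_emp_bound:
  assumes "f \<in> H" "g \<in> H"
  shows "\<bar>P_emp n X I j w (\<lambda>x. f x * g x)\<bar> \<le> real (card (I w j)) / real n * kap\<^sup>2 * hip.nrm f * hip.nrm g"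
proof -
  have "\<bar>f (X i w) * g (X i w)\<bar> \<le> (kap * hip.nrm f) * (kap * hip.nrm g)" for i
    unfolding abs_mult by (intro mult_mono sup_bound assms) (auto simp: kap_nonneg hip.nrm_nonneg assms)
  then have "\<bar>\<Sum>i\<in>I w j. f (X i w) * g (X i w)\<bar> \<le> real (card (I w j)) * ((kap * hip.nrm f) * (kap * hip.nrm g))"
    by (intro order_trans[OF sum_abs] sum_bounded_above) auto
  then show ?thesis
    unfolding P_emp_def abs_mult
    using mult_left_mono[of _ _ "1 / real n"] by (auto simp: power2_eq_square mult_ac)
qed

lemma V_bound: "f \<in> H \<Longrightarrow> g \<in> H \<Longrightarrow> \<bar>V dens f g\<bar> \<le> kap\<^sup>2 * hip.nrm f * hip.nrm g"
  using vip.cauchy_schwarz[of f g] mult_mono[OF vip_nrm_le[of f] vip_nrm_le[of g]]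
  by (simp add: vip.nrm_nonneg hip.nrm_nonneg kap_nonneg power2_eq_square mult_ac)

text \<open>A crude constant that allows blocks of any cardinality. What counts is finiteness: it
  bounds the set under the supremum, makes \<open>dev\<close> continuous, and lets
  \<open>dev\<close> vanish at elements of norm zero.\<close>

definition dev_const :: "nat \<Rightarrow> ('w \<Rightarrow> nat \<Rightarrow> nat set) \<Rightarrow> nat \<Rightarrow> 'w \<Rightarrow> real" where
  "dev_const n I j w = (real (card (I w j)) / real n + 1) * kap\<^sup>2 / lam"

lemma dev_const_nonneg: "0 \<le> dev_const n I j w"
  using lam_pos by (simp add: dev_const_def)

lemma dev_bound:
  assumes "f \<in> H" "g \<in> H"
  shows "\<bar>dev n X I j w f g\<bar> \<le> dev_const n I j w * lip.nrm f * lip.nrm g"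
proof -
  have "\<bar>dev n X I j w f g\<bar> \<le> (real (card (I w j)) / real n + 1) * kap\<^sup>2 * (hip.nrm f * hip.nrm g)"
    unfolding dev_def
    using P_emp_bound[OF assms, of n X I j w] V_bound[OF assms] by (simp add: algebra_simps)
  also have "\<dots> = dev_const n I j w * ((sqrt lam * hip.nrm f) * (sqrt lam * hip.nrm g))"
  proof -
    have "(sqrt lam * hip.nrm f) * (sqrt lam * hip.nrm g) = (sqrt lam * sqrt lam) * (hip.nrm f * hip.nrm g)"
      by (simp only: mult_ac)
    also have "\<dots> = lam * (hip.nrm f * hip.nrm g)"
      using lam_pos by simp
    finally have sq: "(sqrt lam * hip.nrm f) * (sqrt lam * hip.nrm g) = lam * (hip.nrm f * hip.nrm g)" .
    show ?thesis unfolding sq using lam_pos by (simp add: dev_const_def)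
  qed
  also have "\<dots> \<le> dev_const n I j w * (lip.nrm f * lip.nrm g)"
    using lam_pos
    by (intro mult_left_mono mult_mono hip_nrm_le assms dev_const_nonneg)
      (auto simp: lip.nrm_nonneg hip.nrm_nonneg assms)
  finally show ?thesis by (simp add: mult.assoc)
qed

lemma dev_scale:
  "f \<in> H \<Longrightarrow> g \<in> H \<Longrightarrow> dev n X I j w (\<lambda>x. a * f x) (\<lambda>x. b * g x) = a * b * dev n X I j w f g"
  by (simp add: dev_def P_emp_def vip.scale_left vip.scale_right scale_closed sum_distrib_left algebra_simps)

lemma dev_diff_left:
  "f \<in> H \<Longrightarrow> f' \<in> H \<Longrightarrow> g \<in> H \<Longrightarrow> dev n X I j w (\<lambda>x. f x - f' x) g = dev n X I j w f g - dev n X I j w f' g"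
  by (simp add: dev_def P_emp_def vip.diff_left sum_subtractf algebra_simps)

lemma dev_commute: "f \<in> H \<Longrightarrow> g \<in> H \<Longrightarrow> dev n X I j w f g = dev n X I j w g f"
  using vip.commute[of f g] by (simp add: dev_def P_emp_def mult.commute)

definition xi_set :: "nat \<Rightarrow> (nat \<Rightarrow> 'w \<Rightarrow> 'a) \<Rightarrow> ('w \<Rightarrow> nat \<Rightarrow> nat set) \<Rightarrow> nat \<Rightarrow> 'w \<Rightarrow> real set" where
  "xi_set n X I j w = {\<bar>dev n X I j w f g\<bar> | f g. f \<in> H \<and> g \<in> H \<and> lip.nrm f = 1 \<and> lip.nrm g = 1}"

lemma xi_eq: "xi dens H ip lam n X I j w = Sup (xi_set n X I j w)"
  by (simp add: xi_def xi_set_def dev_def V_def norm_lam_eq)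

lemma bdd_xi_set: "bdd_above (xi_set n X I j w)"
proof (rule bdd_aboveI)
  fix y assume "y \<in> xi_set n X I j w"
  then obtain f g where *: "y = \<bar>dev n X I j w f g\<bar>" "f \<in> H" "g \<in> H" "lip.nrm f = 1" "lip.nrm g = 1"
    by (auto simp: xi_set_def)
  show "y \<le> dev_const n I j w"
    using dev_bound[OF *(2,3), of n X I j w] by (simp add: *)
qed

lemma unit_mem:
  assumes "f \<in> H" "lip.nrm f \<noteq> 0"
  shows "(\<lambda>x. 1 / lip.nrm f * f x) \<in> H" "lip.nrm (\<lambda>x. 1 / lip.nrm f * f x) = 1"
proof -
  show "(\<lambda>x. 1 / lip.nrm f * f x) \<in> H" by (rule lip.scale_mem[OF assms(1)])
  show "lip.nrm (\<lambda>x. 1 / lip.nrm f * f x) = 1"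
    unfolding lip.nrm_scale[OF assms(1)] using assms lip.nrm_nonneg[OF assms(1)] by simp
qed

lemma dev_zero:
  assumes "f \<in> H" "g \<in> H" "lip.nrm f * lip.nrm g = 0"
  shows "dev n X I j w f g = 0"
  using dev_bound[OF assms(1,2), of n X I j w] assms(3) by (simp add: mult.assoc)

lemma dev_unit:
  assumes "f \<in> H" "g \<in> H" "lip.nrm f \<noteq> 0" "lip.nrm g \<noteq> 0"
  shows "\<bar>dev n X I j w f g\<bar> =
    \<bar>dev n X I j w (\<lambda>x. 1 / lip.nrm f * f x) (\<lambda>x. 1 / lip.nrm g * g x)\<bar> * (lip.nrm f * lip.nrm g)"
  unfolding dev_scale[OF assms(1,2)]
  using assms(3,4) lip.nrm_nonneg[OF assms(1)] lip.nrm_nonneg[OF assms(2)] by (simp add: abs_mult)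

text \<open>Normalising reduces to unit vectors. If one norm is zero, both sides are zero whatever
  the supremum is; this covers a trivial \<open>H\<close>, where the supremum is over the empty
  set.\<close>

lemma dev_le_xi:
  assumes "f \<in> H" "g \<in> H"
  shows "\<bar>dev n X I j w f g\<bar> \<le> xi dens H ip lam n X I j w * (lip.nrm f * lip.nrm g)"
proof (cases "lip.nrm f * lip.nrm g = 0")
  case True
  show ?thesis unfolding True dev_zero[OF assms True] by simp
next
  case False
  then have nz: "lip.nrm f \<noteq> 0" "lip.nrm g \<noteq> 0" by auto
  have "\<bar>dev n X I j w (\<lambda>x. 1 / lip.nrm f * f x) (\<lambda>x. 1 / lip.nrm g * g x)\<bar> \<in> xi_set n X I j w"
    unfolding xi_set_def using unit_mem[OF assms(1) nz(1)] unit_mem[OF assms(2) nz(2)] by blast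
  then show ?thesis
    unfolding dev_unit[OF assms nz] xi_eq using lip.nrm_nonneg assms
    by (intro mult_right_mono cSup_upper bdd_xi_set) auto
qed

text \<open>The absolute value guards against the supremum over the empty set, a real number of
  unknown sign.\<close>

lemma dev_le_max_xi:
  assumes "f \<in> H" "g \<in> H" "j \<in> {1..s}"
  shows "\<bar>dev n X I j w f g\<bar> \<le> \<bar>max_xi dens H ip lam s n X I w\<bar> * (lip.nrm f * lip.nrm g)"
proof -
  have "xi dens H ip lam n X I j w \<le> max_xi dens H ip lam s n X I w"
    unfolding max_xi_def using assms(3) by (intro Max_ge) auto
  then have "xi dens H ip lam n X I j w * (lip.nrm f * lip.nrm g) \<le> \<bar>max_xi dens H ip lam s n X I w\<bar> * (lip.nrm f * lip.nrm g)"
    using lip.nrm_nonneg assms by (intro mult_right_mono) auto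
  then show ?thesis using dev_le_xi[OF assms(1,2), of n X I j w] by linarith
qed

text \<open>For the difference \<open>?e\<close> of \<open>d\<close> and \<open>z\<close>, the
  squared norm of \<open>?e\<close> equals minus the deviation at \<open>d\<close> and
  \<open>?e\<close>. Dividing by the norm of \<open>?e\<close> bounds it by \<open>t\<close> times
  that of \<open>d\<close>; as \<open>t\<close> is at most 1/2, the triangle inequality absorbs half
  of the norm of \<open>d\<close>.\<close>

lemma contraction:
  assumes mem: "d \<in> H" "z \<in> H"
    and eq: "\<And>g. g \<in> H \<Longrightarrow> P_emp n X I j w (\<lambda>x. d x * g x) + lam * ip d g = ilam z g"
    and xi: "\<And>g. g \<in> H \<Longrightarrow> \<bar>dev n X I j w d g\<bar> \<le> t * (lip.nrm d * lip.nrm g)"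
    and t: "0 \<le> t" "t \<le> 1 / 2"
  shows "lip.nrm (\<lambda>x. d x - z x) \<le> 2 * t * lip.nrm z" "lip.nrm d \<le> 2 * lip.nrm z"
proof -
  let ?e = "\<lambda>x. d x - z x"
  have e: "?e \<in> H" by (rule hip.diff_mem[OF mem])
  have "(lip.nrm ?e)\<^sup>2 = ilam d ?e - ilam z ?e"
    by (simp add: lip.nrm_sq e lip.diff_left mem)
  also have "\<dots> = - dev n X I j w d ?e"
    unfolding eq[OF e, symmetric] by (simp add: dev_def ip_lam_def)
  also have "\<dots> \<le> t * (lip.nrm d * lip.nrm ?e)"
    using xi[OF e] by simp
  finally have "lip.nrm ?e * lip.nrm ?e \<le> (t * lip.nrm d) * lip.nrm ?e"
    by (simp add: power2_eq_square mult.assoc)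
  then have 1: "lip.nrm ?e \<le> t * lip.nrm d"
    using lip.nrm_nonneg[OF e] lip.nrm_nonneg[OF mem(1)] t by (cases "lip.nrm ?e = 0") auto
  have "lip.nrm d \<le> lip.nrm ?e + lip.nrm z" by (rule lip.nrm_triangle_diff[OF mem])
  moreover have "t * lip.nrm d \<le> 1 / 2 * lip.nrm d"
    using t lip.nrm_nonneg[OF mem(1)] by (intro mult_right_mono) auto
  ultimately show 2: "lip.nrm d \<le> 2 * lip.nrm z" using 1 by linarith
  show "lip.nrm ?e \<le> 2 * t * lip.nrm z"
    using 1 mult_left_mono[OF 2 t(1)] by (simp add: mult_ac)
qed

section \<open>Measurability of the maximal deviation\<close>

text \<open>A dense family indexed by a countable type, so that countability of the index set comes
  for free.\<close>

definition comb :: "rat list \<Rightarrow> 'a \<Rightarrow> real" where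
  "comb l = pc (\<lambda>i. of_rat (l ! i)) (length l)"

lemma comb_mem: "comb l \<in> H"
  unfolding comb_def by (rule pc_mem)

lemma nrm_e_le: "hip.nrm (e i) \<le> 1"
  by (simp add: hip.nrm_def e_orthonormal)

lemma comb_dense:
  assumes "f \<in> H" "0 < \<delta>"
  obtains l where "hip.nrm (\<lambda>x. comb l x - f x) < \<delta>"
proof -
  have "\<forall>\<^sub>F k in sequentially. hip.nrm (\<lambda>x. pc (cf f) k x - f x) < \<delta> / 2"
    using pc_approx[OF assms(1)] assms(2) by (intro order_tendstoD(2)) auto
  then obtain k where k: "hip.nrm (\<lambda>x. pc (cf f) k x - f x) < \<delta> / 2"
    by (auto simp: eventually_sequentially)
  \<comment> \<open>Rounding \<open>k\<close> coefficients, each by less than \<open>\<eta>\<close>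
    along vectors of norm at most 1, costs at most half of \<open>\<delta>\<close>; the summand 1
    covers \<open>k = 0\<close>.\<close>
  define \<eta> where "\<eta> = \<delta> / 2 / (real k + 1)"
  have "0 < \<eta>" using assms(2) by (simp add: \<eta>_def)
  then have "\<exists>r. \<bar>of_rat r - cf f i\<bar> < \<eta>" for i
    using of_rat_dense[of "cf f i - \<eta>" "cf f i + \<eta>"] by (auto simp: abs_less_iff algebra_simps)
  then obtain r where r: "\<And>i. \<bar>of_rat (r i) - cf f i\<bar> < \<eta>" by metis
  define l where "l = map r [0..<k]"
  have comb: "comb l = pc (\<lambda>i. of_rat (r i)) k"
    by (auto simp: comb_def l_def pc_def fun_eq_iff intro!: sum.cong)
  have "(\<lambda>x. comb l x - pc (cf f) k x) = (\<lambda>x. \<Sum>i\<in>{..<k}. (of_rat (r i) - cf f i) * e i x)"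
    by (simp add: comb pc_def fun_eq_iff sum_subtractf left_diff_distrib)
  then have "hip.nrm (\<lambda>x. comb l x - pc (cf f) k x) \<le> (\<Sum>i<k. \<bar>of_rat (r i) - cf f i\<bar> * hip.nrm (e i))"
    using hip.nrm_lincomb[of "{..<k}" e "\<lambda>i. of_rat (r i) - cf f i"] e_mem by simp
  also have "\<dots> \<le> (\<Sum>i<k. \<eta> * 1)"
    using r hip.nrm_nonneg[OF e_mem] by (intro sum_mono mult_mono nrm_e_le) (auto intro: less_imp_le order_trans[OF abs_ge_zero])
  also have "\<dots> \<le> \<delta> / 2"
    using assms(2) by (simp add: \<eta>_def field_simps)
  finally have "hip.nrm (\<lambda>x. comb l x - pc (cf f) k x) \<le> \<delta> / 2" .
  moreover have "hip.nrm (\<lambda>x. comb l x - f x) \<le> hip.nrm (\<lambda>x. comb l x - pc (cf f) k x) + hip.nrm (\<lambda>x. pc (cf f) k x - f x)"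
    using hip.nrm_triangle[OF hip.diff_mem[OF comb_mem pc_mem] hip.diff_mem[OF pc_mem assms(1)], of l "cf f" k "cf f" k] by simp
  ultimately show ?thesis using k that[of l] by linarith
qed

lemma comb_sequence:
  assumes "f \<in> H"
  obtains l where "(\<lambda>k. lip.nrm (\<lambda>x. comb (l k) x - f x)) \<longlonglongrightarrow> 0"
proof -
  have "\<exists>l. hip.nrm (\<lambda>x. comb l x - f x) < 1 / real (Suc k)" for k
    by (rule comb_dense[OF assms, of "1 / real (Suc k)"]) auto
  then obtain l where l: "\<And>k. hip.nrm (\<lambda>x. comb (l k) x - f x) < 1 / real (Suc k)" by metis
  have "(\<lambda>k. lip.nrm (\<lambda>x. comb (l k) x - f x)) \<longlonglongrightarrow> 0"
  proof (rule Lim_null_comparison)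
    have "lip.nrm (\<lambda>x. comb (l k) x - f x) \<le> sqrt (kap\<^sup>2 + lam) * (1 / real (Suc k))" for k
      using lam_pos less_imp_le[OF l[of k]]
      by (intro order_trans[OF lip_nrm_le] mult_left_mono hip.diff_mem comb_mem assms) auto
    then show "\<forall>\<^sub>F k in sequentially. norm (lip.nrm (\<lambda>x. comb (l k) x - f x)) \<le> sqrt (kap\<^sup>2 + lam) * (1 / real (Suc k))"
      by (simp add: lip.nrm_nonneg hip.diff_mem comb_mem assms)
    show "(\<lambda>k. sqrt (kap\<^sup>2 + lam) * (1 / real (Suc k))) \<longlonglongrightarrow> 0"
      using tendsto_mult_left[OF LIMSEQ_inverse_real_of_nat, of "sqrt (kap\<^sup>2 + lam)"]
      by (simp add: inverse_eq_divide)
  qed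
  then show ?thesis by (rule that)
qed

lemma nrm_tendsto:
  assumes "\<And>k. F k \<in> H" "f \<in> H" "(\<lambda>k. lip.nrm (\<lambda>x. F k x - f x)) \<longlonglongrightarrow> 0"
  shows "(\<lambda>k. lip.nrm (F k)) \<longlonglongrightarrow> lip.nrm f"
proof (rule LIM_zero_cancel, rule Lim_null_comparison[OF _ assms(3)])
  have "\<bar>lip.nrm (F k) - lip.nrm f\<bar> \<le> lip.nrm (\<lambda>x. F k x - f x)" for k
  proof -
    have "lip.nrm (\<lambda>x. f x - F k x) = lip.nrm (\<lambda>x. F k x - f x)"
      using lip.nrm_scale[OF hip.diff_mem[OF assms(1) assms(2)], of "-1" k] by simp
    then show ?thesis
      using lip.nrm_triangle_diff[OF assms(1) assms(2), of k] lip.nrm_triangle_diff[OF assms(2) assms(1), of k] by simp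
  qed
  then show "\<forall>\<^sub>F k in sequentially. norm (lip.nrm (F k) - lip.nrm f) \<le> lip.nrm (\<lambda>x. F k x - f x)"
    by simp
qed

lemma dev_tendsto:
  assumes "\<And>k. F k \<in> H" "f \<in> H" "g \<in> H" "(\<lambda>k. lip.nrm (\<lambda>x. F k x - f x)) \<longlonglongrightarrow> 0"
  shows "(\<lambda>k. dev n X I j w (F k) g) \<longlonglongrightarrow> dev n X I j w f g"
proof (rule LIM_zero_cancel, rule Lim_null_comparison)
  show "\<forall>\<^sub>F k in sequentially. norm (dev n X I j w (F k) g - dev n X I j w f g)
      \<le> dev_const n I j w * lip.nrm (\<lambda>x. F k x - f x) * lip.nrm g"
    using dev_bound[OF hip.diff_mem[OF assms(1,2)] assms(3), where n = n and X = X and I = I and j = j and w = w] assms by (simp add: dev_diff_left)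
  show "(\<lambda>k. dev_const n I j w * lip.nrm (\<lambda>x. F k x - f x) * lip.nrm g) \<longlonglongrightarrow> 0"
    using tendsto_mult_right[OF tendsto_mult_left[OF assms(4), of "dev_const n I j w"], of "lip.nrm g"] by simp
qed

definition unit_comb :: "rat list \<Rightarrow> 'a \<Rightarrow> real" where
  "unit_comb l = (\<lambda>x. 1 / lip.nrm (comb l) * comb l x)"

definition combs :: "(rat list \<times> rat list) set" where
  "combs = {(l, l'). lip.nrm (comb l) \<noteq> 0 \<and> lip.nrm (comb l') \<noteq> 0}"

lemma unit_comb_mem: "unit_comb l \<in> H"
  unfolding unit_comb_def by (rule hip.scale_mem[OF comb_mem])

lemma combs_xi_set: "(l, l') \<in> combs \<Longrightarrow> \<bar>dev n X I j w (unit_comb l) (unit_comb l')\<bar> \<in> xi_set n X I j w"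
  unfolding xi_set_def combs_def unit_comb_def
  using unit_mem[OF comb_mem] by blast

lemma combs_bdd: "bdd_above ((\<lambda>(l, l'). \<bar>dev n X I j w (unit_comb l) (unit_comb l')\<bar>) ` combs)"
  by (rule bdd_above_mono[OF bdd_xi_set[of n X I j w]]) (auto intro: combs_xi_set)

text \<open>The homogeneous inequality with constant \<open>S\<close> holds on rational combinations
  and extends to \<open>H\<close> by continuity, one argument at a time; on unit vectors it bounds
  the full supremum. Homogeneity also handles the normalisation, so no unit vectors have to be
  approximated by unit vectors.\<close>

lemma xi_countable_Sup:
  "xi dens H ip lam n X I j w = (SUP (l, l')\<in>combs. \<bar>dev n X I j w (unit_comb l) (unit_comb l')\<bar>)"
  (is "_ = ?S")
proof (cases "combs = {}")
  case True
  \<comment> \<open>No element of \<open>H\<close> then has norm 1, and both suprema are over the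
    empty set.\<close>
  have "lip.nrm f = 0" if f: "f \<in> H" for f
  proof -
    obtain l where l: "(\<lambda>k. lip.nrm (\<lambda>x. comb (l k) x - f x)) \<longlonglongrightarrow> 0" by (rule comb_sequence[OF f])
    have "lip.nrm (comb (l k)) = 0" for k using True by (auto simp: combs_def)
    then show ?thesis using nrm_tendsto[OF comb_mem f l] by (simp add: LIMSEQ_const_iff)
  qed
  then have "xi_set n X I j w = {}" by (auto simp: xi_set_def)
  then show ?thesis by (simp add: xi_eq True)
next
  case False
  define S where "S = ?S"
  have 1: "\<bar>dev n X I j w (comb l) (comb l')\<bar> \<le> S * (lip.nrm (comb l) * lip.nrm (comb l'))" for l l'
  proof (cases "(l, l') \<in> combs")
    case True
    then have "\<bar>dev n X I j w (unit_comb l) (unit_comb l')\<bar> \<le> S"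
      unfolding S_def using combs_bdd[of n X I j w] by (intro cSup_upper) auto
    then show ?thesis
      using True unfolding combs_def unit_comb_def
      by (subst dev_unit) (auto intro!: mult_right_mono mult_nonneg_nonneg comb_mem lip.nrm_nonneg)
  next
    case False
    then have z: "lip.nrm (comb l) * lip.nrm (comb l') = 0" by (auto simp: combs_def)
    show ?thesis unfolding z dev_zero[OF comb_mem comb_mem z] by simp
  qed
  have 2: "\<bar>dev n X I j w f (comb l')\<bar> \<le> S * (lip.nrm f * lip.nrm (comb l'))" if f: "f \<in> H" for f l'
  proof -
    obtain l where l: "(\<lambda>k. lip.nrm (\<lambda>x. comb (l k) x - f x)) \<longlonglongrightarrow> 0" by (rule comb_sequence[OF f])
    show ?thesis
      by (rule LIMSEQ_le[OF tendsto_rabs[OF dev_tendsto[OF comb_mem f comb_mem l]]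
            tendsto_mult_left[OF tendsto_mult_right[OF nrm_tendsto[OF comb_mem f l]]]])
        (use 1 in auto)
  qed
  have 3: "\<bar>dev n X I j w f g\<bar> \<le> S * (lip.nrm f * lip.nrm g)" if f: "f \<in> H" and g: "g \<in> H" for f g
  proof -
    obtain l where l: "(\<lambda>k. lip.nrm (\<lambda>x. comb (l k) x - g x)) \<longlonglongrightarrow> 0" by (rule comb_sequence[OF g])
    \<comment> \<open>Continuity is available in the first argument, so the symmetry of
      \<open>dev\<close> swaps the roles.\<close>
    have "\<bar>dev n X I j w (comb l') f\<bar> \<le> S * (lip.nrm f * lip.nrm (comb l'))" for l'
      using 2[OF f, of l'] dev_commute[OF f comb_mem, of n X I j w l'] by simp
    then have "\<bar>dev n X I j w g f\<bar> \<le> S * (lip.nrm f * lip.nrm g)"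
      by (intro LIMSEQ_le[OF tendsto_rabs[OF dev_tendsto[OF comb_mem g f l]]
            tendsto_mult_left[OF tendsto_mult_left[OF nrm_tendsto[OF comb_mem g l]]]]) auto
    then show ?thesis using dev_commute[OF f g, of n X I j w] by simp
  qed
  have "Sup (xi_set n X I j w) = S"
  proof (rule antisym)
    obtain l l' where "(l, l') \<in> combs" using False by auto
    then have "xi_set n X I j w \<noteq> {}" using combs_xi_set[of l l' n X I j w] by blast
    then show "Sup (xi_set n X I j w) \<le> S"
    proof (rule cSup_least)
      fix y assume "y \<in> xi_set n X I j w"
      then obtain f g where *: "y = \<bar>dev n X I j w f g\<bar>" "f \<in> H" "g \<in> H" "lip.nrm f = 1" "lip.nrm g = 1"
        by (auto simp: xi_set_def)
      show "y \<le> S" using 3[OF *(2,3)] by (simp add: *)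
    qed
    show "S \<le> Sup (xi_set n X I j w)"
      unfolding S_def using False
      by (intro cSUP_least) (auto intro!: cSup_upper combs_xi_set bdd_xi_set)
  qed
  then show ?thesis by (simp add: xi_eq S_def)
qed

lemma max_xi_measurable:
  assumes "0 < s"
  shows "(\<lambda>p. max_xi dens H ip lam s n (\<lambda>i p. snd p i) fst p) \<in> borel_measurable (cov_space N s n)"
  unfolding max_xi_def
proof (rule borel_measurable_Max)
  fix j assume j: "j \<in> {1..s}"
  have P: "(\<lambda>p. P_emp n (\<lambda>i p. snd p i) fst j p (\<lambda>x. f x * g x)) \<in> borel_measurable (cov_space N s n)"
    if f: "f \<in> H" and g: "g \<in> H" for f g
  proof -
    have [measurable]: "f \<in> borel_measurable borel" "g \<in> borel_measurable borel"
      using f g by (auto intro: H_measurable)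
    \<comment> \<open>The random index set is traded for indicators over the fixed range, which
      makes the sum visibly measurable.\<close>
    have "(\<lambda>p. 1 / real n * (\<Sum>i\<in>{1..N}. (if i \<in> fst p j then 1 else 0) * (f (snd p i) * g (snd p i))))
        \<in> borel_measurable (cov_space N s n)"
    proof (intro borel_measurable_times borel_measurable_sum borel_measurable_const)
      fix i assume i: "i \<in> {1..N}"
      show "(\<lambda>p. if i \<in> fst p j then 1 else 0 :: real) \<in> borel_measurable (cov_space N s n)"
        by (rule cov_fst_measurable)
      show "(\<lambda>p. f (snd p i)) \<in> borel_measurable (cov_space N s n)"
        "(\<lambda>p. g (snd p i)) \<in> borel_measurable (cov_space N s n)"
        by (rule measurable_compose[OF cov_snd_measurable[OF i]]; simp)+
    qed
    then show ?thesis
    proof (rule measurable_cong[THEN iffD1, rotated])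
      fix p :: "(nat \<Rightarrow> nat set) \<times> (nat \<Rightarrow> 'a)"
      assume "p \<in> space (cov_space N s n)"
      then have "fst p j \<subseteq> {1..N}" using j by (auto simp: space_pair_measure divisions_def)
      then have "(\<Sum>i\<in>{1..N}. (if i \<in> fst p j then 1 else 0) * (f (snd p i) * g (snd p i))) = (\<Sum>i\<in>fst p j. f (snd p i) * g (snd p i))"
        by (intro sum.mono_neutral_cong_right) auto
      then show "1 / real n * (\<Sum>i\<in>{1..N}. (if i \<in> fst p j then 1 else 0) * (f (snd p i) * g (snd p i))) =
          P_emp n (\<lambda>i p. snd p i) fst j p (\<lambda>x. f x * g x)"
        by (simp add: P_emp_def)
    qed
  qed
  show "xi dens H ip lam n (\<lambda>i p. snd p i) fst j \<in> borel_measurable (cov_space N s n)"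
    unfolding xi_countable_Sup[abs_def] case_prod_unfold
  proof (rule borel_measurable_cSUP)
    show "countable combs" by (rule countableI_type)
    show "(\<lambda>p. \<bar>dev n (\<lambda>i p. snd p i) fst j p (unit_comb (fst z)) (unit_comb (snd z))\<bar>) \<in> borel_measurable (cov_space N s n)" for z
      unfolding dev_def by (intro borel_measurable_abs borel_measurable_diff P unit_comb_mem borel_measurable_const)
    show "bdd_above ((\<lambda>z. \<bar>dev n (\<lambda>i p. snd p i) fst j p (unit_comb (fst z)) (unit_comb (snd z))\<bar>) ` combs)" for p
      using combs_bdd[of n "\<lambda>i p. snd p i" fst j p] by (simp add: case_prod_unfold)
  qed
qed simp

end

section \<open>Conditional moments of the noise\<close>

text \<open>Independence makes the joint law a product, so Fubini applies with the first variable
  frozen at \<open>q\<close>. The event then becomes its section at \<open>q\<close>, an event of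
  \<open>x (Z w)\<close> alone, which is what a hypothesis on conditional moments can
  handle.\<close>

lemma (in prob_space) indep_var_integral_section:
  fixes g h :: "'q \<Rightarrow> real"
  assumes ind: "indep_var Q W S Z"
    and [measurable]: "g \<in> borel_measurable Q" "h \<in> borel_measurable S" "x \<in> measurable S T"
    and B [measurable]: "B \<in> sets (Q \<Otimes>\<^sub>M T)"
    and int: "integrable M (\<lambda>w. g (W w) * h (Z w))"
  shows "expectation (\<lambda>w. g (W w) * h (Z w) * indicator B (W w, x (Z w))) =
    (\<integral>q. g q * expectation (\<lambda>w. h (Z w) * indicator (Pair q -` B) (x (Z w))) \<partial>distr M Q W)"
proof -
  have [measurable]: "random_variable Q W" "random_variable S Z"
    using ind by (auto dest: indep_var_rv1 indep_var_rv2)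
  interpret W: prob_space "distr M Q W" by (rule prob_space_distr) simp
  interpret Z: prob_space "distr M S Z" by (rule prob_space_distr) simp
  interpret WZ: pair_prob_space "distr M Q W" "distr M S Z" ..
  have eq: "distr M Q W \<Otimes>\<^sub>M distr M S Z = distr M (Q \<Otimes>\<^sub>M S) (\<lambda>w. (W w, Z w))"
    using ind by (simp add: indep_var_distribution_eq)
  define F where "F = (\<lambda>(q, z). g q * h z * indicator B (q, x z))"
  have [measurable]: "F \<in> borel_measurable (Q \<Otimes>\<^sub>M S)" unfolding F_def by measurable
  have "integrable M (\<lambda>w. F (W w, Z w))"
    unfolding F_def prod.case by (rule Bochner_Integration.integrable_bound[OF int]) (auto split: split_indicator)
  then have "integrable (distr M Q W \<Otimes>\<^sub>M distr M S Z) F"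
    unfolding eq by (subst integrable_distr_eq) auto
  then have "(\<integral>q. (\<integral>z. F (q, z) \<partial>distr M S Z) \<partial>distr M Q W) = integral\<^sup>L (distr M Q W \<Otimes>\<^sub>M distr M S Z) F"
    by (rule WZ.integral_fst')
  also have "\<dots> = expectation (\<lambda>w. F (W w, Z w))"
    unfolding eq by (subst integral_distr) auto
  finally have 1: "expectation (\<lambda>w. F (W w, Z w)) = (\<integral>q. (\<integral>z. F (q, z) \<partial>distr M S Z) \<partial>distr M Q W)" ..
  have "(\<integral>z. F (q, z) \<partial>distr M S Z) = g q * expectation (\<lambda>w. h (Z w) * indicator (Pair q -` B) (x (Z w)))"
    if "q \<in> space Q" for q
  proof -
    have [measurable]: "Pair q -` B \<in> sets T" by (rule sets_Pair1[OF B])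
    have "(\<integral>z. F (q, z) \<partial>distr M S Z) = (\<integral>z. g q * (h z * indicator (Pair q -` B) (x z)) \<partial>distr M S Z)"
      by (simp add: F_def indicator_def mult.assoc)
    also have "\<dots> = expectation (\<lambda>w. g q * (h (Z w) * indicator (Pair q -` B) (x (Z w))))"
      by (subst integral_distr) auto
    finally show ?thesis by simp
  qed
  then show ?thesis
    using 1 by (simp add: F_def) (intro Bochner_Integration.integral_cong refl; simp)
qed

lemma finite_divisions: "finite (divisions N s n)"
proof (rule finite_subset)
  show "divisions N s n \<subseteq> {1..s} \<rightarrow>\<^sub>E Pow {1..N}" by (auto simp: divisions_def)
qed (intro finite_PiE; simp)

lemma sets_vimage_algebra_of:
  assumes "T \<in> X \<rightarrow> space Q" "A \<in> sets (vimage_algebra X T Q)"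
  obtains B where "B \<in> sets Q" "A = T -` B \<inter> X"
  using assms by (auto simp: sets_vimage_algebra2)

lemma subalgebra_vimage_algebra:
  "T \<in> measurable M Q \<Longrightarrow> subalgebra M (vimage_algebra (space M) T Q)"
  unfolding subalgebra_def
  by (auto simp: sets_vimage_algebra2 measurable_space intro: measurable_sets)

lemma (in sigma_finite_subalgebra) real_cond_exp_sum_on:
  assumes "finite A" "\<And>i. i \<in> A \<Longrightarrow> integrable M (g i)"
  shows "AE x in M. real_cond_exp M F (\<lambda>x. \<Sum>i\<in>A. g i x :: real) x = (\<Sum>i\<in>A. real_cond_exp M F (g i) x)"
  using assms
proof (induction A rule: finite_induct)
  case empty
  then show ?case using real_cond_exp_F_meas[of "\<lambda>x. 0"] by simp
next
  case (insert k A)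
  have "AE x in M. real_cond_exp M F (\<lambda>x. g k x + (\<Sum>i\<in>A. g i x)) x =
      real_cond_exp M F (g k) x + real_cond_exp M F (\<lambda>x. \<Sum>i\<in>A. g i x) x"
    by (rule real_cond_exp_add) (use insert.prems in auto)
  then show ?case
    using insert.IH insert.prems insert.hyps by (auto elim!: eventually_elim2)
qed

text \<open>The bridge between the extended conditional expectation, in which the result is stated,
  and the real one, in which the signed cross terms can be expanded.\<close>

lemma (in sigma_finite_subalgebra) nn_cond_exp_eq_real_cond_exp:
  fixes u :: "'a \<Rightarrow> real"
  assumes int: "integrable M u" and nonneg: "\<And>x. 0 \<le> u x"
  shows "AE x in M. nn_cond_exp M F (\<lambda>x. ennreal (u x)) x = ennreal (real_cond_exp M F u x)"
proof -
  have [measurable]: "u \<in> borel_measurable M" using int by simp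
  have neg: "(\<lambda>x. ennreal (- u x)) = (\<lambda>x. 0)" using nonneg by (auto simp: ennreal_neg)
  have "AE x in M. nn_cond_exp M F (\<lambda>x. 0) x = 0"
    using nn_cond_exp_F_meas[of "\<lambda>x. 0"] by simp
  \<comment> \<open>A finite integral excludes the value infinity almost everywhere, so the
    conversion to reals loses nothing.\<close>
  moreover have "AE x in M. nn_cond_exp M F (\<lambda>x. ennreal (u x)) x \<noteq> \<infinity>"
  proof (rule nn_integral_PInf_AE)
    have "(\<integral>\<^sup>+x. nn_cond_exp M F (\<lambda>x. ennreal (u x)) x \<partial>M) = (\<integral>\<^sup>+x. ennreal (u x) \<partial>M)"
      using nn_cond_exp_intg[of "\<lambda>_. 1" "\<lambda>x. ennreal (u x)"] by simp
    also have "\<dots> < \<infinity>" using int nonneg by (simp add: nn_integral_eq_integral)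
    finally show "(\<integral>\<^sup>+x. nn_cond_exp M F (\<lambda>x. ennreal (u x)) x \<partial>M) \<noteq> \<infinity>" by simp
  qed simp
  ultimately show ?thesis
    by eventually_elim (simp add: real_cond_exp_def neg less_top)
qed

section \<open>Moments of the noise on events of the covariates\<close>

locale bounded_noise = regression_model M D dens sigma2 f X Y
  for M :: "'w measure" and D :: "'a::euclidean_space set" and dens sigma2 f X Y +
  fixes c :: real
  assumes f_measurable [measurable]: "f \<in> borel_measurable borel"
    and sigma2_le: "x \<in> D \<Longrightarrow> sigma2 x \<le> c"
begin

abbreviation "\<epsilon> \<equiv> noise f X Y"

definition Z where "Z i w = (X i w, Y i w)"
definition res :: "'a \<times> real \<Rightarrow> real" where "res z = snd z - f (fst z)"

lemma \<epsilon>_eq: "\<epsilon> i w = res (Z i w)"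
  by (simp add: noise_def res_def Z_def)

lemma fst_borel [measurable]: "(fst :: 'a \<times> real \<Rightarrow> 'a) \<in> borel_measurable borel"
  by (intro borel_measurable_continuous_onI continuous_on_fst continuous_on_id)

lemma snd_borel [measurable]: "(snd :: 'a \<times> real \<Rightarrow> real) \<in> borel_measurable borel"
  by (intro borel_measurable_continuous_onI continuous_on_snd continuous_on_id)

lemma res_measurable [measurable]: "res \<in> borel_measurable borel"
  unfolding res_def by measurable

lemma indep_Z: "indep_vars (\<lambda>_. borel) Z {1..}"
  using indep unfolding Z_def .

lemma Z_measurable: "1 \<le> i \<Longrightarrow> Z i \<in> borel_measurable M"
  using indep_Z by (auto simp: indep_vars_def)

lemma X_measurable: "1 \<le> i \<Longrightarrow> X i \<in> borel_measurable M"
  using measurable_compose[OF Z_measurable fst_borel, of i] by (simp add: Z_def)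

lemma \<epsilon>_measurable: "1 \<le> i \<Longrightarrow> \<epsilon> i \<in> borel_measurable M"
  using measurable_compose[OF Z_measurable res_measurable, of i] by (simp add: \<epsilon>_eq[abs_def])

text \<open>The density vanishes off \<open>D\<close>. The bound on \<open>sigma2\<close> is
  available on \<open>D\<close> only, so it can be applied to the covariates almost surely.\<close>

lemma X_in_D:
  assumes "1 \<le> i" shows "AE w in M. X i w \<in> D"
proof -
  have [measurable]: "X i \<in> borel_measurable M" "D \<in> sets borel" by (rule X_measurable[OF assms], rule D_borel)
  note d = X_dens[OF assms]
  have "emeasure M (X i -` (UNIV - D) \<inter> space M) = (\<integral>\<^sup>+x. ennreal (dens x) * indicator (UNIV - D) x \<partial>lborel)"
    by (rule distributed_emeasure[OF d]) simp
  also have "\<dots> = 0"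
    by (rule nn_integral_0_iff_AE[THEN iffD2])
      (use distributed_borel_measurable[OF d] in \<open>auto simp: dens_support split: split_indicator\<close>)
  finally have "X i -` (UNIV - D) \<inter> space M \<in> null_sets M"
    by (intro null_setsI) simp_all
  then show ?thesis by (rule AE_I') auto
qed

lemma cond_sets:
  "1 \<le> i \<Longrightarrow> sigma_finite_subalgebra M (vimage_algebra (space M) (X i) borel)"
  by (rule finite_measure_subalgebra_is_sigma_finite, unfold_locales)
    (rule subalgebra_vimage_algebra[OF X_measurable])

lemma noise_mean_zero:
  assumes i: "1 \<le> i" and B: "B \<in> sets borel"
  shows "expectation (\<lambda>w. \<epsilon> i w * indicator B (X i w)) = 0"
proof -
  let ?F = "vimage_algebra (space M) (X i) borel"
  interpret sigma_finite_subalgebra M ?F by (rule cond_sets[OF i])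
  have "X i -` B \<inter> space M \<in> sets ?F" by (rule in_vimage_algebra[OF B])
  then have "(\<integral>w\<in>X i -` B \<inter> space M. \<epsilon> i w \<partial>M) = (\<integral>w\<in>X i -` B \<inter> space M. real_cond_exp M ?F (\<epsilon> i) w \<partial>M)"
    by (rule real_cond_exp_intA[OF noise_integrable[OF i]])
  also have "\<dots> = 0"
    unfolding set_lebesgue_integral_def using noise_mean[OF i]
    by (subst integral_eq_zero_AE) auto
  finally show ?thesis
    unfolding set_lebesgue_integral_def
    by (subst (asm) Bochner_Integration.integral_cong[OF refl, where g = "\<lambda>w. \<epsilon> i w * indicator B (X i w)"])
      (auto split: split_indicator)
qed

lemma noise_sq_nn:
  assumes i: "1 \<le> i" and B: "B \<in> sets borel"
  shows "(\<integral>\<^sup>+w. indicator B (X i w) * ennreal ((\<epsilon> i w)\<^sup>2) \<partial>M) \<le> (\<integral>\<^sup>+w. indicator B (X i w) * ennreal c \<partial>M)"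
proof -
  let ?F = "vimage_algebra (space M) (X i) borel"
  interpret sigma_finite_subalgebra M ?F by (rule cond_sets[OF i])
  have [measurable]: "\<epsilon> i \<in> borel_measurable M" "B \<in> sets borel" by (rule \<epsilon>_measurable[OF i], rule B)
  have [measurable]: "X i \<in> measurable ?F borel" by (rule measurable_vimage_algebra1) auto
  have "(\<integral>\<^sup>+w. indicator B (X i w) * ennreal ((\<epsilon> i w)\<^sup>2) \<partial>M)
      = (\<integral>\<^sup>+w. indicator B (X i w) * nn_cond_exp M ?F (\<lambda>w. ennreal ((\<epsilon> i w)\<^sup>2)) w \<partial>M)"
    by (intro nn_cond_exp_intg[symmetric]) measurable
  also have "\<dots> \<le> (\<integral>\<^sup>+w. indicator B (X i w) * ennreal c \<partial>M)"
    using noise_var[OF i] X_in_D[OF i]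
    by (intro nn_integral_mono_AE) (auto elim!: eventually_elim2 intro!: mult_left_mono ennreal_leI sigma2_le)
  finally show ?thesis .
qed

lemma noise_sq_integrable: "1 \<le> i \<Longrightarrow> integrable M (\<lambda>w. (\<epsilon> i w)\<^sup>2)"
  using noise_sq_nn[of i UNIV] \<epsilon>_measurable[of i]
  by (intro integrableI_bounded) (auto simp: emeasure_space_1 less_top[symmetric] top_unique)

lemma noise_sq_le:
  assumes i: "1 \<le> i" and B: "B \<in> sets borel"
  shows "expectation (\<lambda>w. ((\<epsilon> i w)\<^sup>2 - c) * indicator B (X i w)) \<le> 0"
proof -
  have [measurable]: "\<epsilon> i \<in> borel_measurable M" "X i \<in> borel_measurable M" "B \<in> sets borel"
    by (rule \<epsilon>_measurable[OF i], rule X_measurable[OF i], rule B)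
  \<comment> \<open>An almost sure event is nonempty, so \<open>D\<close> has a point, and there
    \<open>0 < sigma2\<close> and \<open>sigma2 \<le> c\<close> fix the sign of
    \<open>c\<close>.\<close>
  have D: "D \<noteq> {}" using X_in_D[OF i] AE_E_prob by fastforce
  then have c: "0 \<le> c" using sigma2_le sigma2_pos by (metis ex_in_conv le_less_trans less_le_not_le linear)
  have int: "integrable M (\<lambda>w. (\<epsilon> i w)\<^sup>2 * indicator B (X i w))" "integrable M (\<lambda>w. c * indicator B (X i w))"
  proof -
    show "integrable M (\<lambda>w. (\<epsilon> i w)\<^sup>2 * indicator B (X i w))"
      by (rule Bochner_Integration.integrable_bound[OF noise_sq_integrable[OF i]])
        (auto split: split_indicator)
    show "integrable M (\<lambda>w. c * indicator B (X i w))"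
      by (rule integrable_const_bound[of _ c]) (auto simp: c split: split_indicator)
  qed
  have "ennreal (expectation (\<lambda>w. (\<epsilon> i w)\<^sup>2 * indicator B (X i w))) \<le> ennreal (expectation (\<lambda>w. c * indicator B (X i w)))"
  proof -
    have "ennreal (expectation (\<lambda>w. (\<epsilon> i w)\<^sup>2 * indicator B (X i w))) = (\<integral>\<^sup>+w. ennreal ((\<epsilon> i w)\<^sup>2 * indicator B (X i w)) \<partial>M)"
      by (rule nn_integral_eq_integral[symmetric, OF int(1)]) auto
    also have "\<dots> = (\<integral>\<^sup>+w. indicator B (X i w) * ennreal ((\<epsilon> i w)\<^sup>2) \<partial>M)"
      by (intro nn_integral_cong) (auto split: split_indicator)
    also have "\<dots> \<le> (\<integral>\<^sup>+w. indicator B (X i w) * ennreal c \<partial>M)" by (rule noise_sq_nn[OF i B])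
    also have "\<dots> = (\<integral>\<^sup>+w. ennreal (c * indicator B (X i w)) \<partial>M)"
      by (intro nn_integral_cong) (auto split: split_indicator)
    also have "\<dots> = ennreal (expectation (\<lambda>w. c * indicator B (X i w)))"
      by (rule nn_integral_eq_integral[OF int(2)]) (auto simp: c)
    finally show ?thesis .
  qed
  then have "expectation (\<lambda>w. (\<epsilon> i w)\<^sup>2 * indicator B (X i w)) \<le> expectation (\<lambda>w. c * indicator B (X i w))"
    using c by (subst (asm) ennreal_le_iff) (auto intro!: integral_nonneg)
  then show ?thesis using int by (simp add: left_diff_distrib)
qed

lemma noise_prod_integrable:
  assumes "1 \<le> i" "1 \<le> k" shows "integrable M (\<lambda>w. \<epsilon> i w * \<epsilon> k w)"
proof (rule Bochner_Integration.integrable_bound)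
  show "integrable M (\<lambda>w. (\<epsilon> i w)\<^sup>2 + (\<epsilon> k w)\<^sup>2)"
    by (intro Bochner_Integration.integrable_add noise_sq_integrable assms)
  show "(\<lambda>w. \<epsilon> i w * \<epsilon> k w) \<in> borel_measurable M"
    by (intro borel_measurable_times \<epsilon>_measurable assms)
  have "\<bar>x * y\<bar> \<le> x\<^sup>2 + y\<^sup>2" for x y :: real
    using sum_squares_bound[of "\<bar>x\<bar>" "\<bar>y\<bar>"] mult_nonneg_nonneg[of "\<bar>x\<bar>" "\<bar>y\<bar>"]
    by (simp add: abs_mult del: zero_le_mult_iff mult_nonneg_nonneg)
  then show "AE w in M. norm (\<epsilon> i w * \<epsilon> k w) \<le> norm ((\<epsilon> i w)\<^sup>2 + (\<epsilon> k w)\<^sup>2)"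
    by simp
qed

text \<open>
  The three moments are \<open>g (W) * h (Z i)\<close> with \<open>W\<close> the other observations: \<open>g\<close> is
  $\epsilon_k$ or \<open>1\<close>, and \<open>h\<close> is $\epsilon_i$ or $\epsilon_i^2 - c$.
\<close>

lemma noise_section:
  fixes h :: "'a \<times> real \<Rightarrow> real" and g :: "(nat \<Rightarrow> 'a \<times> real) \<Rightarrow> real"
  assumes i: "i \<in> {1..N}" and B [measurable]: "B \<in> sets (\<Pi>\<^sub>M l\<in>{1..N}. borel)"
    and [measurable]: "h \<in> borel_measurable borel"
      "g \<in> borel_measurable (\<Pi>\<^sub>M l\<in>{1..N} - {i}. borel)"
    and int: "integrable M (\<lambda>w. g (\<lambda>l\<in>{1..N} - {i}. Z l w) * h (Z i w))"
  obtains B' where "\<And>q. B' q \<in> sets borel"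
    "expectation (\<lambda>w. g (\<lambda>l\<in>{1..N} - {i}. Z l w) * h (Z i w) * indicator B (\<lambda>l\<in>{1..N}. X l w)) =
      (\<integral>q. g q * expectation (\<lambda>w. h (Z i w) * indicator (B' q) (X i w))
        \<partial>distr M (\<Pi>\<^sub>M l\<in>{1..N} - {i}. borel) (\<lambda>w. \<lambda>l\<in>{1..N} - {i}. Z l w))"
proof -
  let ?Q = "\<Pi>\<^sub>M l\<in>{1..N} - {i}. (borel :: ('a \<times> real) measure)"
  let ?W = "\<lambda>w. \<lambda>l\<in>{1..N} - {i}. Z l w"
  \<comment> \<open>Reassembles the covariate vector from the other observations and the covariate
    at \<open>i\<close>, so that \<open>B\<close> becomes an event of this pair.\<close>
  define mrg where "mrg = (\<lambda>(q :: nat \<Rightarrow> 'a \<times> real, x :: 'a). \<lambda>l\<in>{1..N}. if l = i then x else fst (q l))"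
  have [measurable]: "mrg \<in> measurable (?Q \<Otimes>\<^sub>M borel) (\<Pi>\<^sub>M l\<in>{1..N}. borel)"
    unfolding mrg_def split_def
  proof (rule measurable_restrict)
    fix l assume l: "l \<in> {1..N}"
    show "(\<lambda>p. if l = i then snd p else fst (fst p l)) \<in> borel_measurable (?Q \<Otimes>\<^sub>M borel)"
    proof (cases "l = i")
      case False
      then have "(\<lambda>p. fst p l) \<in> measurable (?Q \<Otimes>\<^sub>M (borel :: 'a measure)) borel"
        using l by (intro measurable_compose[OF measurable_fst measurable_component_singleton]) auto
      then show ?thesis using False measurable_compose[OF _ fst_borel] by auto
    qed simp
  qed
  define B2 where "B2 = mrg -` B \<inter> space (?Q \<Otimes>\<^sub>M borel)"
  have B2 [measurable]: "B2 \<in> sets (?Q \<Otimes>\<^sub>M borel)" unfolding B2_def by measurable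
  \<comment> \<open>Independence over disjoint index sets yields families on both sides; the
    observation at \<open>i\<close> appears as a family over \<open>{i}\<close>, which
    \<open>Zi\<close> below undoes.\<close>
  have ind: "indep_var ?Q ?W (\<Pi>\<^sub>M l\<in>{i}. borel) (\<lambda>w. \<lambda>l\<in>{i}. Z l w)"
    by (rule indep_var_restrict[OF indep_Z]) (use i in auto)
  have "mrg (?W w, fst (Z i w)) = (\<lambda>l\<in>{1..N}. X l w)" for w
    using i by (auto simp: mrg_def Z_def fun_eq_iff)
  then have ind_eq: "indicator B2 (?W w, fst (Z i w)) = (indicator B (\<lambda>l\<in>{1..N}. X l w) :: real)"
    if "w \<in> space M" for w
    using that by (auto simp: B2_def indicator_def space_pair_measure space_PiM)
  have "expectation (\<lambda>w. g (?W w) * h (Z i w) * indicator B (\<lambda>l\<in>{1..N}. X l w))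
     = expectation (\<lambda>w. g (?W w) * h (Z i w) * indicator B2 (?W w, fst (Z i w)))"
    by (intro Bochner_Integration.integral_cong refl) (simp add: ind_eq del: One_nat_def)
  also have "\<dots> = (\<integral>q. g q * expectation (\<lambda>w. h (Z i w) * indicator (Pair q -` B2) (fst (Z i w))) \<partial>distr M ?Q ?W)"
  proof -
    have Zi: "(\<lambda>l\<in>{i}. Z l w) i = Z i w" for w by simp
    show ?thesis
      by (rule indep_var_integral_section[OF ind, of g "\<lambda>z. h (z i)" "\<lambda>z. fst (z i)" borel B2, unfolded Zi])
        (measurable, rule int)
  qed
  finally have "expectation (\<lambda>w. g (?W w) * h (Z i w) * indicator B (\<lambda>l\<in>{1..N}. X l w)) = \<dots>" .
  moreover have "Pair q -` B2 \<in> sets borel" for q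
    by (rule sets_Pair1[OF B2])
  ultimately show ?thesis
    using that[of "\<lambda>q. Pair q -` B2"] by (simp add: Z_def)
qed

text \<open>Once the other observations are frozen, an event of the whole covariate vector is an
  event of \<open>X i\<close>, where the model prescribes the conditional mean and variance.\<close>

lemma noise_moments_X:
  assumes i: "i \<in> {1..N}" and B: "B \<in> sets (\<Pi>\<^sub>M l\<in>{1..N}. borel)"
  shows "expectation (\<lambda>w. \<epsilon> i w * indicator B (\<lambda>l\<in>{1..N}. X l w)) = 0"
    and "k \<in> {1..N} \<Longrightarrow> k \<noteq> i \<Longrightarrow> expectation (\<lambda>w. \<epsilon> k w * \<epsilon> i w * indicator B (\<lambda>l\<in>{1..N}. X l w)) = 0"
    and "expectation (\<lambda>w. ((\<epsilon> i w)\<^sup>2 - c) * indicator B (\<lambda>l\<in>{1..N}. X l w)) \<le> 0"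
proof -
  have i1: "1 \<le> i" using i by simp
  show "expectation (\<lambda>w. \<epsilon> i w * indicator B (\<lambda>l\<in>{1..N}. X l w)) = 0"
  proof (rule noise_section[OF i B, of res "\<lambda>_. 1"])
    show "integrable M (\<lambda>w. 1 * res (Z i w))"
      using noise_integrable[OF i1] by (simp add: \<epsilon>_eq[abs_def])
  qed (use noise_mean_zero[OF i1] in \<open>simp_all add: \<epsilon>_eq\<close>)
  show "expectation (\<lambda>w. \<epsilon> k w * \<epsilon> i w * indicator B (\<lambda>l\<in>{1..N}. X l w)) = 0"
    if k: "k \<in> {1..N}" "k \<noteq> i"
  proof (rule noise_section[OF i B, of res "\<lambda>q. res (q k)"])
    show "(\<lambda>q. res (q k)) \<in> borel_measurable (\<Pi>\<^sub>M l\<in>{1..N} - {i}. borel)"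
      by (rule measurable_compose[OF _ res_measurable], rule measurable_component_singleton) (use k in auto)
    show "integrable M (\<lambda>w. res ((\<lambda>l\<in>{1..N} - {i}. Z l w) k) * res (Z i w))"
      using noise_prod_integrable[of k i] i k by (simp add: \<epsilon>_eq[abs_def])
  qed (use noise_mean_zero[OF i1] k in \<open>simp_all add: \<epsilon>_eq\<close>)
  show "expectation (\<lambda>w. ((\<epsilon> i w)\<^sup>2 - c) * indicator B (\<lambda>l\<in>{1..N}. X l w)) \<le> 0"
  proof (rule noise_section[OF i B, of "\<lambda>z. (res z)\<^sup>2 - c" "\<lambda>_. 1"])
    show "integrable M (\<lambda>w. 1 * ((res (Z i w))\<^sup>2 - c))"
      using noise_sq_integrable[OF i1] by (simp add: \<epsilon>_eq[abs_def])
    fix B' assume B': "\<And>q. B' q \<in> sets borel" and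
      eq: "expectation (\<lambda>w. 1 * ((res (Z i w))\<^sup>2 - c) * indicator B (\<lambda>l\<in>{1..N}. X l w)) =
      (\<integral>q. 1 * expectation (\<lambda>w. ((res (Z i w))\<^sup>2 - c) * indicator (B' q) (X i w))
        \<partial>distr M (\<Pi>\<^sub>M l\<in>{1..N} - {i}. borel) (\<lambda>w. \<lambda>l\<in>{1..N} - {i}. Z l w))"
    have "0 \<le> (\<integral>q. - expectation (\<lambda>w. ((res (Z i w))\<^sup>2 - c) * indicator (B' q) (X i w))
        \<partial>distr M (\<Pi>\<^sub>M l\<in>{1..N} - {i}. borel) (\<lambda>w. \<lambda>l\<in>{1..N} - {i}. Z l w))"
      by (intro Bochner_Integration.integral_nonneg) (use noise_sq_le[OF i1 B'] in \<open>simp add: \<epsilon>_eq\<close>)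
    then show ?thesis using eq by (simp add: \<epsilon>_eq)
  qed simp_all
qed

section \<open>Conditioning on the covariates together with the random division\<close>

definition cov :: "nat \<Rightarrow> ('w \<Rightarrow> nat \<Rightarrow> nat set) \<Rightarrow> 'w \<Rightarrow> (nat \<Rightarrow> nat set) \<times> (nat \<Rightarrow> 'a)" where
  "cov N I w = (I w, \<lambda>i\<in>{1..N}. X i w)"

lemma X_restrict_measurable: "(\<lambda>w. \<lambda>i\<in>{1..N}. X i w) \<in> measurable M (\<Pi>\<^sub>M i\<in>{1..N}. borel)"
  by (rule measurable_restrict) (auto intro: X_measurable)

context
  fixes N s n :: nat and I
  assumes division: "random_division M X Y N s n I"
begin

abbreviation "\<F> \<equiv> cov_algebra M X N s n I"

lemma cov_algebra_eq: "\<F> = vimage_algebra (space M) (cov N I) (cov_space N s n)"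
  by (simp add: cov_algebra_def cov_def[abs_def])

lemma I_measurable: "I \<in> measurable M (count_space (divisions N s n))"
  using division by (simp add: random_division_def)

lemma cov_measurable: "cov N I \<in> measurable M (cov_space N s n)"
  unfolding cov_def[abs_def] by (intro measurable_Pair I_measurable X_restrict_measurable)

lemma cov_measurable_\<F>: "cov N I \<in> measurable \<F> (cov_space N s n)"
  unfolding cov_algebra_eq
  by (rule measurable_vimage_algebra1) (use measurable_space[OF cov_measurable] in auto)

lemma cov_subalgebra: "sigma_finite_subalgebra M \<F>"
  unfolding cov_algebra_eq
  by (rule finite_measure_subalgebra_is_sigma_finite, unfold_locales)
    (rule subalgebra_vimage_algebra[OF cov_measurable])

text \<open>The division is independent of the whole sample, in particular of any function of it, so
  the expectation of the product factorises.\<close>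

lemma expectation_division:
  fixes G :: "(nat \<Rightarrow> 'a \<times> real) \<Rightarrow> real"
  assumes [measurable]: "G \<in> borel_measurable (\<Pi>\<^sub>M i\<in>{1..N}. borel)"
    and int: "integrable M (\<lambda>w. G (\<lambda>i\<in>{1..N}. Z i w))"
  shows "expectation (\<lambda>w. indicator {J} (I w) * G (\<lambda>i\<in>{1..N}. Z i w)) =
    expectation (\<lambda>w. indicator {J} (I w)) * expectation (\<lambda>w. G (\<lambda>i\<in>{1..N}. Z i w))"
proof (rule indep_var_lebesgue_integral[OF _ _ int])
  let ?A = "vimage_algebra (space M) I (count_space (divisions N s n))"
  let ?P = "\<Pi>\<^sub>M i\<in>{1..N}. (borel :: ('a \<times> real) measure)"
  let ?Zv = "\<lambda>w. \<lambda>i\<in>{1..N}. Z i w"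
  let ?B = "vimage_algebra (space M) ?Zv ?P"
  have ind: "indep_set (sets ?A) (sets ?B)"
    using division by (simp add: random_division_def Z_def[abs_def])
  have I [measurable]: "I \<in> measurable M (count_space (divisions N s n))" by (rule I_measurable)
  have Zv: "?Zv \<in> measurable M ?P"
    by (rule measurable_restrict) (auto intro: Z_measurable)
  have IA: "(\<lambda>w. indicator {J} (I w) :: real) \<in> borel_measurable ?A"
    by (rule measurable_compose[where g = "indicator {J}", OF measurable_vimage_algebra1])
      (use measurable_space[OF I] in auto)
  have GB: "(\<lambda>w. G (?Zv w)) \<in> borel_measurable ?B"
    by (rule measurable_compose[where g = G, OF measurable_vimage_algebra1 assms(1)])
      (use measurable_space[OF Zv] in auto)
  have IM: "(\<lambda>w. indicator {J} (I w) :: real) \<in> borel_measurable M"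
    by (rule measurable_from_subalg[OF subalgebra_vimage_algebra[OF I] IA])
  then show "integrable M (\<lambda>w. indicator {J} (I w) :: real)"
    by (rule integrable_const_bound[of _ 1, rotated]) (auto split: split_indicator)
  \<comment> \<open>Independence of real variables speaks of the sigma-algebras they generate; these
    lie inside the two for which it is given.\<close>
  have sub: "sigma_sets (space M) {h -` A \<inter> space M |A. A \<in> sets borel} \<subseteq> sets N'"
    if "h \<in> borel_measurable N'" "space N' = space M" for h :: "'w \<Rightarrow> real" and N'
    using that(1) unfolding that(2)[symmetric]
    by (intro sets.sigma_sets_subset) (auto intro: measurable_sets)
  show "indep_var borel (\<lambda>w. indicator {J} (I w) :: real) borel (\<lambda>w. G (?Zv w))"
    unfolding indep_var_eq
  proof (intro conjI IM)
    show "(\<lambda>w. G (?Zv w)) \<in> borel_measurable M"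
      by (rule borel_measurable_integrable[OF int])
    show "indep_set (sigma_sets (space M) {(\<lambda>w. indicator {J} (I w) :: real) -` A \<inter> space M |A. A \<in> sets borel})
        (sigma_sets (space M) {(\<lambda>w. G (?Zv w)) -` A \<inter> space M |A. A \<in> sets borel})"
      (is "indep_set ?S ?T")
    proof -
      have "?S \<subseteq> sets ?A" "?T \<subseteq> sets ?B"
        by (rule sub[OF IA], simp, rule sub[OF GB], simp)
      then show ?thesis
        using ind unfolding indep_sets2_eq by (meson order_trans subsetD)
    qed
  qed
qed

text \<open>There are finitely many divisions, and where \<open>I w = J\<close> an event of
  \<open>\<F>\<close> reduces to its section at \<open>J\<close>, an event of the covariates.
  Moments over events of \<open>\<F>\<close> are therefore weighted sums of moments over covariate
  events.\<close>

lemma expectation_cov: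
  fixes G :: "(nat \<Rightarrow> 'a \<times> real) \<Rightarrow> real"
  assumes G [measurable]: "G \<in> borel_measurable (\<Pi>\<^sub>M i\<in>{1..N}. borel)"
    and int: "integrable M (\<lambda>w. G (\<lambda>i\<in>{1..N}. Z i w))"
    and A: "A \<in> sets \<F>"
  obtains B where "\<And>J. B J \<in> sets (\<Pi>\<^sub>M i\<in>{1..N}. borel)"
    "expectation (\<lambda>w. G (\<lambda>i\<in>{1..N}. Z i w) * indicator A w) =
      (\<Sum>J\<in>divisions N s n. expectation (\<lambda>w. indicator {J} (I w)) *
         expectation (\<lambda>w. G (\<lambda>i\<in>{1..N}. Z i w) * indicator (B J) (\<lambda>i\<in>{1..N}. X i w)))"
proof -
  let ?P = "\<Pi>\<^sub>M i\<in>{1..N}. (borel :: ('a \<times> real) measure)"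
  let ?Zv = "\<lambda>w. \<lambda>i\<in>{1..N}. Z i w" and ?Xv = "\<lambda>w. \<lambda>i\<in>{1..N}. X i w"
  obtain B where B [measurable]: "B \<in> sets (cov_space N s n)" and A_eq: "A = cov N I -` B \<inter> space M"
    using A measurable_space[OF cov_measurable] unfolding cov_algebra_eq
    by (elim sets_vimage_algebra_of[rotated]) auto
  define B' where "B' J = Pair J -` B" for J
  have B' [measurable]: "B' J \<in> sets (\<Pi>\<^sub>M i\<in>{1..N}. borel)" for J
    unfolding B'_def by (rule sets_Pair1[OF B])
  define G' where "G' J z = G z * indicator (B' J) (\<lambda>i\<in>{1..N}. fst (z i))" for J z
  have fst_m [measurable]: "(\<lambda>z. \<lambda>i\<in>{1..N}. fst (z i)) \<in> measurable ?P (\<Pi>\<^sub>M i\<in>{1..N}. borel)"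
    by (intro measurable_restrict measurable_compose[OF _ fst_borel]) (rule measurable_component_singleton)
  have G' [measurable]: "G' J \<in> borel_measurable ?P" for J
    unfolding G'_def by measurable
  have Zv [measurable]: "?Zv \<in> measurable M ?P"
    by (rule measurable_restrict) (auto intro: Z_measurable)
  have G'Z: "G' J (?Zv w) = G (?Zv w) * indicator (B' J) (?Xv w)" for J w
  proof -
    have "(\<lambda>i\<in>{1..N}. fst (?Zv w i)) = ?Xv w" by (auto simp: Z_def)
    then show ?thesis by (simp only: G'_def)
  qed
  have intG': "integrable M (\<lambda>w. G' J (?Zv w))" for J
    by (rule Bochner_Integration.integrable_bound[OF int], rule measurable_compose[OF Zv G'])
      (auto simp: G'_def split: split_indicator)
  have Im: "(\<lambda>w. indicator {J} (I w) :: real) \<in> borel_measurable M" for J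
    by (rule measurable_compose[OF I_measurable]) simp
  have intJ: "integrable M (\<lambda>w. indicator {J} (I w) * G' J (?Zv w))" for J
    by (rule Bochner_Integration.integrable_bound[OF intG'[of J]],
        rule borel_measurable_times[OF Im borel_measurable_integrable[OF intG']])
      (auto split: split_indicator)
  have "expectation (\<lambda>w. G (?Zv w) * indicator A w) =
      expectation (\<lambda>w. \<Sum>J\<in>divisions N s n. indicator {J} (I w) * G' J (?Zv w))"
  proof (rule Bochner_Integration.integral_cong[OF refl])
    fix w assume w: "w \<in> space M"
    have Iw: "I w \<in> divisions N s n" using measurable_space[OF I_measurable w] by simp
    have "(\<Sum>J\<in>divisions N s n. indicator {J} (I w) * G' J (?Zv w)) =
        (\<Sum>J\<in>divisions N s n. if J = I w then G' J (?Zv w) else 0)"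
      by (intro sum.cong) (auto split: split_indicator)
    also have "\<dots> = G' (I w) (?Zv w)"
      using Iw finite_divisions by simp
    also have "\<dots> = G (?Zv w) * indicator A w"
      unfolding G'Z using w by (simp add: A_eq B'_def cov_def indicator_def)
    finally show "G (?Zv w) * indicator A w = (\<Sum>J\<in>divisions N s n. indicator {J} (I w) * G' J (?Zv w))" ..
  qed
  also have "\<dots> = (\<Sum>J\<in>divisions N s n. expectation (\<lambda>w. indicator {J} (I w) * G' J (?Zv w)))"
    by (rule Bochner_Integration.integral_sum) (rule intJ)
  also have "\<dots> = (\<Sum>J\<in>divisions N s n. expectation (\<lambda>w. indicator {J} (I w)) * expectation (\<lambda>w. G' J (?Zv w)))"
    by (intro sum.cong refl expectation_division intG' G')
  finally show ?thesis
    by (intro that[of B'] B') (simp only: G'Z)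
qed

lemma noise_moments:
  assumes i: "i \<in> {1..N}" and A: "A \<in> sets \<F>"
  shows "expectation (\<lambda>w. \<epsilon> i w * indicator A w) = 0"
    and "k \<in> {1..N} \<Longrightarrow> k \<noteq> i \<Longrightarrow> expectation (\<lambda>w. \<epsilon> k w * \<epsilon> i w * indicator A w) = 0"
    and "expectation (\<lambda>w. ((\<epsilon> i w)\<^sup>2 - c) * indicator A w) \<le> 0"
proof -
  have i1: "1 \<le> i" using i by simp
  have m: "(\<lambda>z. res (z l)) \<in> borel_measurable (\<Pi>\<^sub>M i\<in>{1..N}. borel)" if "l \<in> {1..N}" for l
    by (rule measurable_compose[OF _ res_measurable], rule measurable_component_singleton) (rule that)
  have Zl: "(\<lambda>i\<in>{1..N}. Z i w) l = Z l w" if "l \<in> {1..N}" for l w using that by simp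
  have pos: "0 \<le> expectation (\<lambda>w. indicator {J} (I w) :: real)" for J by simp
  show "expectation (\<lambda>w. \<epsilon> i w * indicator A w) = 0"
  proof (rule expectation_cov[OF m[OF i] _ A])
    show "integrable M (\<lambda>w. res ((\<lambda>i\<in>{1..N}. Z i w) i))"
      unfolding Zl[OF i] using noise_integrable[OF i1] by (simp only: \<epsilon>_eq[abs_def])
  qed (use noise_moments_X(1)[OF i] in \<open>simp only: Zl[OF i] \<epsilon>_eq mult_zero_right sum.neutral_const\<close>)
  show "expectation (\<lambda>w. \<epsilon> k w * \<epsilon> i w * indicator A w) = 0" if k: "k \<in> {1..N}" "k \<noteq> i"
  proof (rule expectation_cov[OF borel_measurable_times[OF m[OF k(1)] m[OF i]] _ A])
    show "integrable M (\<lambda>w. res ((\<lambda>i\<in>{1..N}. Z i w) k) * res ((\<lambda>i\<in>{1..N}. Z i w) i))"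
      unfolding Zl[OF i] Zl[OF k(1)] using noise_prod_integrable[of k i] i k by (simp add: \<epsilon>_eq[abs_def])
  qed (use noise_moments_X(2)[OF i _ k] in \<open>simp only: Zl[OF i] Zl[OF k(1)] \<epsilon>_eq mult_zero_right sum.neutral_const\<close>)
  show "expectation (\<lambda>w. ((\<epsilon> i w)\<^sup>2 - c) * indicator A w) \<le> 0"
  proof (rule expectation_cov[OF borel_measurable_diff[OF borel_measurable_power[OF m[OF i], of 2] borel_measurable_const[of c]] _ A])
    show "integrable M (\<lambda>w. (res ((\<lambda>i\<in>{1..N}. Z i w) i))\<^sup>2 - c)"
      unfolding Zl[OF i] using noise_sq_integrable[OF i1] by (simp add: \<epsilon>_eq[abs_def])
    fix B assume B: "\<And>J. B J \<in> sets (\<Pi>\<^sub>M i\<in>{1..N}. (borel :: 'a measure))"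
      and eq: "expectation (\<lambda>w. ((res ((\<lambda>i\<in>{1..N}. Z i w) i))\<^sup>2 - c) * indicator A w) =
      (\<Sum>J\<in>divisions N s n. expectation (\<lambda>w. indicator {J} (I w)) *
         expectation (\<lambda>w. ((res ((\<lambda>i\<in>{1..N}. Z i w) i))\<^sup>2 - c) * indicator (B J) (\<lambda>i\<in>{1..N}. X i w)))"
    show ?thesis
      using eq noise_moments_X(3)[OF i B] pos unfolding Zl[OF i] \<epsilon>_eq
      by (auto intro!: sum_nonpos mult_nonneg_nonpos)
  qed
qed

text \<open>Integrals over all events of \<open>\<F>\<close> determine a conditional expectation,
  which settles the two equations. The inequality is tested on the event where it fails.\<close>

lemma noise_cond_exp:
  assumes i: "i \<in> {1..N}"
  shows "AE w in M. real_cond_exp M \<F> (\<epsilon> i) w = 0"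
    and "k \<in> {1..N} \<Longrightarrow> k \<noteq> i \<Longrightarrow> AE w in M. real_cond_exp M \<F> (\<lambda>w. \<epsilon> k w * \<epsilon> i w) w = 0"
    and "AE w in M. real_cond_exp M \<F> (\<lambda>w. \<epsilon> i w * \<epsilon> i w) w \<le> c"
proof -
  interpret F: sigma_finite_subalgebra M \<F> by (rule cov_subalgebra)
  have i1: "1 \<le> i" using i by simp
  show "AE w in M. real_cond_exp M \<F> (\<epsilon> i) w = 0"
    by (rule F.real_cond_exp_charact)
      (use noise_moments(1)[OF i] noise_integrable[OF i1] in
        \<open>auto simp: set_lebesgue_integral_def mult.commute\<close>)
  show "AE w in M. real_cond_exp M \<F> (\<lambda>w. \<epsilon> k w * \<epsilon> i w) w = 0" if k: "k \<in> {1..N}" "k \<noteq> i"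
    by (rule F.real_cond_exp_charact)
      (use noise_moments(2)[OF i _ k] noise_prod_integrable[of k i] i k in
        \<open>auto simp: set_lebesgue_integral_def mult.commute mult.left_commute\<close>)
  have int: "integrable M (\<lambda>w. \<epsilon> i w * \<epsilon> i w)" by (rule noise_prod_integrable[OF i1 i1])
  let ?r = "real_cond_exp M \<F> (\<lambda>w. \<epsilon> i w * \<epsilon> i w)"
  \<comment> \<open>On \<open>A\<close> the excess over \<open>c\<close> is positive while its
    integral is at most zero, so \<open>A\<close> is a null set.\<close>
  define A where "A = {w \<in> space M. c < ?r w}"
  have sp: "space \<F> = space M" by (simp add: cov_algebra_eq)
  have A: "A \<in> sets \<F>"
    unfolding A_def sp[symmetric] by measurable
  then have [measurable]: "A \<in> sets M" using F.subalg by (auto simp: subalgebra_def)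
  have int_r: "integrable M ?r" by (rule F.real_cond_exp_int(1)[OF int])
  have intA: "integrable M (\<lambda>w. h w * indicator A w)" if "integrable M h" for h :: "'w \<Rightarrow> real"
    using integrable_mult_indicator[OF \<open>A \<in> sets M\<close> that] by (simp add: mult.commute)
  have "expectation (\<lambda>w. ?r w * indicator A w) = expectation (\<lambda>w. \<epsilon> i w * \<epsilon> i w * indicator A w)"
    using F.real_cond_exp_intA[OF int A] by (simp add: set_lebesgue_integral_def mult.commute)
  then have "expectation (\<lambda>w. (?r w - c) * indicator A w) = expectation (\<lambda>w. ((\<epsilon> i w)\<^sup>2 - c) * indicator A w)"
    using intA[OF int] intA[OF int_r] intA[of "\<lambda>_. c"] by (simp add: left_diff_distrib power2_eq_square)
  also have "\<dots> \<le> 0" by (rule noise_moments(3)[OF i A])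
  finally have le: "expectation (\<lambda>w. (?r w - c) * indicator A w) \<le> 0" .
  have nn: "0 \<le> (?r w - c) * indicator A w" for w by (auto simp: A_def split: split_indicator)
  have "AE w in M. (?r w - c) * indicator A w = 0"
  proof (rule integral_nonneg_eq_0_iff_AE[THEN iffD1])
    show "integrable M (\<lambda>w. (?r w - c) * indicator A w)"
      by (rule intA) (simp add: int_r)
    show "expectation (\<lambda>w. (?r w - c) * indicator A w) = 0"
      by (intro antisym le Bochner_Integration.integral_nonneg nn)
  qed (rule AE_I2, rule nn)
  then show "AE w in M. ?r w \<le> c"
    by (rule AE_mp) (auto simp: A_def intro!: AE_I2 split: split_indicator)
qed

text \<open>Off the diagonal the noise is uncorrelated, so only the \<open>q i i\<close> survive.\<close>

lemma quadratic_cond_exp: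
  fixes q :: "nat \<Rightarrow> nat \<Rightarrow> (nat \<Rightarrow> nat set) \<times> (nat \<Rightarrow> 'a) \<Rightarrow> real" and l r L
  assumes q: "\<And>i k. i \<in> {1..N} \<Longrightarrow> k \<in> {1..N} \<Longrightarrow> q i k \<in> borel_measurable (cov_space N s n)"
    and l: "\<And>i. i \<in> {1..N} \<Longrightarrow> l i \<in> borel_measurable (cov_space N s n)"
    and r: "r \<in> borel_measurable (cov_space N s n)"
    and q_bound: "\<And>i k p. \<bar>q i k p\<bar> \<le> L" and l_bound: "\<And>i p. \<bar>l i p\<bar> \<le> L" and r_bound: "\<And>p. \<bar>r p\<bar> \<le> L"
    and q_nonneg: "\<And>i p. 0 \<le> q i i p"
    and U: "\<And>w. U w = (\<Sum>i=1..N. \<Sum>k=1..N. q i k (cov N I w) * (\<epsilon> i w * \<epsilon> k w))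
        + (\<Sum>i=1..N. l i (cov N I w) * \<epsilon> i w) + r (cov N I w)"
    and U_nonneg: "\<And>w. 0 \<le> U w"
  shows "AE w in M. nn_cond_exp M \<F> (\<lambda>w. ennreal (U w)) w
    \<le> ennreal (c * (\<Sum>i=1..N. q i i (cov N I w)) + r (cov N I w))"
proof -
  interpret F: sigma_finite_subalgebra M \<F> by (rule cov_subalgebra)
  let ?E = "real_cond_exp M \<F>" and ?c = "cov N I"
  have mF: "(\<lambda>w. u (?c w)) \<in> borel_measurable \<F>" if "u \<in> borel_measurable (cov_space N s n)" for u :: "_ \<Rightarrow> real"
    by (rule measurable_compose[OF cov_measurable_\<F> that])
  have mM: "(\<lambda>w. u (?c w)) \<in> borel_measurable M" if "u \<in> borel_measurable (cov_space N s n)" for u :: "_ \<Rightarrow> real"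
    by (rule measurable_from_subalg[OF F.subalg mF[OF that]])
  \<comment> \<open>The uniform bound \<open>L\<close> on the coefficients makes every term of the
    expansion integrable, so the conditional expectation may be taken term by term.\<close>
  have int: "integrable M (\<lambda>w. u (?c w) * v w)"
    if "u \<in> borel_measurable (cov_space N s n)" "\<And>p. \<bar>u p\<bar> \<le> L" "integrable M v" for u and v :: "_ \<Rightarrow> real"
  proof (rule Bochner_Integration.integrable_bound[of M "\<lambda>w. L * v w"])
    show "(\<lambda>w. u (?c w) * v w) \<in> borel_measurable M"
      by (intro borel_measurable_times mM that borel_measurable_integrable)
    have "\<bar>u p\<bar> * \<bar>y\<bar> \<le> \<bar>L\<bar> * \<bar>y\<bar>" for p and y :: real
      using that(2)[of p] by (intro mult_right_mono) auto
    then show "AE w in M. norm (u (?c w) * v w) \<le> norm (L * v w)"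
      by (simp add: abs_mult)
  qed (simp add: that)
  define u2 where "u2 z w = q (fst z) (snd z) (?c w) * (\<epsilon> (fst z) w * \<epsilon> (snd z) w)" for z w
  define u1 where "u1 i w = l i (?c w) * \<epsilon> i w" for i w
  let ?P = "{1..N} \<times> {1..N}"
  have int2: "integrable M (u2 z)" if "z \<in> ?P" for z
    unfolding u2_def using that by (intro int q q_bound noise_prod_integrable) auto
  have int1: "integrable M (u1 i)" if "i \<in> {1..N}" for i
    unfolding u1_def using that by (intro int l l_bound noise_integrable) auto
  have int0: "integrable M (\<lambda>w. r (?c w))"
    using int[OF r r_bound, of "\<lambda>_. 1"] by simp
  have s2: "AE w in M. ?E (\<lambda>w. \<Sum>z\<in>?P. u2 z w) w = (\<Sum>z\<in>?P. ?E (u2 z) w)"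
    by (rule F.real_cond_exp_sum_on) (use int2 in auto)
  have s1: "AE w in M. ?E (\<lambda>w. \<Sum>i\<in>{1..N}. u1 i w) w = (\<Sum>i\<in>{1..N}. ?E (u1 i) w)"
    by (rule F.real_cond_exp_sum_on) (use int1 in auto)
  have s0: "AE w in M. ?E (\<lambda>w. r (?c w)) w = r (?c w)"
    by (rule F.real_cond_exp_F_meas[OF int0 mF[OF r]])
  have i2: "integrable M (\<lambda>w. \<Sum>z\<in>?P. u2 z w)" and i1: "integrable M (\<lambda>w. \<Sum>i\<in>{1..N}. u1 i w)"
    by (intro Bochner_Integration.integrable_sum; rule int2 int1; assumption)+
  have a2: "AE w in M. ?E (\<lambda>w. ((\<Sum>z\<in>?P. u2 z w) + (\<Sum>i\<in>{1..N}. u1 i w)) + r (?c w)) w =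
      ?E (\<lambda>w. (\<Sum>z\<in>?P. u2 z w) + (\<Sum>i\<in>{1..N}. u1 i w)) w + ?E (\<lambda>w. r (?c w)) w"
    by (intro F.real_cond_exp_add Bochner_Integration.integrable_add i2 i1 int0)
  have a1: "AE w in M. ?E (\<lambda>w. (\<Sum>z\<in>?P. u2 z w) + (\<Sum>i\<in>{1..N}. u1 i w)) w =
      ?E (\<lambda>w. \<Sum>z\<in>?P. u2 z w) w + ?E (\<lambda>w. \<Sum>i\<in>{1..N}. u1 i w) w"
    by (intro F.real_cond_exp_add i2 i1)
  have Ueq: "U = (\<lambda>w. ((\<Sum>z\<in>?P. u2 z w) + (\<Sum>i\<in>{1..N}. u1 i w)) + r (?c w))"
    by (simp add: fun_eq_iff U u1_def u2_def sum.cartesian_product case_prod_unfold)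
  have intU: "integrable M U"
    unfolding Ueq by (intro Bochner_Integration.integrable_add i2 i1 int0)
  \<comment> \<open>Off the diagonal this holds with equality; on it, \<open>q i i\<close> is
    nonnegative and can multiply the variance bound.\<close>
  have e2: "AE w in M. \<forall>z\<in>?P. ?E (u2 z) w \<le> (if fst z = snd z then c * q (fst z) (fst z) (?c w) else 0)"
  proof (rule AE_finite_allI)
    fix z assume z: "z \<in> ?P"
    then have z1: "fst z \<in> {1..N}" "snd z \<in> {1..N}" by auto
    have "AE w in M. ?E (u2 z) w = q (fst z) (snd z) (?c w) * ?E (\<lambda>w. \<epsilon> (fst z) w * \<epsilon> (snd z) w) w"
      unfolding u2_def
    proof (rule F.real_cond_exp_mult)
      show "(\<lambda>w. q (fst z) (snd z) (?c w)) \<in> borel_measurable \<F>" by (rule mF[OF q[OF z1]])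
      show "(\<lambda>w. \<epsilon> (fst z) w * \<epsilon> (snd z) w) \<in> borel_measurable M"
        using z1 by (intro borel_measurable_times \<epsilon>_measurable) auto
    qed (use int2[OF z] in \<open>simp add: u2_def[abs_def]\<close>)
    then show "AE w in M. ?E (u2 z) w \<le> (if fst z = snd z then c * q (fst z) (fst z) (?c w) else 0)"
    proof (cases "fst z = snd z")
      case True
      have "AE w in M. ?E (\<lambda>w. \<epsilon> (fst z) w * \<epsilon> (snd z) w) w \<le> c"
        using noise_cond_exp(3)[OF z1(1)] True by simp
      with \<open>AE w in M. ?E (u2 z) w = _ w\<close> show ?thesis
      proof eventually_elim
        case (elim w)
        then show ?case
          using True mult_left_mono[OF elim(2) q_nonneg[of "fst z" "?c w"]] by (simp add: mult.commute)
      qed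
    next
      case False
      have "AE w in M. ?E (\<lambda>w. \<epsilon> (fst z) w * \<epsilon> (snd z) w) w = 0"
        using noise_cond_exp(2)[OF z1(2) z1(1)] False by simp
      with \<open>AE w in M. ?E (u2 z) w = _ w\<close> show ?thesis
        by eventually_elim (simp add: False)
    qed
  qed simp
  have e1: "AE w in M. \<forall>i\<in>{1..N}. ?E (u1 i) w = 0"
  proof (rule AE_finite_allI)
    fix i assume i: "i \<in> {1..N}"
    have "AE w in M. ?E (u1 i) w = l i (?c w) * ?E (\<epsilon> i) w"
      unfolding u1_def
    proof (rule F.real_cond_exp_mult)
      show "(\<lambda>w. l i (?c w)) \<in> borel_measurable \<F>" by (rule mF[OF l[OF i]])
      show "\<epsilon> i \<in> borel_measurable M" using i by (intro \<epsilon>_measurable) auto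
    qed (use int1[OF i] in \<open>simp add: u1_def[abs_def]\<close>)
    with noise_cond_exp(1)[OF i] show "AE w in M. ?E (u1 i) w = 0"
      by eventually_elim simp
  qed simp
  have "AE w in M. ?E U w \<le> c * (\<Sum>i=1..N. q i i (?c w)) + r (?c w)"
    using s2 s1 s0 a2 a1 e2 e1
  proof eventually_elim
    case (elim w)
    have "?E U w = (\<Sum>z\<in>?P. ?E (u2 z) w) + (\<Sum>i\<in>{1..N}. ?E (u1 i) w) + r (?c w)"
      using elim(1-5) unfolding Ueq by simp
    also have "\<dots> = (\<Sum>z\<in>?P. ?E (u2 z) w) + r (?c w)"
      using elim(7) by simp
    also have "(\<Sum>z\<in>?P. ?E (u2 z) w) \<le> (\<Sum>z\<in>?P. if fst z = snd z then c * q (fst z) (fst z) (?c w) else 0)"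
      by (rule sum_mono) (rule bspec[OF elim(6)])
    also have "\<dots> = (\<Sum>i=1..N. \<Sum>k=1..N. if i = k then c * q i i (?c w) else 0)"
      unfolding sum.cartesian_product by (intro sum.cong) auto
    also have "\<dots> = c * (\<Sum>i=1..N. q i i (?c w))"
      by (simp add: sum_distrib_left)
    finally show ?case by simp
  qed
  with F.nn_cond_exp_eq_real_cond_exp[OF intU U_nonneg] show ?thesis
    by eventually_elim (simp add: ennreal_leI)
qed

end

end

context bounded_mercer
begin

section \<open>The local estimators\<close>

definition emp_form where
  "emp_form n X I j w f g = P_emp n X I j w (\<lambda>x. f x * g x) + lam * ip f g"

lemma inner_form_emp: "inner_form H (emp_form n X I j w)"
proof
  show "emp_form n X I j w f g = emp_form n X I j w g f" if "f \<in> H" "g \<in> H" for f g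
    using ip_commute[OF that] by (simp add: emp_form_def P_emp_def mult.commute)
  show "0 \<le> emp_form n X I j w f f" if "f \<in> H" for f
    using hip.nonneg[OF that] lam_pos
    by (auto simp: emp_form_def P_emp_def intro!: add_nonneg_nonneg divide_nonneg_nonneg sum_nonneg)
qed (auto simp: zero_closed add_closed scale_closed emp_form_def P_emp_def ip_add ip_scale
    algebra_simps sum.distrib sum_distrib_left add_divide_distrib)

lemma emp_form_pos: "f \<in> H \<Longrightarrow> emp_form n X I j w f f \<le> 0 \<Longrightarrow> f = (\<lambda>x. 0)"
proof (rule ccontr)
  assume f: "f \<in> H" "emp_form n X I j w f f \<le> 0" "f \<noteq> (\<lambda>x. 0)"
  have "0 \<le> P_emp n X I j w (\<lambda>x. f x * f x)"
    by (auto simp: P_emp_def intro!: divide_nonneg_nonneg sum_nonneg)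
  moreover have "0 < lam * ip f f" using lam_pos ip_pos[OF f(1,3)] by simp
  ultimately show False using f(2) by (simp add: emp_form_def)
qed

text \<open>Completing the square: the candidate represents the data functional under the empirical
  form, so the objective is a constant plus half the squared distance to it. Definiteness of the
  form, due to the penalty, makes the minimiser unique, and \<open>arg_min\<close> must return
  it.\<close>

lemma sub_estimator_eq:
  assumes n: "0 < n"
    and psi: "\<And>i. i \<in> I w j \<Longrightarrow> \<psi> i \<in> H"
    and psi_eq: "\<And>i g. i \<in> I w j \<Longrightarrow> g \<in> H \<Longrightarrow> emp_form n X I j w (\<psi> i) g = g (X i w)"
  shows "sub_estimator H ip lam n X Y I j w = (\<lambda>x. \<Sum>i\<in>I w j. Y i w / real n * \<psi> i x)"
proof -
  interpret B: inner_form H "emp_form n X I j w" by (rule inner_form_emp)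
  let ?B = "emp_form n X I j w" and ?A = "I w j"
  define u where "u = (\<lambda>x. \<Sum>i\<in>?A. Y i w / real n * \<psi> i x)"
  define J where "J f = 1 / (2 * real n) * (\<Sum>i\<in>?A. (Y i w - f (X i w))\<^sup>2) + lam / 2 * ip f f" for f
  \<comment> \<open>The minimal value of the objective, left over when the square is
    completed.\<close>
  define c where "c = 1 / (2 * real n) * (\<Sum>i\<in>?A. (Y i w)\<^sup>2) - 1 / 2 * ?B u u"
  have u: "u \<in> H" unfolding u_def by (rule B.lincomb_mem) (rule psi)
  have Bu: "?B u g = (\<Sum>i\<in>?A. Y i w / real n * g (X i w))" if "g \<in> H" for g
    unfolding u_def by (subst B.lincomb_left) (auto simp: psi psi_eq that)
  have J: "J f = c + 1 / 2 * ?B (\<lambda>x. f x - u x) (\<lambda>x. f x - u x)" if f: "f \<in> H" for f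
  proof -
    have "J f = 1 / (2 * real n) * (\<Sum>i\<in>?A. (Y i w)\<^sup>2) - ?B u f + 1 / 2 * ?B f f"
      unfolding Bu[OF f]
      unfolding J_def emp_form_def P_emp_def
      by (simp add: power2_diff sum.distrib sum_subtractf sum_distrib_left sum_divide_distrib
          diff_divide_distrib add_divide_distrib power2_eq_square algebra_simps)
    then show ?thesis
      using B.commute[OF f u] by (simp add: B.sq_diff f u c_def add_divide_distrib diff_divide_distrib)
  qed
  have Ju: "J u = c" by (simp add: J u B.zero_left zero_closed)
  have "arg_min J (\<lambda>f. f \<in> H) = u"
  proof (rule arg_minI[where Q = "\<lambda>v. v = u"])
    show "\<not> J f < J u" if "f \<in> H" for f
      using B.nonneg[OF hip.diff_mem[OF that u]] by (simp add: Ju J that)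
    fix v assume v: "v \<in> H" "\<forall>f. f \<in> H \<longrightarrow> \<not> J f < J v"
    then have "?B (\<lambda>x. v x - u x) (\<lambda>x. v x - u x) \<le> 0"
      using u by (auto simp: Ju J[OF v(1)] not_less)
    then have "(\<lambda>x. v x - u x) = (\<lambda>x. 0)"
      by (rule emp_form_pos[OF hip.diff_mem[OF v(1) u]])
    then show "v = u" by (auto simp: fun_eq_iff)
  qed (rule u)
  then show ?thesis unfolding sub_estimator_def J_def u_def .
qed

text \<open>Points outside the block of \<open>i\<close> receive weight zero, so the recursion
  always runs over all \<open>N\<close> points and the division enters only through the weights. The
  successor bridges the recursion, which counts from zero, and the data, which count from
  one.\<close>

definition wt :: "nat \<Rightarrow> nat \<Rightarrow> (nat \<Rightarrow> nat set) \<Rightarrow> nat \<Rightarrow> nat \<Rightarrow> real" where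
  "wt s n J i k = (if \<exists>j\<in>{1..s}. i \<in> J j \<and> Suc k \<in> J j then 1 / real n else 0)"

definition psi :: "nat \<Rightarrow> nat \<Rightarrow> nat \<Rightarrow> (nat \<Rightarrow> nat set) \<times> (nat \<Rightarrow> 'a) \<Rightarrow> nat \<Rightarrow> 'a \<Rightarrow> real" where
  "psi N s n p i = solve N (wt s n (fst p) i) (\<lambda>k. snd p (Suc k)) (Rk (snd p i))"

lemma wt_nonneg: "0 \<le> wt s n J i k"
  by (simp add: wt_def)

lemma psi_mem: "psi N s n p i \<in> H"
  unfolding psi_def by (rule solve_mem[OF Rk_mem])

lemma psi_nrm: "hip.nrm (psi N s n p i) \<le> kap / lam"
  using solve_nrm[where t = "wt s n (fst p) i" and z = "\<lambda>k. snd p (Suc k)" and k = N, OF wt_nonneg Rk_mem[of "snd p i"]]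
    Rk_nrm[of "snd p i"] lam_pos
  by (simp add: psi_def pos_le_divide_eq mult.commute)

lemma psi_eq:
  assumes p: "fst p \<in> divisions N s n" and j: "j \<in> {1..s}" and i: "i \<in> fst p j" and g: "g \<in> H"
  shows "emp_form n (\<lambda>i p. snd p i) fst j p (psi N s n p i) g = g (snd p i)"
proof -
  let ?J = "fst p" and ?\<psi> = "psi N s n p i"
  have Jj: "?J j \<subseteq> {1..N}" using p j by (auto simp: divisions_def)
  \<comment> \<open>The blocks are disjoint, so \<open>j\<close> is the only one that contains
    \<open>i\<close>.\<close>
  have uniq: "(\<exists>j'\<in>{1..s}. i \<in> ?J j' \<and> k \<in> ?J j') \<longleftrightarrow> k \<in> ?J j" for k
  proof -
    have "disjoint_family_on ?J {1..s}" using p by (simp add: divisions_def)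
    then have "j' = j" if "j' \<in> {1..s}" "i \<in> ?J j'" for j'
      using disjoint_family_onD[of ?J "{1..s}" j' j] that i j by blast
    then show ?thesis using i j by blast
  qed
  have "(\<Sum>l<N. wt s n ?J i l * (?\<psi> (snd p (Suc l)) * g (snd p (Suc l)))) =
      (\<Sum>k=1..N. (if k \<in> ?J j then 1 / real n else 0) * (?\<psi> (snd p k) * g (snd p k)))"
    unfolding wt_def uniq by (simp add: sum.atLeast1_atMost_eq)
  also have "\<dots> = (\<Sum>k\<in>?J j. 1 / real n * (?\<psi> (snd p k) * g (snd p k)))"
    using Jj by (intro sum.mono_neutral_cong_right) auto
  also have "\<dots> = P_emp n (\<lambda>i p. snd p i) fst j p (\<lambda>x. ?\<psi> x * g x)"
    by (simp add: P_emp_def sum_distrib_left)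
  finally have "lam * ip ?\<psi> g + P_emp n (\<lambda>i p. snd p i) fst j p (\<lambda>x. ?\<psi> x * g x) = ip (Rk (snd p i)) g"
    using solve_eq[where t = "wt s n ?J i" and k = N and z = "\<lambda>k. snd p (Suc k)", OF wt_nonneg Rk_mem g, of "snd p i"]
    by (simp add: psi_def)
  then show ?thesis
    using ip_commute[OF Rk_mem g, of "snd p i"] eval[OF g] by (simp add: emp_form_def)
qed

lemma Hmeas_psi: "i \<in> {1..N} \<Longrightarrow> Hmeas (cov_space N s n) (\<lambda>p. psi N s n p i)"
  unfolding psi_def
  by (rule Hmeas_solve[OF Hmeas_Rk[OF cov_snd_measurable]]; (intro cov_fst_measurable cov_snd_measurable)?) auto

end

section \<open>The averaged estimator: noise coefficients, bias and conditional risk\<close>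

locale divide_conquer =
  bounded_mercer D dens H ip \<mu> \<phi> C lam + bounded_noise M D dens sigma2 f0 X Y c
  for M :: "'w measure" and D :: "'a::euclidean_space set" and dens sigma2 f0 X Y H ip \<mu> \<phi> C lam c +
  fixes N s n :: nat and I :: "'w \<Rightarrow> nat \<Rightarrow> nat set"
  assumes f0_mem: "f0 \<in> H"
    and sizes: "0 < s" "0 < n" "N = n * s"
    and division: "random_division M X Y N s n I"
    and c_nonneg: "0 \<le> c"
begin

text \<open>
  With \<open>\<theta> = 1\<close> the remainder, with \<open>\<theta> = 0\<close> the error of the averaged estimator is
  $\sum_i \epsilon_i\, \mathtt{coef}_i + \mathtt{bias}$.
\<close>

definition coef :: "real \<Rightarrow> nat \<Rightarrow> (nat \<Rightarrow> nat set) \<times> (nat \<Rightarrow> 'a) \<Rightarrow> 'a \<Rightarrow> real" where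
  "coef \<theta> i p = (\<lambda>x. 1 / real N * (psi N s n p i x - \<theta> * Kk (snd p i) x))"

definition bias :: "real \<Rightarrow> (nat \<Rightarrow> nat set) \<times> (nat \<Rightarrow> 'a) \<Rightarrow> 'a \<Rightarrow> real" where
  "bias \<theta> p = (\<lambda>x. (\<Sum>i\<in>{1..N}. f0 (snd p i) / real N * psi N s n p i x) - f0 x + \<theta> * Pl f0 x)"

lemma coef_mem: "coef \<theta> i p \<in> H"
  unfolding coef_def by (intro hip.scale_mem hip.diff_mem psi_mem Kk_mem)

lemma bias_mem: "bias \<theta> p \<in> H"
  unfolding bias_def
  by (intro hip.add_mem hip.diff_mem hip.lincomb_mem hip.scale_mem psi_mem Pl_mem f0_mem)

text \<open>Far from the final rate, but valid for all covariates, also where the deviation is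
  large; it makes the squared norm integrable before any event is singled out.\<close>

lemma coef_bound: "\<bar>\<theta>\<bar> \<le> 1 \<Longrightarrow> lip.nrm (coef \<theta> i p) \<le> sqrt (kap\<^sup>2 + lam) * (kap / lam) + sqrt (C\<^sup>2 / bandwidth \<mu> lam)"
  (is "_ \<Longrightarrow> _ \<le> ?a + ?b")
proof -
  assume \<theta>: "\<bar>\<theta>\<bar> \<le> 1"
  have K: "lip.nrm (Kk x) \<le> ?b" for x
    using Kk_nrm_sq real_le_rsqrt by blast
  have psi: "lip.nrm (psi N s n p i) \<le> ?a"
    using lam_pos by (intro order_trans[OF lip_nrm_le[OF psi_mem]] mult_left_mono psi_nrm) auto
  have "lip.nrm (\<lambda>x. psi N s n p i x - \<theta> * Kk (snd p i) x) \<le> lip.nrm (psi N s n p i) + \<bar>\<theta>\<bar> * lip.nrm (Kk (snd p i))"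
    using lip.nrm_triangle[OF psi_mem hip.scale_mem[OF Kk_mem, of "- \<theta>"], of N s n p i "snd p i"]
      lip.nrm_scale[OF Kk_mem, of "- \<theta>" "snd p i"] by simp
  also have "\<dots> \<le> ?a + 1 * ?b"
    using \<theta> lip.nrm_nonneg[OF Kk_mem] by (intro add_mono mult_mono psi K) auto
  finally have "lip.nrm (\<lambda>x. psi N s n p i x - \<theta> * Kk (snd p i) x) \<le> ?a + ?b" by simp
  moreover have "0 < N" using sizes by simp
  then have "1 / real N * lip.nrm (\<lambda>x. psi N s n p i x - \<theta> * Kk (snd p i) x)
      \<le> lip.nrm (\<lambda>x. psi N s n p i x - \<theta> * Kk (snd p i) x)"
    by (intro mult_left_le_one_le lip.nrm_nonneg hip.diff_mem psi_mem hip.scale_mem Kk_mem) auto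
  ultimately show ?thesis
    unfolding coef_def lip.nrm_scale[OF hip.diff_mem[OF psi_mem hip.scale_mem[OF Kk_mem]]] by simp
qed

lemma bias_bound: "\<exists>L\<ge>0. \<forall>p. lip.nrm (bias \<theta> p) \<le> L"
proof -
  let ?b = "sqrt (kap\<^sup>2 + lam) * (kap / lam)" and ?F = "kap * hip.nrm f0"
  have psi: "lip.nrm (psi N s n p i) \<le> ?b" for p i
    using lam_pos by (intro order_trans[OF lip_nrm_le[OF psi_mem]] mult_left_mono psi_nrm) auto
  define L where "L = real N * (?F / real N * ?b) + lip.nrm f0 + \<bar>\<theta>\<bar> * lip.nrm (Pl f0)"
  have b0: "0 \<le> ?b" using lam_pos kap_nonneg by auto
  have F0: "0 \<le> ?F" by (intro mult_nonneg_nonneg kap_nonneg hip.nrm_nonneg f0_mem)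
  have le: "lip.nrm (bias \<theta> p) \<le> L" for p
  proof -
    let ?S = "\<lambda>x. \<Sum>i\<in>{1..N}. f0 (snd p i) / real N * psi N s n p i x"
    have S: "?S \<in> H" by (rule hip.lincomb_mem) (rule psi_mem)
    have "lip.nrm ?S \<le> (\<Sum>i\<in>{1..N}. \<bar>f0 (snd p i) / real N\<bar> * lip.nrm (psi N s n p i))"
      by (rule lip.nrm_lincomb) (rule psi_mem)
    also have "\<dots> \<le> (\<Sum>i\<in>{1..N}. ?F / real N * ?b)"
      using sup_bound[OF f0_mem] F0 lip.nrm_nonneg[OF psi_mem]
      by (intro sum_mono mult_mono psi) (auto intro: divide_right_mono)
    finally have S_le: "lip.nrm ?S \<le> real N * (?F / real N * ?b)" by simp
    have "lip.nrm (bias \<theta> p) \<le> lip.nrm (\<lambda>x. ?S x - f0 x) + lip.nrm (\<lambda>x. \<theta> * Pl f0 x)"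
      unfolding bias_def by (intro lip.nrm_triangle hip.diff_mem S f0_mem hip.scale_mem Pl_mem)
    moreover have "lip.nrm (\<lambda>x. ?S x - f0 x) \<le> lip.nrm ?S + lip.nrm f0"
      using lip.nrm_triangle[OF S hip.scale_mem[OF f0_mem, of "-1"]] lip.nrm_scale[OF f0_mem, of "-1"] by simp
    ultimately show ?thesis
      using S_le by (simp add: L_def lip.nrm_scale Pl_mem f0_mem)
  qed
  have "0 \<le> L"
    by (rule order_trans[OF lip.nrm_nonneg[OF bias_mem] le])
  with le show ?thesis by auto
qed

lemma Hmeas_coef: "i \<in> {1..N} \<Longrightarrow> Hmeas (cov_space N s n) (coef \<theta> i)"
  unfolding coef_def
  by (intro Hmeas_scale Hmeas_diff Hmeas_psi Hmeas_Kk cov_snd_measurable borel_measurable_const)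

lemma Hmeas_bias: "Hmeas (cov_space N s n) (bias \<theta>)"
  unfolding bias_def
  by (intro Hmeas_add Hmeas_diff Hmeas_sum Hmeas_scale Hmeas_psi Hmeas_const Pl_mem f0_mem
      borel_measurable_const borel_measurable_divide measurable_compose[OF cov_snd_measurable f_measurable])

abbreviation "Xp \<equiv> \<lambda>i (p :: (nat \<Rightarrow> nat set) \<times> (nat \<Rightarrow> 'a)). snd p i"
abbreviation "\<xi> w \<equiv> max_xi dens H ip lam s n X I w"

lemma I_division: "w \<in> space M \<Longrightarrow> I w \<in> divisions N s n"
  using measurable_space[OF I_measurable[OF division]] by simp

lemma cov_simps: "fst (cov N I w) = I w" "i \<in> {1..N} \<Longrightarrow> snd (cov N I w) i = X i w"
  by (simp_all add: cov_def)

lemma division_sub: "J \<in> divisions N s n \<Longrightarrow> j \<in> {1..s} \<Longrightarrow> J j \<subseteq> {1..N}"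
  by (auto simp: divisions_def)

lemma P_emp_cov:
  assumes "w \<in> space M" "j \<in> {1..s}"
  shows "P_emp n X I j w u = P_emp n Xp fst j (cov N I w) u"
  unfolding P_emp_def cov_simps(1)
  using division_sub[OF I_division[OF assms(1)] assms(2)] by (auto simp: cov_simps(2) intro!: sum.cong)

text \<open>The deviation factors through \<open>cov\<close>, so measurability and norm bounds may
  be proved at points of \<open>cov_space\<close>.\<close>

lemma max_xi_cov: "w \<in> space M \<Longrightarrow> \<xi> w = max_xi dens H ip lam s n Xp fst (cov N I w)"
  unfolding max_xi_def xi_def by (intro arg_cong[of _ _ Max] image_cong refl) (simp add: P_emp_cov)

lemma avg_estimator_eq:
  assumes w: "w \<in> space M"
  shows "avg_estimator H ip lam s n X Y I w =
    (\<lambda>x. \<Sum>i\<in>{1..N}. Y i w / real N * psi N s n (cov N I w) i x)"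
proof
  fix x
  let ?\<psi> = "psi N s n (cov N I w)"
  have J: "I w \<in> divisions N s n" by (rule I_division[OF w])
  have sub: "sub_estimator H ip lam n X Y I j w = (\<lambda>x. \<Sum>i\<in>I w j. Y i w / real n * ?\<psi> i x)"
    if j: "j \<in> {1..s}" for j
  proof (rule sub_estimator_eq[OF sizes(2) psi_mem])
    fix i g assume i: "i \<in> I w j" and g: "g \<in> H"
    have i': "i \<in> {1..N}" using division_sub[OF J j] i by auto
    have "emp_form n X I j w (?\<psi> i) g = emp_form n Xp fst j (cov N I w) (?\<psi> i) g"
      by (simp add: emp_form_def P_emp_cov[OF w j])
    also have "\<dots> = g (X i w)"
      using psi_eq[of "cov N I w", OF _ j _ g] J i i' by (simp add: cov_simps)
    finally show "emp_form n X I j w (?\<psi> i) g = g (X i w)" .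
  qed
  have "avg_estimator H ip lam s n X Y I w x = (\<Sum>j\<in>{1..s}. \<Sum>i\<in>I w j. Y i w / real N * ?\<psi> i x)"
    unfolding avg_estimator_def using sizes
    by (simp add: sub sum_distrib_left mult.commute divide_divide_eq_left)
  also have "\<dots> = (\<Sum>i\<in>(\<Union>j\<in>{1..s}. I w j). Y i w / real N * ?\<psi> i x)"
    using J by (intro sum.UNION_disjoint[symmetric])
      (auto simp: divisions_def disjoint_family_on_def intro: finite_subset)
  also have "(\<Union>j\<in>{1..s}. I w j) = {1..N}" using J by (auto simp: divisions_def)
  finally show "avg_estimator H ip lam s n X Y I w x = (\<Sum>i\<in>{1..N}. Y i w / real N * ?\<psi> i x)" .
qed

definition total :: "real \<Rightarrow> 'w \<Rightarrow> 'a \<Rightarrow> real" where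
  "total \<theta> w = (\<lambda>x. (\<Sum>i\<in>{1..N}. \<epsilon> i w * coef \<theta> i (cov N I w) x) + bias \<theta> (cov N I w) x)"

text \<open>Each response splits into noise, which feeds \<open>coef\<close>, and the value of
  \<open>f0\<close>, which feeds \<open>bias\<close>.\<close>

lemma total_expand:
  assumes "w \<in> space M"
  shows "total \<theta> w x = avg_estimator H ip lam s n X Y I w x
    - \<theta> * (1 / real N * (\<Sum>i=1..N. \<epsilon> i w * Kk (X i w) x)) - f0 x + \<theta> * Pl f0 x"
proof -
  let ?\<psi> = "psi N s n (cov N I w)"
  have "(\<Sum>i\<in>{1..N}. \<epsilon> i w * coef \<theta> i (cov N I w) x) + (\<Sum>i\<in>{1..N}. f0 (snd (cov N I w) i) / real N * ?\<psi> i x)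
    = (\<Sum>i\<in>{1..N}. Y i w / real N * ?\<psi> i x - \<theta> * (1 / real N * (\<epsilon> i w * Kk (X i w) x)))"
    unfolding sum.distrib[symmetric]
  proof (rule sum.cong[OF refl])
    fix i assume i: "i \<in> {1..N}"
    have "Y i w = \<epsilon> i w + f0 (X i w)" by (simp add: noise_def)
    then show "\<epsilon> i w * coef \<theta> i (cov N I w) x + f0 (snd (cov N I w) i) / real N * ?\<psi> i x
        = Y i w / real N * ?\<psi> i x - \<theta> * (1 / real N * (\<epsilon> i w * Kk (X i w) x))"
      unfolding cov_simps(2)[OF i] coef_def by (simp add: algebra_simps add_divide_distrib diff_divide_distrib)
  qed
  also have "\<dots> = avg_estimator H ip lam s n X Y I w x - \<theta> * (1 / real N * (\<Sum>i=1..N. \<epsilon> i w * Kk (X i w) x))"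
    unfolding avg_estimator_eq[OF assms] by (simp add: sum_subtractf sum_distrib_left)
  finally show ?thesis by (simp add: total_def bias_def)
qed

lemma remainder_eq:
  assumes "w \<in> space M"
  shows "remainder dens H ip \<mu> \<phi> lam N s n X Y I f0 w = total 1 w"
    "(\<lambda>x. avg_estimator H ip lam s n X Y I w x - f0 x) = total 0 w"
  using total_expand[OF assms] by (auto simp: remainder_def)

text \<open>The two values of \<open>\<theta>\<close> select the two conclusions of
  \<open>contraction\<close>, with \<open>Kk\<close> as the population representer of the same
  evaluation.\<close>

lemma coef_nrm_le:
  assumes p: "fst p \<in> divisions N s n" and \<theta>: "\<theta> = 0 \<or> \<theta> = 1" and i: "i \<in> {1..N}"
    and t: "t = \<bar>max_xi dens H ip lam s n Xp fst p\<bar>" "t \<le> 1 / 2"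
  shows "lip.nrm (coef \<theta> i p) \<le> 1 / real N * (2 * (if \<theta> = 0 then 1 else t) * lip.nrm (Kk (snd p i)))"
proof -
  obtain j where j: "j \<in> {1..s}" "i \<in> fst p j"
    using p i unfolding divisions_def by blast
  note * = contraction[OF psi_mem Kk_mem, where n = n and X = Xp and I = fst and j = j and w = p and t = t]
  have "lip.nrm (\<lambda>x. psi N s n p i x - Kk (snd p i) x) \<le> 2 * t * lip.nrm (Kk (snd p i))"
    by (rule *(1); use psi_eq[OF p j] t dev_le_max_xi[OF psi_mem _ j(1)] in \<open>simp add: emp_form_def Kk_eval\<close>)
  moreover have "lip.nrm (psi N s n p i) \<le> 2 * lip.nrm (Kk (snd p i))"
    by (rule *(2); use psi_eq[OF p j] t dev_le_max_xi[OF psi_mem _ j(1)] in \<open>simp add: emp_form_def Kk_eval\<close>)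
  ultimately show ?thesis
    using \<theta> unfolding coef_def
    by (subst lip.nrm_scale) (auto intro!: hip.diff_mem psi_mem hip.scale_mem Kk_mem divide_right_mono)
qed

text \<open>\<open>d j\<close> is the error of the noise-free fit on block \<open>j\<close>. Under
  the empirical form its fitted part cancels the data part of \<open>f0\<close>, leaving minus the
  penalty term, which under the population form is represented by the negative of
  \<open>Pl f0\<close>.\<close>

lemma bias_nrm_le:
  assumes p: "fst p \<in> divisions N s n" and \<theta>: "\<theta> = 0 \<or> \<theta> = 1"
    and t: "t = \<bar>max_xi dens H ip lam s n Xp fst p\<bar>" "t \<le> 1 / 2"
  shows "lip.nrm (bias \<theta> p) \<le> 2 * (if \<theta> = 0 then 1 else t) * lip.nrm (Pl f0)"
proof -
  let ?\<psi> = "psi N s n p" and ?P = "Pl f0"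
  let ?\<rho> = "2 * (if \<theta> = 0 then 1 else t) * lip.nrm ?P"
  define d where "d j = (\<lambda>x. (\<Sum>i\<in>fst p j. f0 (snd p i) / real n * ?\<psi> i x) - f0 x)" for j
  have S: "(\<lambda>x. \<Sum>i\<in>fst p j. f0 (snd p i) / real n * ?\<psi> i x) \<in> H" for j
    by (rule hip.lincomb_mem) (rule psi_mem)
  have d: "d j \<in> H" for j unfolding d_def by (rule hip.diff_mem[OF S f0_mem])
  have P: "?P \<in> H" by (rule Pl_mem[OF f0_mem])
  have nP: "(\<lambda>x. (-1) * ?P x) \<in> H" by (rule hip.scale_mem[OF P])
  have nrm_nP: "lip.nrm (\<lambda>x. (-1) * ?P x) = lip.nrm ?P" using lip.nrm_scale[OF P, of "-1"] by simp
  have le: "lip.nrm (\<lambda>x. d j x + \<theta> * ?P x) \<le> ?\<rho>" if j: "j \<in> {1..s}" for j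
  proof -
    interpret B: inner_form H "emp_form n Xp fst j p" by (rule inner_form_emp)
    have eq: "P_emp n Xp fst j p (\<lambda>x. d j x * g x) + lam * ip (d j) g = ilam (\<lambda>x. (-1) * ?P x) g" if g: "g \<in> H" for g
    proof -
      have "emp_form n Xp fst j p (d j) g
          = (\<Sum>i\<in>fst p j. f0 (snd p i) / real n * emp_form n Xp fst j p (?\<psi> i) g) - emp_form n Xp fst j p f0 g"
        unfolding d_def B.diff_left[OF S f0_mem g] by (subst B.lincomb_left) (auto simp: psi_mem g)
      also have "\<dots> = (\<Sum>i\<in>fst p j. f0 (snd p i) / real n * g (snd p i)) - emp_form n Xp fst j p f0 g"
        using psi_eq[OF p j _ g] by simp
      also have "\<dots> = - (lam * ip f0 g)"
        by (simp add: emp_form_def P_emp_def sum_divide_distrib)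
      also have "\<dots> = ilam (\<lambda>x. (-1) * ?P x) g"
        using lip.scale_left[OF P g, of "-1"] by (simp add: Pl_ipl f0_mem g)
      finally show ?thesis by (simp add: emp_form_def)
    qed
    note * = contraction[OF d nP, where n = n and X = Xp and I = fst and j = j and w = p and t = t, OF eq]
    have "lip.nrm (\<lambda>x. d j x - (-1) * ?P x) \<le> 2 * t * lip.nrm (\<lambda>x. (-1) * ?P x)"
      by (rule *(1); use t dev_le_max_xi[OF d _ j] in simp)
    moreover have "lip.nrm (d j) \<le> 2 * lip.nrm (\<lambda>x. (-1) * ?P x)"
      by (rule *(2); use t dev_le_max_xi[OF d _ j] in simp)
    ultimately show ?thesis using \<theta> unfolding nrm_nP by auto
  qed
  have un: "(\<Union>j\<in>{1..s}. fst p j) = {1..N}" using p by (auto simp: divisions_def)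
  \<comment> \<open>Blocks of equal size make the bias the plain mean of the block errors, so the
    triangle inequality costs no factor in \<open>s\<close>.\<close>
  have "bias \<theta> p = (\<lambda>x. \<Sum>j\<in>{1..s}. 1 / real s * (d j x + \<theta> * ?P x))"
  proof
    fix x
    have "(\<Sum>i\<in>{1..N}. f0 (snd p i) / real N * ?\<psi> i x) = (\<Sum>j\<in>{1..s}. \<Sum>i\<in>fst p j. f0 (snd p i) / real N * ?\<psi> i x)"
      unfolding un[symmetric] using p
      by (intro sum.UNION_disjoint) (auto simp: divisions_def disjoint_family_on_def intro: finite_subset)
    also have "\<dots> = (\<Sum>j\<in>{1..s}. 1 / real s * (\<Sum>i\<in>fst p j. f0 (snd p i) / real n * ?\<psi> i x))"
      using sizes by (simp add: sum_distrib_left mult.commute)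
    finally have "(\<Sum>i\<in>{1..N}. f0 (snd p i) / real N * ?\<psi> i x) = (\<Sum>j\<in>{1..s}. 1 / real s * (d j x + f0 x))"
      by (simp add: d_def)
    then show "bias \<theta> p x = (\<Sum>j\<in>{1..s}. 1 / real s * (d j x + \<theta> * ?P x))"
      using sizes(1) by (simp add: bias_def sum.distrib add_divide_distrib)
  qed
  then have "lip.nrm (bias \<theta> p) \<le> (\<Sum>j\<in>{1..s}. \<bar>1 / real s\<bar> * lip.nrm (\<lambda>x. d j x + \<theta> * ?P x))"
    using lip.nrm_lincomb[of "{1..s}" "\<lambda>j x. d j x + \<theta> * ?P x" "\<lambda>j. 1 / real s"]
    by (simp add: hip.add_mem hip.scale_mem d P)
  also have "\<dots> \<le> (\<Sum>j\<in>{1..s}. 1 / real s * ?\<rho>)"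
  proof (rule sum_mono)
    fix j assume "j \<in> {1..s}"
    then have "1 / real s * lip.nrm (\<lambda>x. d j x + \<theta> * ?P x) \<le> 1 / real s * ?\<rho>"
      by (intro mult_left_mono le) simp_all
    then show "\<bar>1 / real s\<bar> * lip.nrm (\<lambda>x. d j x + \<theta> * ?P x) \<le> 1 / real s * ?\<rho>" by simp
  qed
  also have "\<dots> = ?\<rho>" using sizes by simp
  finally show ?thesis .
qed

text \<open>The squared norm is a quadratic polynomial in the noise whose coefficients depend on the
  covariates. Its conditional expectation is bounded on the whole space first; the smallness of the
  deviation is used pointwise, in the resulting diagonal and bias terms.\<close>

lemma cond_exp_total:
  assumes \<theta>: "\<theta> = 0 \<or> \<theta> = 1"
    and u: "\<And>w. w \<in> space M \<Longrightarrow> u w = total \<theta> w"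
  shows "AE w in M. \<bar>\<xi> w\<bar> \<le> 1 / 2 \<longrightarrow>
    nn_cond_exp M (cov_algebra M X N s n I) (\<lambda>w. ennreal ((norm_lam dens ip lam (u w))\<^sup>2)) w
    \<le> ennreal (4 * (if \<theta> = 0 then 1 else (\<xi> w)\<^sup>2) * (c * C\<^sup>2 / (real N * bandwidth \<mu> lam) + lam * ip f0 f0))"
proof -
  let ?F = "cov_algebra M X N s n I"
  interpret F: sigma_finite_subalgebra M ?F by (rule cov_subalgebra[OF division])
  define q where "q i k p = ilam (coef \<theta> i p) (coef \<theta> k p)" for i k p
  define l where "l i p = 2 * ilam (coef \<theta> i p) (bias \<theta> p)" for i p
  define r where "r p = ilam (bias \<theta> p) (bias \<theta> p)" for p
  define U where "U w = (lip.nrm (total \<theta> w))\<^sup>2" for w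
  have \<theta>1: "\<bar>\<theta>\<bar> \<le> 1" using \<theta> by auto
  obtain L1 where L1: "0 \<le> L1" "\<And>i p. lip.nrm (coef \<theta> i p) \<le> L1"
  proof (rule that)
    show "0 \<le> sqrt (kap\<^sup>2 + lam) * (kap / lam) + sqrt (C\<^sup>2 / bandwidth \<mu> lam)"
      by (rule order_trans[OF lip.nrm_nonneg[OF coef_mem] coef_bound[OF \<theta>1]])
  qed (rule coef_bound[OF \<theta>1])
  obtain L2 where L2: "0 \<le> L2" "\<And>p. lip.nrm (bias \<theta> p) \<le> L2"
    using bias_bound by blast
  \<comment> \<open>The factor 2 is for the mixed terms \<open>l\<close>, which carry a 2 of their
    own.\<close>
  define L where "L = 2 * (L1 + L2)\<^sup>2"
  have bd: "\<bar>ilam a b\<bar> \<le> (L1 + L2)\<^sup>2" if "a \<in> H" "b \<in> H" "lip.nrm a \<le> L1 + L2" "lip.nrm b \<le> L1 + L2" for a b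
    unfolding power2_eq_square using L1(1) L2(1) that
    by (intro order_trans[OF lip.cauchy_schwarz[OF that(1,2)]] mult_mono lip.nrm_nonneg) auto
  have cb: "lip.nrm (coef \<theta> i p) \<le> L1 + L2" "lip.nrm (bias \<theta> p) \<le> L1 + L2" for i p
    using L1(1) L1(2)[of i p] L2(1) L2(2)[of p] by auto
  have L0: "(L1 + L2)\<^sup>2 \<le> L" by (simp add: L_def)
  have U_eq: "U w = (\<Sum>i=1..N. \<Sum>k=1..N. q i k (cov N I w) * (\<epsilon> i w * \<epsilon> k w))
      + (\<Sum>i=1..N. l i (cov N I w) * \<epsilon> i w) + r (cov N I w)" for w
  proof -
    let ?p = "cov N I w"
    let ?S = "\<lambda>x. \<Sum>i\<in>{1..N}. \<epsilon> i w * coef \<theta> i ?p x"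
    have S: "?S \<in> H" by (rule hip.lincomb_mem) (rule coef_mem)
    have "U w = ilam ?S ?S + 2 * ilam ?S (bias \<theta> ?p) + r ?p"
      unfolding U_def total_def r_def lip.nrm_sq[OF hip.add_mem[OF S bias_mem]]
      by (rule lip.sq_add[OF S bias_mem])
    also have "ilam ?S ?S = (\<Sum>i=1..N. \<Sum>k=1..N. q i k ?p * (\<epsilon> i w * \<epsilon> k w))"
      by (subst lip.lincomb_left, rule coef_mem, rule S, subst lip.lincomb_right)
        (auto simp: coef_mem q_def sum_distrib_left mult_ac)
    also have "2 * ilam ?S (bias \<theta> ?p) = (\<Sum>i=1..N. l i ?p * \<epsilon> i w)"
      by (subst lip.lincomb_left, rule coef_mem, rule bias_mem)
        (auto simp: l_def sum_distrib_left mult_ac)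
    finally show ?thesis .
  qed
  have "AE w in M. nn_cond_exp M ?F (\<lambda>w. ennreal (U w)) w \<le> ennreal (c * (\<Sum>i=1..N. q i i (cov N I w)) + r (cov N I w))"
  proof (rule quadratic_cond_exp[OF division, where q = q and l = l and r = r and L = L, OF _ _ _ _ _ _ _ U_eq])
    show "q i k \<in> borel_measurable (cov_space N s n)" if "i \<in> {1..N}" "k \<in> {1..N}" for i k
      unfolding q_def[abs_def] by (rule Hmeas_ipl[OF Hmeas_coef[OF that(1)] Hmeas_coef[OF that(2)]])
    show "l i \<in> borel_measurable (cov_space N s n)" if "i \<in> {1..N}" for i
      unfolding l_def[abs_def]
      by (intro borel_measurable_times borel_measurable_const Hmeas_ipl[OF Hmeas_coef[OF that] Hmeas_bias])
    show "r \<in> borel_measurable (cov_space N s n)"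
      unfolding r_def[abs_def] by (rule Hmeas_ipl[OF Hmeas_bias Hmeas_bias])
    show "\<bar>q i k p\<bar> \<le> L" for i k p
      unfolding q_def by (rule order_trans[OF bd L0]) (auto intro: coef_mem cb)
    show "\<bar>l i p\<bar> \<le> L" for i p
      using bd[OF coef_mem bias_mem cb(1) cb(2), of i p p] by (simp add: l_def L_def abs_mult)
    show "\<bar>r p\<bar> \<le> L" for p
      unfolding r_def by (rule order_trans[OF bd L0]) (auto intro: bias_mem cb)
    show "0 \<le> q i i p" for i p unfolding q_def by (rule lip.nonneg[OF coef_mem])
    show "0 \<le> U w" for w by (simp add: U_def)
  qed
  \<comment> \<open>\<open>u\<close> agrees with \<open>total\<close> on the sample space only; the
    measurability of its squared norm is inherited from the explicit polynomial.\<close>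
  moreover have "AE w in M. nn_cond_exp M ?F (\<lambda>w. ennreal ((norm_lam dens ip lam (u w))\<^sup>2)) w = nn_cond_exp M ?F (\<lambda>w. ennreal (U w)) w"
  proof -
    have eq: "ennreal (U w) = ennreal ((norm_lam dens ip lam (u w))\<^sup>2)" if "w \<in> space M" for w
      using u[OF that] by (simp add: U_def norm_lam_eq)
    have cm: "(\<lambda>w. v (cov N I w)) \<in> borel_measurable M" if "v \<in> borel_measurable (cov_space N s n)" for v :: "_ \<Rightarrow> real"
      by (rule measurable_compose[OF cov_measurable[OF division] that])
    have "U \<in> borel_measurable M"
      unfolding U_eq[abs_def] q_def l_def r_def
      by (intro borel_measurable_add borel_measurable_sum borel_measurable_times \<epsilon>_measurable borel_measurable_const
          cm Hmeas_ipl Hmeas_coef Hmeas_bias) auto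
    then have mU: "(\<lambda>w. ennreal (U w)) \<in> borel_measurable M" by simp
    then have "(\<lambda>w. ennreal ((norm_lam dens ip lam (u w))\<^sup>2)) \<in> borel_measurable M"
      by (rule measurable_cong[THEN iffD1, rotated]) (rule eq)
    with mU show ?thesis
      by (intro F.nn_cond_exp_cong) (auto simp: eq)
  qed
  moreover note AE_space
  ultimately show ?thesis
  proof eventually_elim
    case (elim w)
    show ?case
    proof
      assume xi: "\<bar>\<xi> w\<bar> \<le> 1 / 2"
      let ?p = "cov N I w" and ?h = "bandwidth \<mu> lam"
      define a where "a = (if \<theta> = 0 then 1 else \<bar>\<xi> w\<bar>)"
      have a0: "0 \<le> a" by (simp add: a_def)
      have p: "fst ?p \<in> divisions N s n" using I_division[OF elim(3)] by (simp add: cov_simps)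
      have t: "\<bar>\<xi> w\<bar> = \<bar>max_xi dens H ip lam s n Xp fst ?p\<bar>" by (simp add: max_xi_cov[OF elim(3)])
      have qi: "q i i ?p \<le> 4 * a\<^sup>2 * (C\<^sup>2 / ?h) / (real N)\<^sup>2" if i: "i \<in> {1..N}" for i
      proof -
        let ?K = "Kk (snd ?p i)"
        have "q i i ?p = (lip.nrm (coef \<theta> i ?p))\<^sup>2" by (simp add: q_def lip.nrm_sq coef_mem)
        also have "\<dots> \<le> (1 / real N * (2 * a * lip.nrm ?K))\<^sup>2"
          unfolding a_def by (intro power_mono coef_nrm_le[OF p \<theta> i t xi] lip.nrm_nonneg coef_mem)
        also have "\<dots> = 4 * a\<^sup>2 / (real N)\<^sup>2 * (lip.nrm ?K)\<^sup>2"
          by (simp add: power_mult_distrib power_divide)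
        also have "\<dots> \<le> 4 * a\<^sup>2 / (real N)\<^sup>2 * (C\<^sup>2 / ?h)"
          by (intro mult_left_mono Kk_nrm_sq) simp
        finally show ?thesis by (simp add: mult.commute)
      qed
      have ri: "r ?p \<le> 4 * a\<^sup>2 * (lam * ip f0 f0)"
      proof -
        have "r ?p = (lip.nrm (bias \<theta> ?p))\<^sup>2" by (simp add: r_def lip.nrm_sq bias_mem)
        also have "\<dots> \<le> (2 * a * lip.nrm (Pl f0))\<^sup>2"
          unfolding a_def by (intro power_mono bias_nrm_le[OF p \<theta> t xi] lip.nrm_nonneg bias_mem)
        also have "\<dots> = 4 * a\<^sup>2 * (lip.nrm (Pl f0))\<^sup>2" by (simp add: power_mult_distrib)
        also have "\<dots> \<le> 4 * a\<^sup>2 * (lam * ip f0 f0)"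
          by (intro mult_left_mono Pl_nrm_sq f0_mem) simp
        finally show ?thesis .
      qed
      have N0: "0 < N" using sizes by simp
      \<comment> \<open>There are \<open>N\<close> diagonal terms with a factor of one over the
        square of \<open>N\<close> each, whence the rate in the full sample size.\<close>
      have "c * (\<Sum>i=1..N. q i i ?p) \<le> c * (\<Sum>i=1..N. 4 * a\<^sup>2 * (C\<^sup>2 / ?h) / (real N)\<^sup>2)"
        by (intro mult_left_mono sum_mono qi c_nonneg) simp
      also have "\<dots> = 4 * a\<^sup>2 * (c * C\<^sup>2 / (real N * ?h))"
        using N0 by (simp add: power2_eq_square mult_ac)
      finally have le: "c * (\<Sum>i=1..N. q i i ?p) + r ?p \<le> 4 * a\<^sup>2 * (c * C\<^sup>2 / (real N * ?h) + lam * ip f0 f0)"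
        using ri by (simp add: distrib_left)
      have a2: "(if \<theta> = 0 then 1 else (\<xi> w)\<^sup>2) = a\<^sup>2" by (simp add: a_def)
      show "nn_cond_exp M ?F (\<lambda>w. ennreal ((norm_lam dens ip lam (u w))\<^sup>2)) w
          \<le> ennreal (4 * (if \<theta> = 0 then 1 else (\<xi> w)\<^sup>2) * (c * C\<^sup>2 / (real N * ?h) + lam * ip f0 f0))"
        unfolding elim(2) a2 by (rule order_trans[OF elim(1) ennreal_leI[OF le]])
    qed
  qed
qed

end

section \<open>From the conditional bounds to probabilities\<close>

context divide_conquer
begin

lemma \<xi>_measurable: "(\<lambda>w. \<xi> w) \<in> borel_measurable M"
proof -
  have "(\<lambda>w. max_xi dens H ip lam s n Xp fst (cov N I w)) \<in> borel_measurable M"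
    by (rule measurable_compose[OF cov_measurable[OF division] max_xi_measurable[OF sizes(1)]])
  then show ?thesis
    by (rule measurable_cong[THEN iffD1, rotated]) (simp add: max_xi_cov)
qed

text \<open>Both inequalities hold almost surely outside the event of large deviation, for each
  fixed \<open>N\<close>; the asymptotics concern only the probability of that event.\<close>

lemma prob_bounds:
  "1 - prob {w \<in> space M. 1 / 2 < \<bar>\<xi> w\<bar>} \<le> prob {w \<in> space M.
      nn_cond_exp M (cov_algebra M X N s n I)
          (\<lambda>w. ennreal ((norm_lam dens ip lam (remainder dens H ip \<mu> \<phi> lam N s n X Y I f0 w))\<^sup>2)) w
        \<le> ennreal (4 * (c * C\<^sup>2 / (real N * bandwidth \<mu> lam) + lam * ip f0 f0) * (\<xi> w)\<^sup>2) \<and>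
      nn_cond_exp M (cov_algebra M X N s n I)
          (\<lambda>w. ennreal ((norm_lam dens ip lam
             (\<lambda>x. avg_estimator H ip lam s n X Y I w x - f0 x))\<^sup>2)) w
        \<le> ennreal (4 * c * C\<^sup>2 / (real N * bandwidth \<mu> lam) + 8 * lam * ip f0 f0)}"
    (is "1 - prob ?B \<le> prob {w \<in> space M. ?R w \<and> ?E w}")
proof -
  note [measurable] = \<xi>_measurable
  have B: "?B \<in> events" by measurable
  have G: "{w \<in> space M. ?R w \<and> ?E w} \<in> events" by measurable
  have R: "remainder dens H ip \<mu> \<phi> lam N s n X Y I f0 w = total 1 w"
    "(\<lambda>x. avg_estimator H ip lam s n X Y I w x - f0 x) = total 0 w" if "w \<in> space M" for w
    using remainder_eq[OF that] .
  have "AE w in M. \<bar>\<xi> w\<bar> \<le> 1 / 2 \<longrightarrow> ?R w"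
    using cond_exp_total[of 1, OF _ R(1)] by (simp only: one_neq_zero if_False mult_ac simp_thms)
  moreover have "AE w in M. \<bar>\<xi> w\<bar> \<le> 1 / 2 \<longrightarrow>
      nn_cond_exp M (cov_algebra M X N s n I) (\<lambda>w. ennreal ((norm_lam dens ip lam
         (\<lambda>x. avg_estimator H ip lam s n X Y I w x - f0 x))\<^sup>2)) w
      \<le> ennreal (4 * (c * C\<^sup>2 / (real N * bandwidth \<mu> lam) + lam * ip f0 f0))"
    using cond_exp_total[of 0, OF _ R(2)] by simp
  moreover note AE_space
  ultimately have "AE w in M. w \<in> space M - ?B \<longrightarrow> w \<in> {w \<in> space M. ?R w \<and> ?E w}"
  proof eventually_elim
    case (elim w)
    show ?case
    proof
      assume "w \<in> space M - ?B"
      then have xi: "\<bar>\<xi> w\<bar> \<le> 1 / 2" using elim(3) by auto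
      have "?R w" using elim(1) xi by blast
      moreover have "?E w"
      proof (rule order_trans[OF elim(2)[rule_format, OF xi]])
        \<comment> \<open>The bound obtained carries 4 at the penalty term; raising it to 8 uses
          that this term is nonnegative.\<close>
        have "0 \<le> lam * ip f0 f0" using lam_pos hip.nonneg[OF f0_mem] by simp
        then show "ennreal (4 * (c * C\<^sup>2 / (real N * bandwidth \<mu> lam) + lam * ip f0 f0))
            \<le> ennreal (4 * c * C\<^sup>2 / (real N * bandwidth \<mu> lam) + 8 * lam * ip f0 f0)"
          by (intro ennreal_leI) (simp add: distrib_left mult.assoc)
      qed
      ultimately show "w \<in> {w \<in> space M. ?R w \<and> ?E w}" using elim(3) by simp
    qed
  qed
  then have "prob (space M - ?B) \<le> prob {w \<in> space M. ?R w \<and> ?E w}"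
    by (rule finite_measure_mono_AE[OF _ G])
  then show ?thesis using prob_compl[OF B] by simp
qed

end

text \<open>The ratio at \<open>k = 1\<close> bounds the tail by a finite multiple of
  \<open>\<mu> 1\<close>; if \<open>\<mu> 1\<close> is zero, monotonicity makes the whole sequence
  zero.\<close>

lemma summable_of_ratio:
  assumes nonneg: "\<And>i. 1 \<le> i \<Longrightarrow> 0 \<le> \<mu> i" and decr: "\<And>i j. 1 \<le> i \<Longrightarrow> i \<le> j \<Longrightarrow> \<mu> j \<le> \<mu> i"
    and ratio: "(SUP k\<in>{1..}. (\<Sum>i. ennreal (\<mu> (k + 1 + i))) / ennreal (real k * \<mu> k)) < \<infinity>"
  shows "summable (\<lambda>i. \<mu> (Suc i) :: real)"
proof (cases "\<mu> 1 = 0")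
  case True
  then have "\<mu> (Suc i) = 0" for i using nonneg[of "Suc i"] decr[of 1 "Suc i"] by simp
  then show ?thesis by simp
next
  case False
  then have pos: "0 < \<mu> 1" using nonneg[of 1] by simp
  have "(\<Sum>i. ennreal (\<mu> (1 + 1 + i))) / ennreal (real 1 * \<mu> 1) \<le> (SUP k\<in>{1..}. (\<Sum>i. ennreal (\<mu> (k + 1 + i))) / ennreal (real k * \<mu> k))"
    by (rule SUP_upper) simp
  then have "(\<Sum>i. ennreal (\<mu> (Suc (Suc i)))) / ennreal (\<mu> 1) < \<infinity>"
    using ratio by (simp add: order.strict_trans1)
  then have "(\<Sum>i. ennreal (\<mu> (Suc (Suc i)))) \<noteq> \<infinity>"
    using pos by (auto simp: ennreal_top_divide)
  then have "summable (\<lambda>i. \<mu> (Suc (Suc i)))"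
    using nonneg by (intro summable_suminf_not_top) auto
  then show ?thesis by (rule summable_Suc_iff[THEN iffD1])
qed

theorem theorem3p3:
  fixes M :: "'w measure" and D :: "(real ^ 'd) set"
    and dens sigma2 f0 :: "real ^ 'd \<Rightarrow> real"
    and H :: "(real ^ 'd \<Rightarrow> real) set"
    and ip :: "(real ^ 'd \<Rightarrow> real) \<Rightarrow> (real ^ 'd \<Rightarrow> real) \<Rightarrow> real"
    and \<mu> :: "nat \<Rightarrow> real" and \<phi> :: "nat \<Rightarrow> real ^ 'd \<Rightarrow> real"
    and X :: "nat \<Rightarrow> 'w \<Rightarrow> real ^ 'd" and Y :: "nat \<Rightarrow> 'w \<Rightarrow> real"
    and Ns :: "nat set" and s n :: "nat \<Rightarrow> nat" and lam h :: "nat \<Rightarrow> real"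
    and I :: "nat \<Rightarrow> 'w \<Rightarrow> nat \<Rightarrow> nat set"
    and c_pi c_phi a b :: real
  assumes space: "mercer_rkhs D dens H ip \<mu> \<phi>"
    and model: "regression_model M D dens sigma2 f0 X Y"
    and f0: "f0 \<in> H"
    and Ns: "infinite Ns"
    and sizes: "\<And>N. N \<in> Ns \<Longrightarrow> 0 < s N \<and> 0 < n N \<and> N = n N * s N"
    and lam: "\<And>N. N \<in> Ns \<Longrightarrow> 0 < lam N"
    and h: "\<And>N. N \<in> Ns \<Longrightarrow> h N = bandwidth \<mu> (lam N)"
    and division: "\<And>N. N \<in> Ns \<Longrightarrow> random_division M X Y N (s N) (n N) (I N)"
    and c_pi: "0 < c_pi"
    and i: "\<And>x. x \<in> D \<Longrightarrow> 0 \<le> dens x \<and> dens x \<le> c_pi \<and> 0 \<le> sigma2 x \<and> sigma2 x \<le> c_pi"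
    and ii_phi: "(SUP j\<in>{1..}. sup_norm D (\<phi> j)) < \<infinity>"
    and c_phi: "c_phi = enn2real (SUP j\<in>{1..}. sup_norm D (\<phi> j))"
    and ii_mu: "(SUP k\<in>{1..}. (\<Sum>i. ennreal (\<mu> (k + 1 + i))) / ennreal (real k * \<mu> k)) < \<infinity>"
    and ab: "0 \<le> a" "0 \<le> b"
    and iii: "big_OP M (along Ns)
        (\<lambda>N w. max_xi dens H ip (lam N) (s N) (n N) X (I N) w)
        (\<lambda>N. sqrt (ln (real N) powr b / (real (n N) * h N powr a)))"
    and iv: "(\<lambda>N. ln (real N) powr b) \<in> o[along Ns](\<lambda>N. real (n N) * h N powr a)"
  shows "((\<lambda>N. measure M {w \<in> space M.
      nn_cond_exp M (cov_algebra M X N (s N) (n N) (I N))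
          (\<lambda>w. ennreal ((norm_lam dens ip (lam N)
             (remainder dens H ip \<mu> \<phi> (lam N) N (s N) (n N) X Y (I N) f0 w))\<^sup>2)) w
        \<le> ennreal (4 * (c_pi * c_phi\<^sup>2 / (real N * h N) + lam N * ip f0 f0)
            * (max_xi dens H ip (lam N) (s N) (n N) X (I N) w)\<^sup>2) \<and>
      nn_cond_exp M (cov_algebra M X N (s N) (n N) (I N))
          (\<lambda>w. ennreal ((norm_lam dens ip (lam N)
             (\<lambda>x. avg_estimator H ip (lam N) (s N) (n N) X Y (I N) w x - f0 x))\<^sup>2)) w
        \<le> ennreal (4 * c_pi * c_phi\<^sup>2 / (real N * h N) + 8 * lam N * ip f0 f0)})
    \<longlongrightarrow> 1) (along Ns)"
proof -
  interpret mercer_rkhs D dens H ip \<mu> \<phi> by (rule space)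
  interpret regression_model M D dens sigma2 f0 X Y by (rule model)
  let ?\<xi> = "\<lambda>N w. max_xi dens H ip (lam N) (s N) (n N) X (I N) w"
  let ?r = "\<lambda>N. sqrt (ln (real N) powr b / (real (n N) * h N powr a))"
  have \<phi>_bound: "\<bar>\<phi> i x\<bar> \<le> c_phi" if "1 \<le> i" for i x
  proof (cases "x \<in> D")
    case True
    have "ennreal \<bar>\<phi> i x\<bar> \<le> sup_norm D (\<phi> i)"
      unfolding sup_norm_def by (rule SUP_upper[OF True])
    also have "\<dots> \<le> (SUP j\<in>{1..}. sup_norm D (\<phi> j))"
      by (rule SUP_upper) (use that in simp)
    \<comment> \<open>Finiteness of the supremum makes its conversion to a real number
      lossless.\<close>
    also have "\<dots> = ennreal c_phi"
      using ii_phi by (simp add: c_phi less_top)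
    finally show ?thesis by (simp add: c_phi)
  next
    case False
    then show ?thesis using \<phi>_vanish[OF that] by (simp add: c_phi)
  qed
  have law_prob: "prob_space (law dens)"
  proof -
    have "distributed M lborel (X 1) (\<lambda>x. ennreal (dens x))" by (rule X_dens) simp
    then have "distr M lborel (X 1) = law dens" "X 1 \<in> measurable M lborel"
      by (auto simp: law_def distributed_def)
    then show ?thesis using prob_space_distr by metis
  qed
  have m_summable: "summable m"
    using summable_of_ratio[OF \<mu>_nonneg \<mu>_decreasing ii_mu] by (simp add: m_def[abs_def])
  have dc: "divide_conquer M D dens sigma2 f0 X Y H ip \<mu> \<phi> c_phi (lam N) c_pi N (s N) (n N) (I N)"
    if N: "N \<in> Ns" for N
  proof (intro divide_conquer.intro divide_conquer_axioms.intro)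
    show "bounded_mercer D dens H ip \<mu> \<phi> c_phi (lam N)"
      by (intro bounded_mercer.intro bounded_mercer_axioms.intro space law_prob \<phi>_bound m_summable lam[OF N])
    have "f0 \<in> borel_measurable borel" using f0 H_L2 by (auto simp: L2_def)
    then show "bounded_noise M D dens sigma2 f0 X Y c_pi"
      by (intro bounded_noise.intro bounded_noise_axioms.intro model) (use i in blast)+
    show "0 < s N" "0 < n N" "N = n N * s N"
      using sizes[OF N] by blast+
  qed (use c_pi in \<open>simp_all add: f0 division[OF N]\<close>)
  have in_Ns: "\<forall>\<^sub>F N in along Ns. N \<in> Ns"
    by (simp add: along_def eventually_inf_principal)
  show ?thesis
    (is "((\<lambda>N. measure M (?G N)) \<longlongrightarrow> 1) (along Ns)")
  proof (rule tendstoI)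
    fix \<delta> :: real assume \<delta>: "0 < \<delta>"
    then obtain K where K: "0 < K"
      "\<forall>\<^sub>F N in along Ns. measure M {w \<in> space M. \<bar>?\<xi> N w\<bar> > K * ?r N} \<le> \<delta> / 2"
      using iii unfolding big_OP_def by (meson half_gt_zero)
    \<comment> \<open>The constant is chosen so that after the square root the threshold
      \<open>K * ?r N\<close> is at most 1/2.\<close>
    have "\<forall>\<^sub>F N in along Ns. norm (ln (real N) powr b) \<le> (1 / (2 * K))\<^sup>2 * norm (real (n N) * h N powr a)"
      using landau_o.smallD[OF iv, of "(1 / (2 * K))\<^sup>2"] K(1) by simp
    with K(2) in_Ns show "\<forall>\<^sub>F N in along Ns. dist (measure M (?G N)) 1 < \<delta>"
    proof eventually_elim
      case (elim N)
      interpret dc: divide_conquer M D dens sigma2 f0 X Y H ip \<mu> \<phi> c_phi "lam N" c_pi N "s N" "n N" "I N"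
        by (rule dc[OF elim(2)])
      \<comment> \<open>If the denominator is zero, the quotient is zero by convention and the bound
        holds as well.\<close>
      have "ln (real N) powr b / (real (n N) * h N powr a) \<le> (1 / (2 * K))\<^sup>2"
        using elim(3) by (cases "real (n N) * h N powr a = 0") (auto simp: pos_divide_le_eq abs_mult)
      then have "?r N \<le> 1 / (2 * K)"
        using real_sqrt_le_mono K(1) by fastforce
      then have Kr: "K * ?r N \<le> 1 / 2"
        using mult_left_mono[of "?r N" "1 / (2 * K)" K] K(1) by simp
      note [measurable] = dc.\<xi>_measurable
      have "prob {w \<in> space M. 1 / 2 < \<bar>?\<xi> N w\<bar>} \<le> prob {w \<in> space M. \<bar>?\<xi> N w\<bar> > K * ?r N}"
        using Kr by (intro finite_measure_mono) auto
      also have "\<dots> \<le> \<delta> / 2" by (rule elim(1))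
      finally have "1 - \<delta> / 2 \<le> measure M (?G N)"
        using dc.prob_bounds unfolding h[OF elim(2)] by linarith
      then show ?case
        using \<delta> prob_le_1[of "?G N"] by (simp add: dist_real_def)
    qed
  qed
qed

end
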